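(* Consider the continuous-time jump process on the finite directed graph $G=(V,E)$ with waiting time densities $\psi(\cdot\,|\,x\to y)$, let $\kappa(x)$ be the average time it stays at node $x$, and let $p$ and $q$ be the transition probabilities and the committor function (for disjoint nonempty $A,B\subset V$) of the associated discrete-time Markov jump process. Suppose that this discrete-time jump process is ergodic (irreducible and aperiodic) with unique invariant probability measure $m$. Then the reaction rate between $A$ and $B$, defined by $k_{AB}=\lim_{N\to+\infty}\frac{M(N)}{t_N}$, satisfies $$k_{AB}=\frac{\sum_{x\in A}\sum_{y\in V}m(x)\,p(y\,|\,x)\,q(y)}{\sum_{x\in V}m(x)\,\kappa(x)}.$$
   Context: $V=\{1,\dots,n\}$, $n>1$; $G=(V,E)$ is a directed graph without loop edges, $\mathcal N_x=\{y\in V:(x,y)\in E\}$ (nonempty for every $x$ in the ergodic case). $A,B\subset V$ are disjoint and nonempty with $(A\cup B)^c\ne\emptyset$. Process: for each edge $x\to y$, $\psi(\cdot\,|\,x\to y)$ is a probability density on $[0,+\infty)$, the density of the waiting time for the jump along $x\to y$; the jump events to different nodes of $\mathcal N_x$ are independent of each other, and from $x$ the process jumps along the edge whose waiting time is smallest, at that time. Thus $a(t\,|\,x)=\prod_{y\in\mathcal N_x}\int_t^{+\infty}\psi(u\,|\,x\to y)\,du$ is the probability of staying at $x$ longer than $t$, and $b(t,x\to y)=\Big(\prod_{z\in\mathcal N_x,z\ne y}\int_t^{+\infty}\psi(u\,|\,x\to z)\,du\Big)\psi(t\,|\,x\to y)$ is the probability density of jumping from $x$ to $y\in\mathcal N_x$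 at time $t$ after arriving at $x$. The average time spent at $x$ before leaving is $\kappa(x)=\int_0^{+\infty}a(u\,|\,x)\,du$. Set $p(y\,|\,x)=\int_0^{+\infty}b(u,x\to y)\,du$ for $y\in\mathcal N_x$ and $p(y\,|\,x)=0$ otherwise; $p$ is the transition matrix of the associated discrete-time Markov jump process on $V$. Committor: $q(x)=\mathbb P(\tau_{B,x}<\tau_{A,x})$ for $x\in V$, where $\tau_{A,x},\tau_{B,x}$ are the first hitting times (over $k\ge 0$) of $A,B$ by the discrete-time process started at $x$. An infinitely long trajectory of the continuous-time process is $\{(t_0,x_0),(t_1,x_1),\dots\}$ with $t_0=0$, $x_0\sim m$, where the process jumps from $x_i$ to $x_{i+1}$ at time $t_{i+1}$. Let $\tau_A^{(0)}=\tau_B^{(0)}=0$ and, for $k\ge0$, $\tau_A^{(k+1)}=\min\{l\ge\tau_B^{(k)}:x_l\in A\}$, $\tau_B^{(k+1)}=\min\{l\ge\tau_A^{(k+1)}:x_l\in B\}$. $M=M(N)>0$ is the integer with $\tau_B^{(M)}\le N<\tau_B^{(M+1)}$ (for $N$ large). *)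

theory Defs
  imports "HOL-Probability.Probability" "HOL-Library.Extended_Nat"
begin

text \<open>The node set is the finite type \<open>'v\<close>, and the nodes that can be reached from \<open>x\<close> in one
  jump are \<open>E `` {x}\<close>.  A density on \<open>[0, \<infinity>)\<close> is a function on the reals of which only the values
  on \<open>{0..}\<close> are ever used.\<close>

definition waiting_density :: "(real \<Rightarrow> real) \<Rightarrow> bool" where
  "waiting_density f \<longleftrightarrow> f \<in> borel_measurable borel \<and> (\<forall>t\<ge>0. 0 \<le> f t) \<and>
     (\<integral>\<^sup>+t\<in>{0..}. ennreal (f t) \<partial>lborel) = 1"

definition waiting_graph :: "('v::finite \<times> 'v) set \<Rightarrow> ('v \<Rightarrow> 'v \<Rightarrow> real \<Rightarrow> real) \<Rightarrow> bool" where
  "waiting_graph E \<psi> \<longleftrightarrow> irrefl E \<and> (\<forall>(x, y)\<in>E. waiting_density (\<psi> x y))"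

definition stay_prob ::
    "('v::finite \<times> 'v) set \<Rightarrow> ('v \<Rightarrow> 'v \<Rightarrow> real \<Rightarrow> real) \<Rightarrow> 'v \<Rightarrow> real \<Rightarrow> real" where
  "stay_prob E \<psi> x t = (\<Prod>y\<in>E `` {x}. LINT u:{t..}|lborel. \<psi> x y u)"

definition jump_density ::
    "('v::finite \<times> 'v) set \<Rightarrow> ('v \<Rightarrow> 'v \<Rightarrow> real \<Rightarrow> real) \<Rightarrow> 'v \<Rightarrow> 'v \<Rightarrow> real \<Rightarrow> real" where
  "jump_density E \<psi> x y t =
     (\<Prod>z\<in>E `` {x} - {y}. LINT u:{t..}|lborel. \<psi> x z u) * \<psi> x y t"

text \<open>The mean sojourn time may be infinite, hence the values in \<^typ>\<open>ennreal\<close>.\<close>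

definition mean_stay ::
    "('v::finite \<times> 'v) set \<Rightarrow> ('v \<Rightarrow> 'v \<Rightarrow> real \<Rightarrow> real) \<Rightarrow> 'v \<Rightarrow> ennreal" where
  "mean_stay E \<psi> x = (\<integral>\<^sup>+u\<in>{0..}. ennreal (stay_prob E \<psi> x u) \<partial>lborel)"

definition trans_prob ::
    "('v::finite \<times> 'v) set \<Rightarrow> ('v \<Rightarrow> 'v \<Rightarrow> real \<Rightarrow> real) \<Rightarrow> 'v \<Rightarrow> 'v \<Rightarrow> real" where
  "trans_prob E \<psi> x y =
     (if (x, y) \<in> E then LINT u:{0..}|lborel. jump_density E \<psi> x y u else 0)"


primrec nstep_prob :: "('v::finite \<Rightarrow> 'v \<Rightarrow> real) \<Rightarrow> nat \<Rightarrow> 'v \<Rightarrow> 'v \<Rightarrow> real" where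
  "nstep_prob p 0 x y = (if x = y then 1 else 0)"
| "nstep_prob p (Suc n) x y = (\<Sum>z\<in>UNIV. p x z * nstep_prob p n z y)"

definition irreducible_chain :: "('v::finite \<Rightarrow> 'v \<Rightarrow> real) \<Rightarrow> bool" where
  "irreducible_chain p \<longleftrightarrow> (\<forall>x y. \<exists>n. nstep_prob p n x y > 0)"

definition aperiodic_chain :: "('v::finite \<Rightarrow> 'v \<Rightarrow> real) \<Rightarrow> bool" where
  "aperiodic_chain p \<longleftrightarrow> (\<forall>x. Gcd {n. n > 0 \<and> nstep_prob p n x x > 0} = 1)"

definition ergodic_chain :: "('v::finite \<Rightarrow> 'v \<Rightarrow> real) \<Rightarrow> bool" where
  "ergodic_chain p \<longleftrightarrow> irreducible_chain p \<and> aperiodic_chain p"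

definition invariant_dist :: "('v::finite \<Rightarrow> 'v \<Rightarrow> real) \<Rightarrow> 'v pmf \<Rightarrow> bool" where
  "invariant_dist p m \<longleftrightarrow> (\<forall>y. (\<Sum>x\<in>UNIV. pmf m x * p x y) = pmf m y)"

text \<open>The law on path space of the Markov chain with transition matrix \<open>p\<close> started at \<open>x\<close>, by the
  Ionescu-Tulcea construction.  Lemma \<open>chain_law_cylinder\<close> below gives its finite-dimensional
  distributions when \<open>p\<close> is stochastic.\<close>

definition chain_kernel ::
    "('v::finite \<Rightarrow> 'v \<Rightarrow> real) \<Rightarrow> 'v \<Rightarrow> nat \<Rightarrow> (nat \<Rightarrow> 'v) \<Rightarrow> 'v measure" where
  "chain_kernel p x n \<omega> = (case n of
       0 \<Rightarrow> return (count_space UNIV) x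
     | Suc k \<Rightarrow> point_measure UNIV (\<lambda>y. ennreal (p (\<omega> k) y)))"

definition chain_law :: "('v::finite \<Rightarrow> 'v \<Rightarrow> real) \<Rightarrow> 'v \<Rightarrow> (nat \<Rightarrow> 'v) measure" where
  "chain_law p x = projective_family.lim UNIV
     (Ionescu_Tulcea.CI (chain_kernel p x) (\<lambda>_. count_space UNIV)) (\<lambda>_. count_space UNIV)"

text \<open>Hitting times are \<open>\<infinity>\<close> for a path that has no further visit to \<open>S\<close>.\<close>

definition next_visit :: "'v set \<Rightarrow> (nat \<Rightarrow> 'v) \<Rightarrow> enat \<Rightarrow> enat" where
  "next_visit S \<omega> s = (INF l\<in>{l. s \<le> enat l \<and> \<omega> l \<in> S}. enat l)"

definition hitting_time :: "'v set \<Rightarrow> (nat \<Rightarrow> 'v) \<Rightarrow> enat" where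
  "hitting_time S \<omega> = next_visit S \<omega> 0"

definition committor ::
    "('v::finite \<Rightarrow> 'v \<Rightarrow> real) \<Rightarrow> 'v set \<Rightarrow> 'v set \<Rightarrow> 'v \<Rightarrow> real" where
  "committor p A B x = measure (chain_law p x)
     {\<omega> \<in> space (chain_law p x). hitting_time B \<omega> < hitting_time A \<omega>}"


text \<open>With \<open>\<tau>\<^sub>B\<^sup>(\<^sup>k\<^sup>)\<close> = \<open>reaction_time A B \<omega> k\<close>, the intermediate time \<open>\<tau>\<^sub>A\<^sup>(\<^sup>k\<^sup>+\<^sup>1\<^sup>)\<close> is
  \<open>next_visit A \<omega> (reaction_time A B \<omega> k)\<close>.\<close>

primrec reaction_time :: "'v set \<Rightarrow> 'v set \<Rightarrow> (nat \<Rightarrow> 'v) \<Rightarrow> nat \<Rightarrow> enat" where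
  "reaction_time A B \<omega> 0 = 0"
| "reaction_time A B \<omega> (Suc k) = next_visit B \<omega> (next_visit A \<omega> (reaction_time A B \<omega> k))"

definition reaction_count :: "'v set \<Rightarrow> 'v set \<Rightarrow> (nat \<Rightarrow> 'v) \<Rightarrow> nat \<Rightarrow> nat" where
  "reaction_count A B \<omega> N =
     (THE M. reaction_time A B \<omega> M \<le> enat N \<and> enat N < reaction_time A B \<omega> (Suc M))"


text \<open>\<open>X i\<close> is the node reached by the \<open>i\<close>-th jump, and \<open>W i y\<close> is the waiting time, counted from
  the arrival at \<open>X i\<close>, of the jump along the edge from \<open>X i\<close> to \<open>y\<close> (irrelevant unless
  \<open>y \<in> E `` {X i}\<close>).\<close>

definition jump_time :: "(nat \<Rightarrow> 'w \<Rightarrow> 'v) \<Rightarrow> (nat \<Rightarrow> 'v \<Rightarrow> 'w \<Rightarrow> real) \<Rightarrow> nat \<Rightarrow> 'w \<Rightarrow> real" where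
  "jump_time X W n \<omega> = (\<Sum>i<n. W i (X (Suc i) \<omega>) \<omega>)"

text \<open>Assumption \<open>clocks\<close>: given the trajectory up to the arrival at \<open>X i\<close>, the waiting times along
  the edges leaving \<open>X i\<close> are independent, with densities \<open>\<psi> (X i) y\<close>.  The events used for the past
  form a generator, stable under intersection, of the natural filtration of the trajectory.\<close>

locale jump_process = prob_space P
  for P :: "'w measure" +
  fixes E :: "('v::finite \<times> 'v) set"
    and \<psi> :: "'v \<Rightarrow> 'v \<Rightarrow> real \<Rightarrow> real"
    and m :: "'v pmf"
    and X :: "nat \<Rightarrow> 'w \<Rightarrow> 'v"
    and W :: "nat \<Rightarrow> 'v \<Rightarrow> 'w \<Rightarrow> real"
  assumes X_measurable: "X i \<in> measurable P (count_space UNIV)"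
    and W_measurable: "W i y \<in> borel_measurable P"
    and start: "distr P (count_space UNIV) (X 0) = measure_pmf m"
    and clocks: "\<lbrakk>\<And>j. D j \<in> sets borel; \<And>y. C y \<in> sets borel\<rbrakk> \<Longrightarrow>
      measure P {\<omega> \<in> space P. (\<forall>j\<le>i. X j \<omega> = x j \<and> jump_time X W j \<omega> \<in> D j)
                              \<and> (\<forall>y\<in>E `` {x i}. W i y \<omega> \<in> C y)}
      = measure P {\<omega> \<in> space P. \<forall>j\<le>i. X j \<omega> = x j \<and> jump_time X W j \<omega> \<in> D j}
        * (\<Prod>y\<in>E `` {x i}. LINT u:C y \<inter> {0..}|lborel. \<psi> (x i) y u)"
    and jump: "AE \<omega> in P. is_arg_min (\<lambda>y. W i y \<omega>) (\<lambda>y. y \<in> E `` {X i \<omega>}) (X (Suc i) \<omega>)"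


lemma next_visit_ge: "s \<le> next_visit S \<omega> s"
  by (auto simp: next_visit_def intro: INF_greatest)

lemma next_visit_enat:
  assumes "next_visit S \<omega> s = enat l"
  shows "s \<le> enat l" "\<omega> l \<in> S"
proof -
  let ?K = "enat ` {l. s \<le> enat l \<and> \<omega> l \<in> S}"
  have "?K \<noteq> {}"
    using assms by (force simp: next_visit_def Inf_enat_def)
  then have "Inf ?K \<in> ?K"
    unfolding Inf_enat_def by (auto intro: LeastI)
  then show "s \<le> enat l" "\<omega> l \<in> S"
    using assms by (auto simp: next_visit_def)
qed

lemma reaction_time_less_Suc:
  assumes "A \<inter> B = {}" "reaction_time A B \<omega> k = enat n"
  shows "reaction_time A B \<omega> k < reaction_time A B \<omega> (Suc k)"
proof -
  let ?a = "next_visit A \<omega> (reaction_time A B \<omega> k)"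
  let ?b = "next_visit B \<omega> ?a"
  have le: "reaction_time A B \<omega> k \<le> ?a" "?a \<le> ?b"
    by (rule next_visit_ge)+
  have "?a \<noteq> ?b \<or> ?b = \<infinity>"
  proof (cases ?b)
    case (enat l)
    then show ?thesis
      using next_visit_enat[OF enat] assms(1) next_visit_enat(2)[of A \<omega> "reaction_time A B \<omega> k" l] by auto
  qed auto
  then show ?thesis
    using le assms(2) order_le_less_trans[of "reaction_time A B \<omega> k" ?a ?b]
    by (cases "?b = \<infinity>") auto
qed

text \<open>\<open>reaction_count\<close> is well defined along every path.\<close>

lemma reaction_count_ex1:
  assumes "A \<inter> B = {}"
  shows "\<exists>!M. reaction_time A B \<omega> M \<le> enat N \<and> enat N < reaction_time A B \<omega> (Suc M)"
proof -
  let ?r = "reaction_time A B \<omega>"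
  have mono: "?r k \<le> ?r (Suc k)" for k
    by (auto intro: order_trans next_visit_ge)
  then have mono': "i \<le> j \<Longrightarrow> ?r i \<le> ?r j" for i j
    by (rule lift_Suc_mono_le)
  have ge: "enat k \<le> ?r k" for k
  proof (induction k)
    case (Suc k)
    show ?case
    proof (cases "?r k")
      case (enat n)
      then show ?thesis
        using reaction_time_less_Suc[OF assms enat] Suc
        by (metis Suc_ile_eq order_le_less_trans)
    next
      case infinity
      then show ?thesis
        using mono[of k] by simp
    qed
  qed (simp add: zero_enat_def)
  define M where "M = (LEAST M. enat N < ?r (Suc M))"
  have "enat N < ?r (Suc N)"
    by (rule less_le_trans[OF _ ge]) simp
  then have M: "enat N < ?r (Suc M)"
    unfolding M_def by (rule LeastI)
  have "?r M \<le> enat N"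
  proof (cases M)
    case (Suc K)
    then show ?thesis
      using not_less_Least[of K "\<lambda>M. enat N < ?r (Suc M)"] by (auto simp: M_def)
  qed (simp add: zero_enat_def)
  moreover have "K = M" if "?r K \<le> enat N" "enat N < ?r (Suc K)" for K
    using that M \<open>?r M \<le> enat N\<close> mono'[of "Suc K" M] mono'[of "Suc M" K]
    by (metis not_less_eq_eq linorder_not_less nle_le order_trans)
  ultimately show ?thesis
    using M by blast
qed

lemma Ionescu_Tulcea_chain_kernel:
  assumes nonneg: "\<And>x y. 0 \<le> p x y" and sum1: "\<And>x. (\<Sum>y\<in>UNIV. p x y) = 1"
  shows "Ionescu_Tulcea (chain_kernel p x) (\<lambda>_. count_space UNIV)"
proof (rule Ionescu_Tulcea.intro)
  have pm: "prob_space (point_measure UNIV (\<lambda>y. ennreal (p z y)))" for z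
    by (rule prob_spaceI)
      (simp add: space_point_measure emeasure_point_measure_finite nonneg sum1 sum_nonneg)
  then show "prob_space (chain_kernel p x i \<omega>)" for i \<omega>
    by (auto simp: chain_kernel_def split: nat.split intro: prob_space_return)
  have sub: "point_measure UNIV (\<lambda>y. ennreal (p z y)) \<in> space (subprob_algebra (count_space UNIV))" for z
    using pm[of z] by (auto simp: space_subprob_algebra sets_point_measure intro: prob_space_imp_subprob_space)
  show "chain_kernel p x i \<in> measurable (PiM {0..<i} (\<lambda>_. count_space UNIV))
      (subprob_algebra (count_space UNIV))" for i
  proof (cases i)
    case 0
    have "chain_kernel p x 0 = (\<lambda>_. return (count_space UNIV) x)"
      by (simp add: chain_kernel_def fun_eq_iff)
    moreover have "return (count_space UNIV) x \<in> space (subprob_algebra (count_space UNIV))"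
      by (rule measurable_space[OF return_measurable]) simp
    ultimately show ?thesis
      using 0 by simp
  next
    case (Suc k)
    have "(\<lambda>\<omega>. \<omega> k) \<in> measurable (PiM {0..<i} (\<lambda>_. count_space UNIV)) (count_space UNIV)"
      using Suc by (intro measurable_component_singleton) auto
    moreover have "(\<lambda>z. point_measure UNIV (\<lambda>y. ennreal (p z y)))
        \<in> measurable (count_space UNIV) (subprob_algebra (count_space UNIV))"
      using sub by (intro measurable_count_space_eq1[THEN iffD2]) auto
    ultimately have "(\<lambda>\<omega>. point_measure UNIV (\<lambda>y. ennreal (p (\<omega> k) y)))
        \<in> measurable (PiM {0..<i} (\<lambda>_. count_space UNIV)) (subprob_algebra (count_space UNIV))"
      by (rule measurable_compose)
    moreover have "chain_kernel p x i = (\<lambda>\<omega>. point_measure UNIV (\<lambda>y. ennreal (p (\<omega> k) y)))"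
      using Suc by (simp add: chain_kernel_def fun_eq_iff)
    ultimately show ?thesis
      by simp
  qed
qed

lemma chain_law_cylinder:
  assumes nonneg: "\<And>x y. 0 \<le> p x y" and sum1: "\<And>x. (\<Sum>y\<in>UNIV. p x y) = 1"
  shows "measure (chain_law p x) {\<omega> \<in> space (chain_law p x). \<forall>i\<le>n. \<omega> i = z i}
       = (if z 0 = x then \<Prod>i<n. p (z i) (z (Suc i)) else 0)"
proof -
  let ?M = "\<lambda>_::nat. count_space (UNIV :: 'a set)"
  interpret IT: Ionescu_Tulcea "chain_kernel p x" ?M
    by (rule Ionescu_Tulcea_chain_kernel[OF assms])
  let ?Z = "\<lambda>n. {restrict z {0..<n}}"
  have Z: "?Z n = PiE {0..<n} (\<lambda>i. {z i})" for n
    by (auto simp: PiE_def Pi_def extensional_def restrict_def fun_eq_iff)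
  have Z_sets[measurable]: "?Z n \<in> sets (PiM {0..<n} ?M)" for n
    unfolding Z by (intro sets_PiM_I_finite) auto
  have C: "emeasure (IT.C 0 (Suc n) (\<lambda>_. undefined)) (?Z (Suc n))
    = ennreal (if z 0 = x then \<Prod>i<n. p (z i) (z (Suc i)) else 0)" for n
  proof (induction n)
    case 0
    have u: "(\<lambda>_. undefined) \<in> space (PiM {0..<0} ?M)"
      by (simp add: space_PiM)
    have "IT.C 0 (Suc 0) (\<lambda>_. undefined) = IT.eP 0 (\<lambda>_. undefined)"
      unfolding IT.C.simps add_0 by (rule bind_return[OF IT.measurable_eP u])
    moreover have "{y. (\<lambda>_. undefined)(0 := y) = restrict z {0..<Suc 0}} = {z 0}"
      by (auto simp: restrict_def fun_eq_iff)
    moreover have "chain_kernel p x 0 (\<lambda>_. undefined) = return (count_space UNIV) x"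
      by (simp add: chain_kernel_def)
    ultimately show ?case
      by (auto simp only: IT.emeasure_eP[OF u Z_sets] vimage_def singleton_iff) simp
  next
    case (Suc n)
    let ?C = "IT.C 0 (Suc n) (\<lambda>_. undefined)"
    have sp: "(\<lambda>_. undefined) \<in> space (PiM {0..<0} ?M)"
      by (simp add: space_PiM)
    have K: "emeasure (IT.eP (Suc n) \<omega>) (?Z (Suc (Suc n)))
        = ennreal (p (z n) (z (Suc n))) * indicator (?Z (Suc n)) \<omega>"
      if \<omega>: "\<omega> \<in> space (PiM {0..<Suc n} ?M)" for \<omega>
    proof -
      have upd: "fun_upd \<omega> (Suc n) y = restrict z {0..<Suc (Suc n)}
          \<longleftrightarrow> \<omega> = restrict z {0..<Suc n} \<and> y = z (Suc n)" for y
        using \<omega> by (auto simp: space_PiM PiE_def extensional_def restrict_def fun_eq_iff less_Suc_eq)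
      have "emeasure (IT.eP (Suc n) \<omega>) (?Z (Suc (Suc n)))
          = emeasure (chain_kernel p x (Suc n) \<omega>) {y. fun_upd \<omega> (Suc n) y = restrict z {0..<Suc (Suc n)}}"
        using \<omega> by (subst IT.emeasure_eP) (auto intro!: arg_cong2[where f=emeasure] Z_sets)
      also have "\<dots> = ennreal (p (z n) (z (Suc n))) * indicator (?Z (Suc n)) \<omega>"
        unfolding upd
        by (auto simp: chain_kernel_def emeasure_point_measure_finite split: split_indicator)
      finally show ?thesis .
    qed
    have "emeasure (IT.C 0 (Suc (Suc n)) (\<lambda>_. undefined)) (?Z (Suc (Suc n)))
        = (\<integral>\<^sup>+\<omega>. emeasure (IT.eP (Suc n) \<omega>) (?Z (Suc (Suc n))) \<partial>?C)"
      unfolding IT.C.simps(2)[of 0 "Suc n"] add_0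
    proof (rule emeasure_bind)
      show "space ?C \<noteq> {}"
        by (rule prob_space.not_empty[OF IT.prob_space_C[OF sp]])
      show "IT.eP (Suc n) \<in> measurable ?C (subprob_algebra (PiM {0..<Suc (Suc n)} ?M))"
        using IT.measurable_eP[of "Suc n"]
        by (simp only: measurable_cong_sets[OF IT.sets_C[OF sp, of "Suc n", unfolded add_0] refl])
    qed (rule Z_sets)
    also have "\<dots> = (\<integral>\<^sup>+\<omega>. ennreal (p (z n) (z (Suc n))) * indicator (?Z (Suc n)) \<omega> \<partial>?C)"
      by (rule nn_integral_cong, rule K) (simp only: IT.space_C[OF sp, of "Suc n", unfolded add_0])
    also have "\<dots> = ennreal (p (z n) (z (Suc n))) * emeasure ?C (?Z (Suc n))"
      using Z_sets[of "Suc n"] by (intro nn_integral_cmult_indicator)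
        (simp only: IT.sets_C[OF sp, of "Suc n", unfolded add_0])
    also have "\<dots> = ennreal (if z 0 = x then \<Prod>i<Suc n. p (z i) (z (Suc i)) else 0)"
      unfolding Suc.IH by (auto simp: ennreal_mult'[symmetric] nonneg mult.commute)
    finally show ?case .
  qed
  have "{\<omega> \<in> space (chain_law p x). \<forall>i\<le>n. \<omega> i = z i} = prod_emb UNIV ?M {0..<Suc n} (?Z (Suc n))"
    by (auto simp: chain_law_def prod_emb_def space_PiM restrict_def fun_eq_iff less_Suc_eq_le)
       (metis less_Suc_eq_le)
  then have "emeasure (chain_law p x) {\<omega> \<in> space (chain_law p x). \<forall>i\<le>n. \<omega> i = z i}
      = emeasure (IT.CI {0..<Suc n}) (?Z (Suc n))"
    unfolding chain_law_def by (simp only: IT.lim[OF finite_atLeastLessThan Z_sets])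
  also have "\<dots> = emeasure (IT.C 0 (Suc n) (\<lambda>_. undefined)) (?Z (Suc n))"
    using Z_sets[of "Suc n"] sets.sets_into_space[OF Z_sets[of "Suc n"]]
    by (subst IT.emeasure_CI[of _ "Suc n"]) (auto simp: prod_emb_id)
  finally show ?thesis
    unfolding C by (auto simp: measure_def nonneg prod_nonneg)
qed

end

(*
A reaction is counted at a visit of B whenever the last earlier visit of A \<union> B was in A.  Let s n be the
indicator of this situation at time n (a function of the past).  As q is harmonic off A \<union> B, 0 on A and 1
on B, the increments s n * (q (X (n+1)) - (p q) (X n)) sum up to the number of reactions minus the sum
of (p q) (X n) over the visits of A, up to a bounded error.  They are bounded martingale
differences, hence orthogonal, hence have averages tending to 0.  The same orthogonality argument shows
that the occupation frequencies are asymptotically invariant, so they converge to the only invariant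
distribution m.  Together this gives M(N)/N.

For t_N/N, sojourn times truncated at a constant c are treated in the same way, which gives the lower
bound, also when the mean is infinite.  For the upper bound the excess over c is truncated at 2^n on the
first 2^n jumps.
*)

theory Submission
  imports Defs "HOL-Library.Discrete_Functions"
begin

section \<open>Averages of orthogonal variables\<close>

text \<open>The assumption \<open>clocks\<close> speaks of cylinder events only, whereas centring
  has to be tested on every event of the past; the pi-lambda theorem extends it to the sigma-algebra
  \<open>past i\<close>, after which integrals over past events are explicit finite sums over the
  nodes. Orthogonality needs second moments, which sojourn times may lack; this forces the
  truncations. The level 2^n for the first 2^n jumps is chosen because the average of the centred
  truncated excesses then has a second moment controlled by the expectation of (min u 2^n)^2 / 2^n.
  Summed over n, these quotients are at most 4 u pointwise, so a finite first moment suffices.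
  Controlling the excess at dyadic times only loses a factor 2 at the other times. This is harmless:
  the factor multiplies the mean excess over c, which tends to 0 as c grows. The limit of the
  occupation frequencies is identified by compactness: they lie in a finite-dimensional simplex, and
  each limit point is an invariant distribution.\<close>

text \<open>Takes the place of Chebyshev's inequality with Borel-Cantelli: the series of the
  \<open>f n\<close> has a finite integral, so it converges almost surely and its terms vanish in
  the limit.\<close>

lemma AE_tendsto_zero_if_suminf_expectation_finite:
  fixes f :: "nat \<Rightarrow> 'a \<Rightarrow> real"
  assumes [measurable]: "\<And>n. f n \<in> borel_measurable M" and nonneg: "\<And>n x. 0 \<le> f n x"
    and fin: "(\<Sum>n. \<integral>\<^sup>+x. ennreal (f n x) \<partial>M) < \<infinity>"
  shows "AE x in M. (\<lambda>n. f n x) \<longlonglongrightarrow> 0"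
proof -
  have "(\<integral>\<^sup>+x. (\<Sum>n. ennreal (f n x)) \<partial>M) \<noteq> \<infinity>"
    using fin by (subst nn_integral_suminf) auto
  then have "AE x in M. (\<Sum>n. ennreal (f n x)) \<noteq> \<infinity>"
    by (intro nn_integral_PInf_AE) auto
  then show ?thesis
    by eventually_elim (auto intro!: summable_LIMSEQ_zero summable_suminf_not_top nonneg)
qed

context prob_space
begin

lemma expectation_sum_square_orthogonal:
  fixes Z :: "nat \<Rightarrow> 'a \<Rightarrow> real"
  assumes [measurable]: "\<And>i. Z i \<in> borel_measurable M" and bound: "\<And>i x. \<bar>Z i x\<bar> \<le> C"
    and orth: "\<And>i j. i < j \<Longrightarrow> expectation (\<lambda>x. Z i x * Z j x) = 0"
  shows "expectation (\<lambda>x. (\<Sum>i<n. Z i x)\<^sup>2) = (\<Sum>i<n. expectation (\<lambda>x. (Z i x)\<^sup>2))"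
proof (induction n)
  case (Suc n)
  have C: "0 \<le> C"
    using bound[of 0 undefined] by linarith
  have int[simp]: "integrable M (\<lambda>x. Z i x * Z j x)" for i j
    by (rule integrable_const_bound[of _ "C * C"])
      (auto intro!: AE_I2 mult_mono bound C simp: abs_mult)
  have sq[simp]: "integrable M (\<lambda>x. (\<Sum>i<n. Z i x)\<^sup>2)" "integrable M (\<lambda>x. (Z i x)\<^sup>2)" for i
    by (simp_all add: power2_eq_square sum_product)
  have "(\<Sum>i<Suc n. Z i x)\<^sup>2
      = (\<Sum>i<n. Z i x)\<^sup>2 + (2 * (\<Sum>i<n. Z i x * Z n x) + (Z n x)\<^sup>2)" for x
    by (simp add: power2_sum sum_distrib_right)
  then have "expectation (\<lambda>x. (\<Sum>i<Suc n. Z i x)\<^sup>2)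
      = expectation (\<lambda>x. (\<Sum>i<n. Z i x)\<^sup>2)
        + (2 * (\<Sum>i<n. expectation (\<lambda>x. Z i x * Z n x)) + expectation (\<lambda>x. (Z n x)\<^sup>2))"
    by simp
  then show ?case
    by (simp add: Suc.IH orth)
qed simp

text \<open>Along the squares the second moments are summable, and boundedness of the increments
  fills the gaps between consecutive squares.\<close>

lemma bounded_orthogonal_law_of_large_numbers:
  fixes Z :: "nat \<Rightarrow> 'a \<Rightarrow> real"
  assumes [measurable]: "\<And>i. Z i \<in> borel_measurable M" and bound: "\<And>i x. \<bar>Z i x\<bar> \<le> C"
    and orth: "\<And>i j. i < j \<Longrightarrow> expectation (\<lambda>x. Z i x * Z j x) = 0"
  shows "AE x in M. (\<lambda>n. (\<Sum>i<n. Z i x) / real n) \<longlonglongrightarrow> 0"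
proof -
  define S where "S n x = (\<Sum>i<n. Z i x)" for n x
  have [measurable]: "S n \<in> borel_measurable M" for n
    unfolding S_def by measurable
  have C: "0 \<le> C"
    using bound[of 0 undefined] by linarith
  have S_bound: "\<bar>S n x - S k x\<bar> \<le> C * real (n - k)" if "k \<le> n" for n k x
  proof -
    have "S n x - S k x = (\<Sum>i\<in>{k..<n}. Z i x)"
      using that unfolding S_def by (simp add: sum_diff_nat_ivl lessThan_atLeast0)
    also have "\<bar>\<dots>\<bar> \<le> (\<Sum>i\<in>{k..<n}. C)"
      by (rule order_trans[OF sum_abs sum_mono]) (rule bound)
    finally show ?thesis
      by (simp add: mult.commute)
  qed
  have Z2: "integrable M (\<lambda>x. (Z i x)\<^sup>2)" "expectation (\<lambda>x. (Z i x)\<^sup>2) \<le> C\<^sup>2" for i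
  proof -
    have le: "(Z i x)\<^sup>2 \<le> C\<^sup>2" for x
      using bound[of i x] by (metis abs_le_square_iff abs_of_nonneg C)
    then show int: "integrable M (\<lambda>x. (Z i x)\<^sup>2)"
      by (intro integrable_const_bound[of _ "C\<^sup>2"]) auto
    show "expectation (\<lambda>x. (Z i x)\<^sup>2) \<le> C\<^sup>2"
      using integral_mono[OF int integrable_const[of "C\<^sup>2"]] le by (simp add: prob_space)
  qed
  have S_int: "integrable M (\<lambda>x. (S n x)\<^sup>2)" for n
  proof (rule integrable_const_bound[of _ "(C * real n)\<^sup>2"])
    have "\<bar>S n x\<bar> \<le> C * real n" for x
      using S_bound[of 0 n x] by (simp add: S_def)
    then have "(S n x)\<^sup>2 \<le> (C * real n)\<^sup>2" for x
      by (metis abs_le_square_iff abs_of_nonneg C mult_nonneg_nonneg of_nat_0_le_iff)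
    then show "AE x in M. norm ((S n x)\<^sup>2) \<le> (C * real n)\<^sup>2"
      by simp
  qed simp
  have S2: "expectation (\<lambda>x. (S n x)\<^sup>2) \<le> C\<^sup>2 * real n" for n
  proof -
    have "expectation (\<lambda>x. (S n x)\<^sup>2) = (\<Sum>i<n. expectation (\<lambda>x. (Z i x)\<^sup>2))"
      unfolding S_def by (rule expectation_sum_square_orthogonal[OF assms])
    also have "\<dots> \<le> (\<Sum>i<n. C\<^sup>2)"
      by (intro sum_mono Z2)
    finally show ?thesis
      by (simp add: mult.commute)
  qed
  \<comment> \<open>The average of n terms has second moment at most C^2 / n, which is not summable
    over n but is so along n = k^2.\<close>
  have sq: "(\<integral>\<^sup>+x. ennreal ((S (k\<^sup>2) x / real (k\<^sup>2))\<^sup>2) \<partial>M) \<le> ennreal (C\<^sup>2 / (real k)\<^sup>2)" for k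
  proof (cases "k = 0")
    case False
    have "expectation (\<lambda>x. (S (k\<^sup>2) x / real (k\<^sup>2))\<^sup>2) = expectation (\<lambda>x. (S (k\<^sup>2) x)\<^sup>2) / (real (k\<^sup>2))\<^sup>2"
      by (simp add: power_divide)
    also have "\<dots> \<le> (C\<^sup>2 * real (k\<^sup>2)) / (real (k\<^sup>2))\<^sup>2"
      by (intro divide_right_mono S2) simp
    also have "\<dots> = C\<^sup>2 / (real k)\<^sup>2"
      using False by (simp add: power2_eq_square)
    finally show ?thesis
      by (subst nn_integral_eq_integral) (auto simp: power_divide S_int intro!: ennreal_leI)
  qed simp
  have "summable (\<lambda>k. C\<^sup>2 / (real k)\<^sup>2)"
    unfolding divide_inverse by (intro summable_mult inverse_power_summable) simp
  then have "(\<Sum>k. ennreal (C\<^sup>2 / (real k)\<^sup>2)) < \<infinity>"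
    by (simp add: ennreal_suminf_neq_top less_top)
  then have "(\<Sum>k. \<integral>\<^sup>+x. ennreal ((S (k\<^sup>2) x / real (k\<^sup>2))\<^sup>2) \<partial>M) < \<infinity>"
    by (rule le_less_trans[OF suminf_le[OF sq summableI summableI]])
  then have "AE x in M. (\<lambda>k. (S (k\<^sup>2) x / real (k\<^sup>2))\<^sup>2) \<longlonglongrightarrow> 0"
    by (intro AE_tendsto_zero_if_suminf_expectation_finite) auto
  then show ?thesis
  proof eventually_elim
    case (elim x)
    let ?k = floor_sqrt
    have k_top: "filterlim ?k at_top at_top"
      unfolding filterlim_at_top by (metis (no_types, lifting) eventually_sequentiallyI le_floor_sqrtI)
    have "(\<lambda>k. S (k\<^sup>2) x / real (k\<^sup>2)) \<longlonglongrightarrow> 0"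
      using tendsto_real_sqrt[OF elim] by (simp add: tendsto_rabs_zero_cancel)
    then have "(\<lambda>n. \<bar>S ((?k n)\<^sup>2) x / real ((?k n)\<^sup>2)\<bar>) \<longlonglongrightarrow> 0"
      by (rule tendsto_rabs_zero[OF filterlim_compose[OF _ k_top]])
    moreover have "(\<lambda>n. 2 * C / real (?k n)) \<longlonglongrightarrow> 0"
      by (rule real_tendsto_divide_at_top[OF tendsto_const
            filterlim_compose[OF filterlim_real_sequentially k_top]])
    ultimately have lim: "(\<lambda>n. \<bar>S ((?k n)\<^sup>2) x / real ((?k n)\<^sup>2)\<bar> + 2 * C / real (?k n)) \<longlonglongrightarrow> 0"
      by (rule tendsto_add_zero)
    have "\<bar>S n x / real n\<bar> \<le> \<bar>S ((?k n)\<^sup>2) x / real ((?k n)\<^sup>2)\<bar> + 2 * C / real (?k n)" if "n > 0" for n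
    proof -
      define k where "k = ?k n"
      \<comment> \<open>From n < (k + 1)^2: at most 2 k increments, each bounded by C, separate n
        from the square below it. Divided by k^2 they contribute 2 C / k.\<close>
      have k: "0 < k" "k\<^sup>2 \<le> n" "n - k\<^sup>2 \<le> 2 * k"
        using that Suc_floor_sqrt_power2_gt[of n] floor_sqrt_power2_le[of n]
        by (auto simp: k_def power2_eq_square simp del: floor_sqrt_power2_le)
      have "\<bar>S n x\<bar> \<le> \<bar>S (k\<^sup>2) x\<bar> + C * real (n - k\<^sup>2)"
        using S_bound[OF k(2), of x] by linarith
      also have "\<dots> \<le> \<bar>S (k\<^sup>2) x\<bar> + C * (2 * real k)"
        using k(3) by (intro add_left_mono mult_left_mono C) linarith
      finally have "\<bar>S n x\<bar> / real n \<le> (\<bar>S (k\<^sup>2) x\<bar> + C * (2 * real k)) / real n"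
        by (rule divide_right_mono) simp
      also have "\<dots> \<le> (\<bar>S (k\<^sup>2) x\<bar> + C * (2 * real k)) / real (k\<^sup>2)"
        using k that by (intro divide_left_mono mult_pos_pos) (auto simp: C simp del: of_nat_power)
      also have "\<dots> = \<bar>S (k\<^sup>2) x\<bar> / real (k\<^sup>2) + 2 * C / real k"
        using k by (simp add: power2_eq_square field_simps)
      finally show ?thesis
        by (simp add: k_def)
    qed
    then have "\<forall>\<^sub>F n in sequentially. norm (S n x / real n)
        \<le> \<bar>S ((?k n)\<^sup>2) x / real ((?k n)\<^sup>2)\<bar> + 2 * C / real (?k n)"
      by (auto intro: eventually_sequentiallyI[of 1])
    then have "(\<lambda>n. S n x / real n) \<longlonglongrightarrow> 0"
      by (rule Lim_null_comparison[OF _ lim])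
    then show ?case
      by (simp add: S_def)
  qed
qed

end

section \<open>Limits of empirical measures\<close>

text \<open>Otherwise some subsequence stays at distance \<open>e\<close> from \<open>m\<close> at
  \<open>y\<close>. By Bolzano-Weierstrass a further subsequence converges at all nodes; its limit
  is a probability vector and invariant by \<open>inv\<close>, hence equal to \<open>m\<close>, a
  contradiction.\<close>

lemma empirical_measure_tendsto_invariant:
  fixes p :: "'v::finite \<Rightarrow> 'v \<Rightarrow> real" and \<mu> :: "nat \<Rightarrow> 'v \<Rightarrow> real"
  assumes unique: "\<And>m'. invariant_dist p m' \<Longrightarrow> m' = m"
    and nonneg: "\<And>n x. 0 \<le> \<mu> n x" and sum1: "\<And>n. n > 0 \<Longrightarrow> (\<Sum>x\<in>UNIV. \<mu> n x) = 1"
    and inv: "\<And>y. (\<lambda>n. \<mu> n y - (\<Sum>x\<in>UNIV. \<mu> n x * p x y)) \<longlonglongrightarrow> 0"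
  shows "(\<lambda>n. \<mu> n y) \<longlonglongrightarrow> pmf m y"
proof (rule ccontr)
  assume "\<not> ?thesis"
  then obtain e where e: "e > 0" "\<And>N. \<exists>n\<ge>N. \<not> dist (\<mu> n y) (pmf m y) < e"
    unfolding lim_sequentially by blast
  \<comment> \<open>A strictly increasing enumeration of bad indices. It starts at a positive one
    because \<open>sum1\<close> says nothing about n = 0.\<close>
  define r where "r = rec_nat (SOME n. n > 0 \<and> \<not> dist (\<mu> n y) (pmf m y) < e)
     (\<lambda>_ k. SOME n. n > k \<and> \<not> dist (\<mu> n y) (pmf m y) < e)"
  have ex: "\<exists>n. n > k \<and> \<not> dist (\<mu> n y) (pmf m y) < e" for k
    using e(2)[of "Suc k"] by (auto simp: Suc_le_eq)
  have r0: "r 0 > 0 \<and> \<not> dist (\<mu> (r 0)  y) (pmf m y) < e"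
    unfolding r_def using someI_ex[OF ex[of 0]] by simp
  have rS: "r (Suc k) > r k \<and> \<not> dist (\<mu> (r (Suc k)) y) (pmf m y) < e" for k
    unfolding r_def using someI_ex[OF ex[of "r k"]] by (simp add: r_def)
  have r: "strict_mono r"
    by (rule strict_monoI_Suc) (use rS in blast)
  have far: "\<not> dist (\<mu> (r k) y) (pmf m y) < e" for k
    using r0 rS by (cases k) auto
  have rpos: "r k > 0" for k
    using r0 strict_mono_less_eq[OF r, of 0 k] by simp
  have le1: "\<mu> (r k) x \<le> 1" for k x
    using member_le_sum[of x UNIV "\<mu> (r k)"] nonneg sum1[OF rpos] by simp
  have "bounded (range (\<lambda>k. \<chi> x. \<mu> (r k) x))"
    unfolding bounded_iff
    by (intro exI[of _ "\<Sum>(x::'v)\<in>UNIV. 1"])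
      (auto intro!: order_trans[OF norm_le_l1_cart sum_mono] simp: nonneg le1 simp del: sum_constant)
  then obtain l s where s: "strict_mono s" "((\<lambda>k. \<chi> x. \<mu> (r k) x) \<circ> s) \<longlonglongrightarrow> l"
    using bounded_imp_convergent_subsequence by blast
  define t where "t = r \<circ> s"
  have t: "strict_mono t" "t k > 0" for k
    using strict_mono_o[OF r s(1)] rpos by (auto simp: t_def)
  have lim: "(\<lambda>k. \<mu> (t k) x) \<longlonglongrightarrow> l $ x" for x
    using tendsto_vec_nth[OF s(2), of x] by (simp add: t_def o_def)
  have l0: "0 \<le> l $ x" for x
    by (rule LIMSEQ_le_const[OF lim]) (auto simp: nonneg)
  have "(\<lambda>k. \<Sum>x\<in>UNIV. \<mu> (t k) x) \<longlonglongrightarrow> (\<Sum>x\<in>UNIV. l $ x)"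
    by (intro tendsto_sum lim)
  then have l1: "(\<Sum>x\<in>UNIV. l $ x) = 1"
    using sum1[OF t(2)] by (simp add: LIMSEQ_const_iff)
  have linv: "l $ z = (\<Sum>x\<in>UNIV. l $ x * p x z)" for z
  proof -
    have "(\<lambda>k. \<mu> (t k) z - (\<Sum>x\<in>UNIV. \<mu> (t k) x * p x z)) \<longlonglongrightarrow> 0"
      using LIMSEQ_subseq_LIMSEQ[OF inv[of z] t(1)] by (simp add: o_def)
    moreover have "(\<lambda>k. \<mu> (t k) z - (\<Sum>x\<in>UNIV. \<mu> (t k) x * p x z))
        \<longlonglongrightarrow> l $ z - (\<Sum>x\<in>UNIV. l $ x * p x z)"
      by (intro tendsto_intros lim)
    ultimately show ?thesis
      using LIMSEQ_unique by fastforce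
  qed
  have "(\<integral>\<^sup>+x. ennreal (l $ x) \<partial>count_space UNIV) = 1"
    using l1 by (simp add: nn_integral_count_space_finite l0 sum_ennreal)
  then have emb: "pmf (embed_pmf (\<lambda>x. l $ x)) x = l $ x" for x
    by (intro pmf_embed_pmf l0) auto
  then have "embed_pmf (\<lambda>x. l $ x) = m"
    by (intro unique) (simp add: invariant_dist_def linv[symmetric])
  then have "l $ y = pmf m y"
    using emb[of y] by simp
  then have "\<exists>k. dist (\<mu> (t k) y) (pmf m y) < e"
    using lim[of y] e(1) unfolding lim_sequentially by (metis order_refl)
  then show False
    using far by (auto simp: t_def)
qed

section \<open>Counting reactions\<close>

text \<open>Trades the infimum for a bounded existence statement, so that passing from
  \<open>n\<close> to \<open>Suc n\<close> only asks about the node at time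
  \<open>Suc n\<close>.\<close>

lemma next_visit_le_iff: "next_visit S \<omega> s \<le> enat n \<longleftrightarrow> (\<exists>l\<le>n. s \<le> enat l \<and> \<omega> l \<in> S)"
proof
  assume "next_visit S \<omega> s \<le> enat n"
  then obtain l where l: "next_visit S \<omega> s = enat l" "l \<le> n"
    by (cases "next_visit S \<omega> s") auto
  then show "\<exists>l\<le>n. s \<le> enat l \<and> \<omega> l \<in> S"
    using next_visit_enat[OF l(1)] by blast
next
  assume "\<exists>l\<le>n. s \<le> enat l \<and> \<omega> l \<in> S"
  then obtain l where "l \<le> n" "s \<le> enat l" "\<omega> l \<in> S"
    by blast
  then show "next_visit S \<omega> s \<le> enat n"
    unfolding next_visit_def by (intro INF_lower2[of l]) auto
qed

text \<open>Whether, among the nodes of \<open>A \<union> B\<close> visited up to time \<open>n\<close>, the last one lies in \<open>A\<close>.\<close>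

primrec reactive :: "'v set \<Rightarrow> 'v set \<Rightarrow> (nat \<Rightarrow> 'v) \<Rightarrow> nat \<Rightarrow> bool" where
  "reactive A B \<omega> 0 \<longleftrightarrow> \<omega> 0 \<in> A"
| "reactive A B \<omega> (Suc n) \<longleftrightarrow> \<omega> (Suc n) \<in> A \<or> reactive A B \<omega> n \<and> \<omega> (Suc n) \<notin> B"

lemma reactive_notin: "A \<inter> B = {} \<Longrightarrow> reactive A B \<omega> n \<Longrightarrow> \<omega> n \<notin> B"
  by (cases n) auto

lemma in_A_imp_reactive: "\<omega> n \<in> A \<Longrightarrow> reactive A B \<omega> n"
  by (cases n) auto

text \<open>Turns the count into a sum over single steps whose summands depend on the past and the
  next node, as the martingale argument requires. The number \<open>c N\<close> satisfies the two
  inequalities that determine the count uniquely.\<close>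

lemma reaction_count_eq:
  assumes "A \<inter> B = {}"
  shows "reaction_count A B \<omega> N = (\<Sum>n<N. of_bool (reactive A B \<omega> n \<and> \<omega> (Suc n) \<in> B))"
proof -
  define c where "c N = (\<Sum>n<N. of_bool (reactive A B \<omega> n \<and> \<omega> (Suc n) \<in> B) :: nat)" for N
  let ?r = "reaction_time A B \<omega>"
  \<comment> \<open>The third conjunct strengthens the induction: \<open>reactive\<close> records
    whether the visit of \<open>A\<close> that the next reaction waits for has already
    happened.\<close>
  have "?r (c N) \<le> enat N \<and> enat N < ?r (Suc (c N))
      \<and> (reactive A B \<omega> N \<longleftrightarrow> next_visit A \<omega> (?r (c N)) \<le> enat N)"
  proof (induction N)
    case 0
    have "(0::enat) < ?r (Suc 0)"
      using reaction_time_less_Suc[OF assms, of \<omega> 0 0] by (simp add: zero_enat_def)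
    moreover have "next_visit A \<omega> 0 \<le> enat 0 \<longleftrightarrow> \<omega> 0 \<in> A"
      unfolding next_visit_le_iff by simp
    ultimately show ?case
      by (simp add: c_def zero_enat_def[symmetric])
  next
    case (Suc N)
    let ?a = "next_visit A \<omega> (?r (c N))"
    from Suc have r: "?r (c N) \<le> enat N" and less: "enat N < next_visit B \<omega> ?a"
      and react: "reactive A B \<omega> N \<longleftrightarrow> ?a \<le> enat N"
      by auto
    have r': "?r (c N) \<le> enat (Suc N)"
      by (rule order_trans[OF r]) simp
    have b_iff: "next_visit B \<omega> ?a \<le> enat (Suc N) \<longleftrightarrow> ?a \<le> enat (Suc N) \<and> \<omega> (Suc N) \<in> B"
      using less unfolding linorder_not_le[symmetric] next_visit_le_iff[of B]
      by (auto simp: le_Suc_eq)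
    have a_iff: "?a \<le> enat (Suc N) \<longleftrightarrow> ?a \<le> enat N \<or> \<omega> (Suc N) \<in> A"
      unfolding next_visit_le_iff using r' by (auto simp: le_Suc_eq)
    show ?case
    proof (cases "reactive A B \<omega> N \<and> \<omega> (Suc N) \<in> B")
      case True
      then have c: "c (Suc N) = Suc (c N)"
        by (simp add: c_def)
      have b: "?r (Suc (c N)) = enat (Suc N)"
        using less b_iff a_iff react True by (auto intro!: antisym simp: Suc_ile_eq)
      have "\<omega> (Suc N) \<notin> A"
        using True assms by auto
      \<comment> \<open>The new search for \<open>A\<close> begins at time \<open>Suc N\<close>
        itself, the starting time being included; as the node there lies in \<open>B\<close>, it
        cannot succeed at once.\<close>
      then have "\<not> next_visit A \<omega> (enat (Suc N)) \<le> enat (Suc N)"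
        by (auto simp: next_visit_le_iff dest: antisym)
      moreover have "next_visit A \<omega> (enat (Suc N)) \<le> ?r (Suc (Suc (c N)))"
        using next_visit_ge[of "next_visit A \<omega> (enat (Suc N))" B \<omega>]
        unfolding reaction_time.simps(2)[of A B \<omega> "Suc (c N)"] b by simp
      ultimately show ?thesis
        unfolding c b using True \<open>\<omega> (Suc N) \<notin> A\<close> by auto
    next
      case False
      then have c: "c (Suc N) = c N"
        by (simp add: c_def)
      have "reactive A B \<omega> (Suc N) \<longleftrightarrow> ?a \<le> enat (Suc N)"
        using False a_iff react by auto
      moreover have "\<not> next_visit B \<omega> ?a \<le> enat (Suc N)"
        using False a_iff react b_iff assms by auto
      ultimately show ?thesis
        unfolding c using r' by auto
    qed
  qed
  then show ?thesis
    unfolding reaction_count_def c_def[symmetric]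
    using the1_equality[OF reaction_count_ex1[OF assms]] by blast
qed

section \<open>The committor\<close>

text \<open>The probability that the chain started at \<open>x\<close> enters
  \<open>A \<union> B\<close> for the first time at step \<open>n\<close>, and does so in
  \<open>B\<close>; see \<open>measure_first_hit\<close>. The recursion is a decomposition by the
  first step.\<close>

primrec first_hit :: "('v::finite \<Rightarrow> 'v \<Rightarrow> real) \<Rightarrow> 'v set \<Rightarrow> 'v set \<Rightarrow> nat \<Rightarrow> 'v \<Rightarrow> real" where
  "first_hit p A B 0 x = of_bool (x \<in> B)"
| "first_hit p A B (Suc n) x = (if x \<in> A \<union> B then 0 else \<Sum>y\<in>UNIV. p x y * first_hit p A B n y)"

text \<open>Decomposes the event of the committor by the time of the first entry into
  \<open>A \<union> B\<close>; each piece depends on finitely many coordinates.\<close>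

lemma hitting_time_less_iff:
  assumes "A \<inter> B = {}"
  shows "hitting_time B \<omega> < hitting_time A \<omega> \<longleftrightarrow> (\<exists>n. (\<forall>j<n. \<omega> j \<notin> A \<union> B) \<and> \<omega> n \<in> B)"
proof
  assume less: "hitting_time B \<omega> < hitting_time A \<omega>"
  then obtain n where n: "hitting_time B \<omega> = enat n"
    by (cases "hitting_time B \<omega>") auto
  have "\<omega> n \<in> B"
    using next_visit_enat(2) n unfolding hitting_time_def by metis
  moreover have "\<omega> j \<notin> A \<union> B" if "j < n" for j
  proof
    assume "\<omega> j \<in> A \<union> B"
    then have "hitting_time A \<omega> \<le> enat j \<or> hitting_time B \<omega> \<le> enat j"
      by (auto simp: hitting_time_def next_visit_def zero_enat_def intro: INF_lower)
    then have "hitting_time B \<omega> \<le> enat j"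
      using less by auto
    then show False
      using that n by simp
  qed
  ultimately show "\<exists>n. (\<forall>j<n. \<omega> j \<notin> A \<union> B) \<and> \<omega> n \<in> B"
    by blast
next
  assume "\<exists>n. (\<forall>j<n. \<omega> j \<notin> A \<union> B) \<and> \<omega> n \<in> B"
  then obtain n where n: "\<And>j. j < n \<Longrightarrow> \<omega> j \<notin> A \<union> B" "\<omega> n \<in> B"
    by blast
  have "hitting_time B \<omega> \<le> enat n"
    using n(2) by (auto simp: hitting_time_def next_visit_def zero_enat_def intro: INF_lower)
  also have "enat n < enat (Suc n)"
    by simp
  also have "enat (Suc n) \<le> hitting_time A \<omega>"
    unfolding hitting_time_def next_visit_def
  proof (rule INF_greatest)
    fix l assume "l \<in> {l. 0 \<le> enat l \<and> \<omega> l \<in> A}"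
    then have "\<not> l \<le> n"
      using n assms by (auto simp: le_less)
    then show "enat (Suc n) \<le> enat l"
      by simp
  qed
  finally show "hitting_time B \<omega> < hitting_time A \<omega>" .
qed

context
  fixes p :: "'v::finite \<Rightarrow> 'v \<Rightarrow> real"
  assumes nonneg: "\<And>x y. 0 \<le> p x y" and sum1: "\<And>x. (\<Sum>y\<in>UNIV. p x y) = 1"
begin

lemma sets_chain_law: "sets (chain_law p x) = sets (PiM UNIV (\<lambda>_. count_space UNIV))"
proof -
  interpret IT: Ionescu_Tulcea "chain_kernel p x" "\<lambda>_. count_space UNIV"
    by (rule Ionescu_Tulcea_chain_kernel[OF nonneg sum1])
  show ?thesis
    unfolding chain_law_def by (rule IT.PF.sets_lim)
qed

lemma prob_space_chain_law: "prob_space (chain_law p x)"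
proof -
  interpret IT: Ionescu_Tulcea "chain_kernel p x" "\<lambda>_. count_space UNIV"
    by (rule Ionescu_Tulcea_chain_kernel[OF nonneg sum1])
  \<comment> \<open>The cylinder over the empty set of coordinates is the whole path space, so the
    total mass is that of a finite-dimensional marginal.\<close>
  have "emeasure (chain_law p x) (prod_emb UNIV (\<lambda>_. count_space UNIV) {} {\<lambda>_. undefined})
      = emeasure (IT.CI {}) {\<lambda>_. undefined}"
    unfolding chain_law_def by (rule IT.lim) (auto simp: PiM_empty)
  also have "\<dots> = 1"
    using prob_space.emeasure_space_1[OF IT.PF.prob_space_P[of "{}"]]
    by (simp add: IT.PF.space_P space_PiM)
  also have "prod_emb UNIV (\<lambda>_. count_space UNIV) {} {\<lambda>_. undefined} = space (chain_law p x)"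
    by (auto simp: prod_emb_def chain_law_def space_PiM)
  finally show ?thesis
    by (intro prob_spaceI)
qed

lemma coordinate_measurable_chain_law:
  "(\<lambda>\<omega>. \<omega> i) \<in> measurable (chain_law p x) (count_space UNIV)"
  unfolding measurable_cong_sets[OF sets_chain_law refl] by (rule measurable_component_singleton) simp

text \<open>The prefix \<open>z\<close> up to time \<open>k\<close> is there for the induction on
  \<open>n\<close>: a further step lengthens the prefix by one node. In this way the Markov property
  is drawn from the cylinder probabilities alone, without shifting paths.\<close>

lemma measure_first_hit_after_cylinder:
  "measure (chain_law p x) {\<omega> \<in> space (chain_law p x).
      (\<forall>i\<le>k. \<omega> i = z i) \<and> (\<forall>j<n. \<omega> (k + j) \<notin> A \<union> B) \<and> \<omega> (k + n) \<in> B}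
    = (if z 0 = x then \<Prod>i<k. p (z i) (z (Suc i)) else 0) * first_hit p A B n (z k)"
proof (induction n arbitrary: k z)
  case 0
  have "{\<omega> \<in> space (chain_law p x). (\<forall>i\<le>k. \<omega> i = z i) \<and> (\<forall>j<0. \<omega> (k + j) \<notin> A \<union> B) \<and> \<omega> (k + 0) \<in> B}
    = (if z k \<in> B then {\<omega> \<in> space (chain_law p x). \<forall>i\<le>k. \<omega> i = z i} else {})"
    by auto
  then show ?case
    by (simp add: chain_law_cylinder[OF nonneg sum1])
next
  case (Suc n)
  interpret L: prob_space "chain_law p x"
    by (rule prob_space_chain_law)
  note coordinate_measurable_chain_law [measurable]
  show ?case
  proof (cases "z k \<in> A \<union> B")
    case True
    then have "{\<omega> \<in> space (chain_law p x). (\<forall>i\<le>k. \<omega> i = z i)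
        \<and> (\<forall>j<Suc n. \<omega> (k + j) \<notin> A \<union> B) \<and> \<omega> (k + Suc n) \<in> B} = {}"
      by fastforce
    with True show ?thesis
      by (simp only: measure_empty) simp
  next
    case False
    let ?E = "\<lambda>y. {\<omega> \<in> space (chain_law p x). (\<forall>i\<le>Suc k. \<omega> i = (z(Suc k := y)) i)
        \<and> (\<forall>j<n. \<omega> (Suc k + j) \<notin> A \<union> B) \<and> \<omega> (Suc k + n) \<in> B}"
    have eq: "{\<omega> \<in> space (chain_law p x). (\<forall>i\<le>k. \<omega> i = z i)
        \<and> (\<forall>j<Suc n. \<omega> (k + j) \<notin> A \<union> B) \<and> \<omega> (k + Suc n) \<in> B} = (\<Union>y\<in>UNIV. ?E y)"
      using False by (auto simp: le_Suc_eq All_less_Suc2)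
    have disj: "disjoint_family_on ?E UNIV"
      unfolding disjoint_family_on_def by (auto 0 3 dest: spec[of _ "Suc k"])
    have [measurable]: "?E y \<in> L.events" for y
      by measurable
    have "L.prob (\<Union>y\<in>UNIV. ?E y) = (\<Sum>y\<in>UNIV. L.prob (?E y))"
      by (rule L.finite_measure_finite_Union[OF _ _ disj]) auto
    also have "\<dots> = (\<Sum>y\<in>UNIV. (if z 0 = x then \<Prod>i<k. p (z i) (z (Suc i)) else 0) * (p (z k) y * first_hit p A B n y))"
      unfolding Suc.IH by (intro sum.cong refl) simp
    finally show ?thesis
      unfolding eq using False by (simp add: sum_distrib_left)
  qed
qed

lemma measure_first_hit:
  "measure (chain_law p x) {\<omega> \<in> space (chain_law p x). (\<forall>j<n. \<omega> j \<notin> A \<union> B) \<and> \<omega> n \<in> B} = first_hit p A B n x"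
proof -
  interpret L: prob_space "chain_law p x"
    by (rule prob_space_chain_law)
  note coordinate_measurable_chain_law [measurable]
  let ?E = "\<lambda>y. {\<omega> \<in> space (chain_law p x). (\<forall>i\<le>0. \<omega> i = y) \<and> (\<forall>j<n. \<omega> (0 + j) \<notin> A \<union> B) \<and> \<omega> (0 + n) \<in> B}"
  have eq: "{\<omega> \<in> space (chain_law p x). (\<forall>j<n. \<omega> j \<notin> A \<union> B) \<and> \<omega> n \<in> B} = (\<Union>y\<in>UNIV. ?E y)"
    by auto
  have "L.prob (\<Union>y\<in>UNIV. ?E y) = (\<Sum>y\<in>UNIV. L.prob (?E y))"
    by (rule L.finite_measure_finite_Union) (auto simp: disjoint_family_on_def)
  also have "\<dots> = (\<Sum>y\<in>UNIV. (if y = x then first_hit p A B n y else 0))"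
    by (intro sum.cong refl) (subst measure_first_hit_after_cylinder, simp)
  finally show ?thesis
    unfolding eq by simp
qed

text \<open>Countable additivity over the disjoint first-entry times. All properties of the
  committor below are read off from this series.\<close>

lemma first_hit_sums_committor:
  assumes "A \<inter> B = {}"
  shows "(\<lambda>n. first_hit p A B n x) sums committor p A B x"
proof -
  interpret L: prob_space "chain_law p x"
    by (rule prob_space_chain_law)
  note coordinate_measurable_chain_law [measurable]
  let ?E = "\<lambda>n. {\<omega> \<in> space (chain_law p x). (\<forall>j<n. \<omega> j \<notin> A \<union> B) \<and> \<omega> n \<in> B}"
  have "range ?E \<subseteq> L.events"
    by auto
  moreover have "disjoint_family ?E"
    unfolding disjoint_family_on_def by (auto simp: neq_iff)
  ultimately have "(\<lambda>n. L.prob (?E n)) sums L.prob (\<Union>n. ?E n)"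
    by (rule L.finite_measure_UNION)
  moreover have "(\<Union>n. ?E n) = {\<omega> \<in> space (chain_law p x). hitting_time B \<omega> < hitting_time A \<omega>}"
    unfolding hitting_time_less_iff[OF assms] by auto
  ultimately show ?thesis
    unfolding measure_first_hit committor_def by simp
qed

lemma committor_in_A:
  assumes "A \<inter> B = {}" "x \<in> A"
  shows "committor p A B x = 0"
proof -
  have "first_hit p A B n x = 0" for n
    using assms by (cases n) auto
  then show ?thesis
    using first_hit_sums_committor[OF assms(1), of x] sums_unique2[OF sums_zero] by simp
qed

lemma committor_in_B:
  assumes "A \<inter> B = {}" "x \<in> B"
  shows "committor p A B x = 1"
proof -
  have "first_hit p A B n x = (if n = 0 then 1 else 0)" for n
    using assms by (cases n) auto
  then have "(\<lambda>n. if n = 0 then 1 else 0) sums committor p A B x"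
    using first_hit_sums_committor[OF assms(1), of x] by simp
  then show ?thesis
    using sums_unique2[OF sums_single[of 0 "\<lambda>_. 1::real"]] by simp
qed

text \<open>The one-step recursion of \<open>first_hit\<close> summed over all times; the index
  shift is free because the term at time 0 vanishes off \<open>B\<close>.\<close>

lemma committor_harmonic:
  assumes "A \<inter> B = {}" "x \<notin> A \<union> B"
  shows "committor p A B x = (\<Sum>y\<in>UNIV. p x y * committor p A B y)"
proof -
  have "(\<lambda>n. \<Sum>y\<in>UNIV. p x y * first_hit p A B n y) sums (\<Sum>y\<in>UNIV. p x y * committor p A B y)"
    by (intro sums_sum sums_mult first_hit_sums_committor assms)
  then have "(\<lambda>n. first_hit p A B (Suc n) x) sums (\<Sum>y\<in>UNIV. p x y * committor p A B y)"
    using assms by simp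
  then have "(\<lambda>n. first_hit p A B n x) sums (\<Sum>y\<in>UNIV. p x y * committor p A B y)"
    using assms by (subst (asm) sums_Suc_iff) simp
  then show ?thesis
    by (rule sums_unique2[OF first_hit_sums_committor[OF assms(1)]])
qed

lemma committor_bounds: "0 \<le> committor p A B x" "committor p A B x \<le> 1"
  unfolding committor_def using prob_space.prob_le_1[OF prob_space_chain_law] by auto

end

section \<open>Laws of the clocks\<close>

text \<open>The indicator discards the values at negative times, about which
  \<open>waiting_density\<close> says nothing except measurability.\<close>

definition clock_law :: "(real \<Rightarrow> real) \<Rightarrow> real measure" where
  "clock_law f = density lborel (\<lambda>u. ennreal (f u) * indicator {0..} u)"

lemma sets_clock_law [simp, measurable_cong]: "sets (clock_law f) = sets borel"
  by (simp add: clock_law_def)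

lemma space_clock_law [simp]: "space (clock_law f) = UNIV"
  by (simp add: clock_law_def)

context
  fixes f :: "real \<Rightarrow> real"
  assumes f: "waiting_density f"
begin

lemma waiting_density_measurable: "f \<in> borel_measurable borel"
  using f by (simp add: waiting_density_def)

lemma waiting_density_nonneg: "0 \<le> t \<Longrightarrow> 0 \<le> f t"
  using f by (simp add: waiting_density_def)

lemma prob_space_clock_law: "prob_space (clock_law f)"
proof -
  note waiting_density_measurable [measurable]
  show ?thesis
    using f by (intro prob_spaceI) (simp add: clock_law_def emeasure_density waiting_density_def)
qed

lemma measure_clock_law:
  assumes [measurable]: "C \<in> sets borel"
  shows "measure (clock_law f) C = (LINT u:C \<inter> {0..}|lborel. f u)"
proof -
  note waiting_density_measurable [measurable]
  have "(LINT u:C \<inter> {0..}|lborel. f u) = enn2real (\<integral>\<^sup>+u. ennreal (indicator (C \<inter> {0..}) u * f u) \<partial>lborel)"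
    unfolding set_lebesgue_integral_def real_scaleR_def
    by (rule integral_eq_nn_integral) (auto simp: indicator_def waiting_density_nonneg)
  also have "(\<integral>\<^sup>+u. ennreal (indicator (C \<inter> {0..}) u * f u) \<partial>lborel) = emeasure (clock_law f) C"
    by (auto simp: clock_law_def emeasure_density intro!: nn_integral_cong split: split_indicator)
  finally show ?thesis
    by (simp add: measure_def)
qed

lemma measure_clock_law_atLeast: "0 \<le> t \<Longrightarrow> measure (clock_law f) {t..} = (LINT u:{t..}|lborel. f u)"
  by (subst measure_clock_law) (auto intro!: arg_cong[where f="\<lambda>C. LINT u:C|lborel. f u"])

lemma AE_clock_law_pos: "AE t in clock_law f. 0 < t"
proof -
  note waiting_density_measurable [measurable]
  have "AE t in lborel. t \<noteq> (0::real)"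
    by (rule AE_lborel_singleton)
  then show ?thesis
    unfolding clock_law_def by (subst AE_density) (auto elim!: eventually_mono split: split_indicator)
qed

end

text \<open>Off the edges the value is irrelevant; it only has to be a probability measure.\<close>

definition edge_clock :: "('v::finite \<times> 'v) set \<Rightarrow> ('v \<Rightarrow> 'v \<Rightarrow> real \<Rightarrow> real) \<Rightarrow> 'v \<Rightarrow> 'v \<Rightarrow> real measure" where
  "edge_clock E \<psi> x y = (if (x, y) \<in> E then clock_law (\<psi> x y) else return borel 0)"

lemma sets_edge_clock [simp, measurable_cong]: "sets (edge_clock E \<psi> x y) = sets borel"
  by (simp add: edge_clock_def)

lemma space_edge_clock [simp]: "space (edge_clock E \<psi> x y) = UNIV"
  by (simp add: edge_clock_def)

definition clocks_law :: "('v::finite \<times> 'v) set \<Rightarrow> ('v \<Rightarrow> 'v \<Rightarrow> real \<Rightarrow> real) \<Rightarrow> 'v \<Rightarrow> ('v \<Rightarrow> real) measure" where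
  "clocks_law E \<psi> x = PiM (E `` {x}) (edge_clock E \<psi> x)"

definition sojourn_law :: "('v::finite \<times> 'v) set \<Rightarrow> ('v \<Rightarrow> 'v \<Rightarrow> real \<Rightarrow> real) \<Rightarrow> 'v \<Rightarrow> real measure" where
  "sojourn_law E \<psi> x = distr (clocks_law E \<psi> x) borel (\<lambda>w. Min (w ` (E `` {x})))"

lemma sets_sojourn_law [simp, measurable_cong]: "sets (sojourn_law E \<psi> x) = sets borel"
  by (simp add: sojourn_law_def)

lemma space_sojourn_law [simp]: "space (sojourn_law E \<psi> x) = UNIV"
  by (simp add: sojourn_law_def)

lemma sets_clocks_law [measurable_cong]:
  "sets (clocks_law E \<psi> x) = sets (PiM (E `` {x}) (\<lambda>_. borel))"
  unfolding clocks_law_def by (rule sets_PiM_cong) auto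

lemma space_clocks_law: "space (clocks_law E \<psi> x) = PiE (E `` {x}) (\<lambda>_. UNIV)"
  by (simp add: clocks_law_def space_PiM)

lemma Min_measurable_clocks_law [measurable]:
  fixes E :: "('v::finite \<times> 'v) set"
  shows "(\<lambda>w. Min (w ` (E `` {x}))) \<in> borel_measurable (PiM (E `` {x}) (\<lambda>_. borel :: real measure))"
  by (intro borel_measurable_Min measurable_component_singleton) auto

context
  fixes E :: "('v::finite \<times> 'v) set" and \<psi> :: "'v \<Rightarrow> 'v \<Rightarrow> real \<Rightarrow> real"
  assumes graph: "waiting_graph E \<psi>"
begin

lemma edge_density: "(x, y) \<in> E \<Longrightarrow> waiting_density (\<psi> x y)"
  using graph by (auto simp: waiting_graph_def)

lemma prob_space_edge_clock: "prob_space (edge_clock E \<psi> x y)"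
  by (auto simp: edge_clock_def edge_density intro: prob_space_clock_law prob_space_return)

lemma prob_space_clocks_law: "prob_space (clocks_law E \<psi> x)"
  unfolding clocks_law_def by (intro prob_space_PiM prob_space_edge_clock)

lemma prob_space_sojourn_law: "prob_space (sojourn_law E \<psi> x)"
  unfolding sojourn_law_def by (intro prob_space.prob_space_distr prob_space_clocks_law) measurable

lemma emeasure_clocks_law_box:
  assumes "\<And>y. y \<in> E `` {x} \<Longrightarrow> C y \<in> sets borel"
  shows "emeasure (clocks_law E \<psi> x) (PiE (E `` {x}) C) = (\<Prod>y\<in>E `` {x}. emeasure (edge_clock E \<psi> x y) (C y))"
proof -
  interpret product_prob_space "edge_clock E \<psi> x" UNIV
    by (rule product_prob_spaceI) (rule prob_space_edge_clock)
  show ?thesis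
    unfolding clocks_law_def by (rule emeasure_PiM) (auto simp: assms)
qed

text \<open>Written as a parameter integral, the tail is measurable in \<open>t\<close> by the
  measurability part of Fubini's theorem.\<close>

lemma measurable_emeasure_edge_clock_atLeast [measurable]:
  "(\<lambda>t. emeasure (edge_clock E \<psi> x y) {t..}) \<in> borel_measurable borel"
proof -
  interpret prob_space "edge_clock E \<psi> x y"
    by (rule prob_space_edge_clock)
  have "(\<lambda>t. \<integral>\<^sup>+u. (if t \<le> u then 1 else 0 :: ennreal) \<partial>edge_clock E \<psi> x y) \<in> borel_measurable borel"
    by measurable
  also have "(\<lambda>t. \<integral>\<^sup>+u. (if t \<le> u then 1 else 0 :: ennreal) \<partial>edge_clock E \<psi> x y)
      = (\<lambda>t. \<integral>\<^sup>+u. indicator {t..} u \<partial>edge_clock E \<psi> x y)"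
    by (intro ext nn_integral_cong) (simp add: indicator_def)
  finally show ?thesis
    by simp
qed

text \<open>The minimum is at least \<open>t\<close> iff every clock is, which is a box for the
  product measure. Without outgoing edges \<open>Min\<close> would be unspecified.\<close>

lemma emeasure_sojourn_law_atLeast:
  assumes "E `` {x} \<noteq> {}" "0 \<le> t"
  shows "emeasure (sojourn_law E \<psi> x) {t..} = ennreal (stay_prob E \<psi> x t)"
proof -
  have "(\<lambda>w. Min (w ` (E `` {x}))) -` {t..} \<inter> space (clocks_law E \<psi> x) = PiE (E `` {x}) (\<lambda>_. {t..})"
  proof (intro set_eqI)
    fix w
    have "t \<le> Min (w ` (E `` {x})) \<longleftrightarrow> (\<forall>y\<in>E `` {x}. t \<le> w y)"
      using assms(1) by (subst Min_ge_iff) simp_all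
    then show "w \<in> (\<lambda>w. Min (w ` (E `` {x}))) -` {t..} \<inter> space (clocks_law E \<psi> x)
        \<longleftrightarrow> w \<in> PiE (E `` {x}) (\<lambda>_. {t..})"
      by (simp add: space_clocks_law PiE_iff conj_commute)
  qed
  then have "emeasure (sojourn_law E \<psi> x) {t..} = emeasure (clocks_law E \<psi> x) (PiE (E `` {x}) (\<lambda>_. {t..}))"
    unfolding sojourn_law_def by (subst emeasure_distr) simp_all
  also have "\<dots> = (\<Prod>y\<in>E `` {x}. emeasure (edge_clock E \<psi> x y) {t..})"
    by (rule emeasure_clocks_law_box) simp
  also have "\<dots> = (\<Prod>y\<in>E `` {x}. ennreal (LINT u:{t..}|lborel. \<psi> x y u))"
  proof (intro prod.cong refl)
    fix y assume y: "y \<in> E `` {x}"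
    interpret prob_space "edge_clock E \<psi> x y"
      by (rule prob_space_edge_clock)
    show "emeasure (edge_clock E \<psi> x y) {t..} = ennreal (LINT u:{t..}|lborel. \<psi> x y u)"
      unfolding emeasure_eq_measure using y assms(2)
      by (simp add: edge_clock_def measure_clock_law_atLeast[OF edge_density])
  qed
  also have "\<dots> = ennreal (stay_prob E \<psi> x t)"
    unfolding stay_prob_def using assms(2)
    by (intro prod_ennreal) (simp add: measure_clock_law_atLeast[OF edge_density, symmetric])
  finally show ?thesis .
qed

lemma AE_sojourn_law_pos:
  assumes "E `` {x} \<noteq> {}"
  shows "AE t in sojourn_law E \<psi> x. 0 < t"
proof -
  interpret product_prob_space "edge_clock E \<psi> x" UNIV
    by (rule product_prob_spaceI) (rule prob_space_edge_clock)
  have "AE w in clocks_law E \<psi> x. 0 < w y" if "y \<in> E `` {x}" for y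
  proof -
    have "edge_clock E \<psi> x y = clock_law (\<psi> x y)" "waiting_density (\<psi> x y)"
      using that by (auto simp: edge_clock_def edge_density)
    then have "AE t in edge_clock E \<psi> x y. 0 < t"
      by (simp only: AE_clock_law_pos)
    then show ?thesis
      unfolding clocks_law_def by (rule AE_PiM_component[OF prob_space_edge_clock that])
  qed
  then have "AE w in clocks_law E \<psi> x. \<forall>y\<in>E `` {x}. 0 < w y"
    by (intro AE_finite_allI) auto
  then show ?thesis
    unfolding sojourn_law_def using assms by (subst AE_distr_iff) (auto elim!: eventually_mono)
qed

text \<open>Layer-cake formula: \<open>stay_prob\<close> is the tail of the sojourn law, and
  Tonelli's theorem exchanges the level and the sojourn time. Infinite means are covered.\<close>

lemma nn_integral_sojourn_law:
  assumes "E `` {x} \<noteq> {}"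
  shows "(\<integral>\<^sup>+t. ennreal t \<partial>sojourn_law E \<psi> x) = mean_stay E \<psi> x"
proof -
  interpret S: prob_space "sojourn_law E \<psi> x"
    by (rule prob_space_sojourn_law)
  interpret pair_sigma_finite "sojourn_law E \<psi> x" lborel
    by (simp add: pair_sigma_finite_def lborel.sigma_finite_measure_axioms S.sigma_finite_measure_axioms)
  have "mean_stay E \<psi> x = (\<integral>\<^sup>+u. emeasure (sojourn_law E \<psi> x) {u..} * indicator {0..} u \<partial>lborel)"
    unfolding mean_stay_def using assms
    by (intro nn_integral_cong) (auto simp: emeasure_sojourn_law_atLeast split: split_indicator)
  also have "\<dots> = (\<integral>\<^sup>+u. \<integral>\<^sup>+t. (if 0 \<le> u \<and> u \<le> t then 1 else 0) \<partial>sojourn_law E \<psi> x \<partial>lborel)"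
  proof (intro nn_integral_cong)
    fix u :: real
    have "(\<integral>\<^sup>+t. (if 0 \<le> u \<and> u \<le> t then 1 else 0) \<partial>sojourn_law E \<psi> x)
        = (\<integral>\<^sup>+t. indicator {u..} t * indicator {0..} u \<partial>sojourn_law E \<psi> x)"
      by (intro nn_integral_cong) (auto split: split_indicator)
    then show "emeasure (sojourn_law E \<psi> x) {u..} * indicator {0..} u
        = (\<integral>\<^sup>+t. (if 0 \<le> u \<and> u \<le> t then 1 else 0) \<partial>sojourn_law E \<psi> x)"
      by (simp only:) (subst nn_integral_multc, auto intro!: borel_measurable_indicator)
  qed
  also have "\<dots> = (\<integral>\<^sup>+t. \<integral>\<^sup>+u. (if 0 \<le> u \<and> u \<le> t then 1 else 0) \<partial>lborel \<partial>sojourn_law E \<psi> x)"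
    by (rule Fubini') measurable
  also have "\<dots> = (\<integral>\<^sup>+t. \<integral>\<^sup>+u. indicator {0..t} u \<partial>lborel \<partial>sojourn_law E \<psi> x)"
    by (intro nn_integral_cong) (auto split: split_indicator)
  also have "\<dots> = (\<integral>\<^sup>+t. ennreal t \<partial>sojourn_law E \<psi> x)"
  proof (intro nn_integral_cong)
    show "(\<integral>\<^sup>+u. indicator {0..t} u \<partial>lborel) = ennreal t" for t :: real
      by (cases "0 \<le> t") (auto simp: ennreal_neg)
  qed
  finally show ?thesis ..
qed

text \<open>Fixing the clock of \<open>y\<close> at \<open>t\<close>, the other clocks must lie in
  the box of values from \<open>t\<close> on; the product of their tails with the density at
  \<open>t\<close> is \<open>jump_density\<close>. Ties are included in the event.\<close>

lemma emeasure_clocks_law_arg_min: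
  assumes y: "(x, y) \<in> E"
  shows "emeasure (clocks_law E \<psi> x) {w \<in> space (clocks_law E \<psi> x). \<forall>z\<in>E `` {x}. w y \<le> w z}
    = ennreal (trans_prob E \<psi> x y)"
proof -
  interpret product_prob_space "edge_clock E \<psi> x" UNIV
    by (rule product_prob_spaceI) (rule prob_space_edge_clock)
  interpret C: prob_space "clocks_law E \<psi> x"
    by (rule prob_space_clocks_law)
  define I where "I = E `` {x} - {y}"
  have I: "E `` {x} = insert y I" "y \<notin> I" "finite I"
    using y by (auto simp: I_def)
  have IE: "(x, z) \<in> E" if "z \<in> I" for z
    using that by (simp add: I_def)
  let ?S = "{w \<in> space (clocks_law E \<psi> x). \<forall>z\<in>E `` {x}. w y \<le> w z}"
  have "(\<lambda>w. w z) \<in> borel_measurable (clocks_law E \<psi> x)" if "z \<in> E `` {x}" for z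
    using that unfolding measurable_cong_sets[OF sets_clocks_law refl] by (rule measurable_component_singleton)
  then have S: "?S \<in> sets (clocks_law E \<psi> x)"
    using y by (intro sets.sets_Collect_finite_All borel_measurable_le) auto
  let ?G = "\<lambda>t. \<Prod>z\<in>I. emeasure (edge_clock E \<psi> x z) {t..}"
  have "emeasure (clocks_law E \<psi> x) ?S = (\<integral>\<^sup>+w. indicator ?S w \<partial>clocks_law E \<psi> x)"
    using S by simp
  also have "\<dots> = (\<integral>\<^sup>+t. (\<integral>\<^sup>+w. indicator ?S (w(y := t)) \<partial>PiM I (edge_clock E \<psi> x)) \<partial>edge_clock E \<psi> x y)"
    unfolding clocks_law_def I(1) by (rule product_nn_integral_insert_rev[OF I(3,2)])
      (use S in \<open>simp add: clocks_law_def I(1)\<close>)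
  also have "\<dots> = (\<integral>\<^sup>+t. ?G t \<partial>edge_clock E \<psi> x y)"
  proof (intro nn_integral_cong)
    fix t :: real
    have "(\<integral>\<^sup>+w. indicator ?S (w(y := t)) \<partial>PiM I (edge_clock E \<psi> x))
        = (\<integral>\<^sup>+w. indicator (PiE I (\<lambda>_. {t..})) w \<partial>PiM I (edge_clock E \<psi> x))"
    proof (intro nn_integral_cong)
      fix w assume "w \<in> space (PiM I (edge_clock E \<psi> x))"
      then have "w \<in> PiE I (\<lambda>_. UNIV)"
        by (simp add: space_PiM)
      then have "w(y := t) \<in> ?S \<longleftrightarrow> w \<in> PiE I (\<lambda>_. {t..})"
        using I by (auto simp: space_clocks_law I(1) PiE_iff extensional_def)
      then show "indicator ?S (w(y := t)) = (indicator (PiE I (\<lambda>_. {t..})) w :: ennreal)"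
        by (simp add: indicator_def)
    qed
    also have "\<dots> = emeasure (PiM I (edge_clock E \<psi> x)) (PiE I (\<lambda>_. {t..}))"
      by (intro nn_integral_indicator sets_PiM_I_finite I) simp
    also have "\<dots> = ?G t"
      by (intro emeasure_PiM I) simp
    finally show "(\<integral>\<^sup>+w. indicator ?S (w(y := t)) \<partial>PiM I (edge_clock E \<psi> x)) = ?G t" .
  qed
  also have "\<dots> = (\<integral>\<^sup>+t. ennreal (\<psi> x y t) * indicator {0..} t * ?G t \<partial>lborel)"
  proof -
    have clock: "edge_clock E \<psi> x y = density lborel (\<lambda>t. ennreal (\<psi> x y t) * indicator {0..} t)"
      using y by (simp add: edge_clock_def clock_law_def)
    have [measurable]: "\<psi> x y \<in> borel_measurable borel"
      by (rule waiting_density_measurable[OF edge_density[OF y]])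
    show ?thesis
      unfolding clock by (rule nn_integral_density) measurable
  qed
  also have "\<dots> = (\<integral>\<^sup>+t. ennreal (indicator {0..} t * jump_density E \<psi> x y t) \<partial>lborel)"
  proof (intro nn_integral_cong)
    fix t :: real
    show "ennreal (\<psi> x y t) * indicator {0..} t * ?G t = ennreal (indicator {0..} t * jump_density E \<psi> x y t)"
    proof (cases "0 \<le> t")
      case True
      have "?G t = (\<Prod>z\<in>I. ennreal (LINT u:{t..}|lborel. \<psi> x z u))"
      proof (intro prod.cong refl)
        fix z assume z: "z \<in> I"
        show "emeasure (edge_clock E \<psi> x z) {t..} = ennreal (LINT u:{t..}|lborel. \<psi> x z u)"
          unfolding finite_measure.emeasure_eq_measure[OF prob_space.finite_measure[OF prob_space_edge_clock]]
          using measure_clock_law_atLeast[OF edge_density[OF IE[OF z]] True] IE[OF z]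
          by (simp add: edge_clock_def)
      qed
      also have "\<dots> = ennreal (\<Prod>z\<in>I. LINT u:{t..}|lborel. \<psi> x z u)"
        using True by (intro prod_ennreal) (simp add: measure_clock_law_atLeast[OF edge_density[OF IE], symmetric])
      finally show ?thesis
        using True waiting_density_nonneg[OF edge_density[OF y] True]
        by (simp add: jump_density_def I_def[symmetric] ennreal_mult' mult.commute)
    qed simp
  qed
  finally have eq: "emeasure (clocks_law E \<psi> x) ?S = \<dots>" .
  have "trans_prob E \<psi> x y = enn2real (\<integral>\<^sup>+t. ennreal (indicator {0..} t * jump_density E \<psi> x y t) \<partial>lborel)"
  proof -
    have [measurable]: "\<psi> x y \<in> borel_measurable borel"
      by (rule waiting_density_measurable[OF edge_density[OF y]])
    \<comment> \<open>With the tails written as measures of half-lines, nonnegativity and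
      measurability of the integrand are immediate.\<close>
    have jump: "indicator {0..} t * jump_density E \<psi> x y t
      = indicator {0..} t * ((\<Prod>z\<in>I. measure (edge_clock E \<psi> x z) {t..}) * \<psi> x y t)" for t
    proof (cases "0 \<le> t")
      case True
      have "(LINT u:{t..}|lborel. \<psi> x z u) = measure (edge_clock E \<psi> x z) {t..}" if "z \<in> I" for z
        using measure_clock_law_atLeast[OF edge_density[OF IE[OF that]] True] IE[OF that]
        by (simp add: edge_clock_def)
      then show ?thesis
        by (simp add: jump_density_def I_def[symmetric])
    qed simp
    have "0 \<le> indicator {0..} t * jump_density E \<psi> x y t" for t
      unfolding jump using waiting_density_nonneg[OF edge_density[OF y], of t]
      by (cases "0 \<le> t") (auto intro!: mult_nonneg_nonneg prod_nonneg)
    moreover have "(\<lambda>t. indicator {0..} t * jump_density E \<psi> x y t) \<in> borel_measurable borel"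
      unfolding jump measure_def by measurable
    ultimately show ?thesis
      using y unfolding trans_prob_def set_lebesgue_integral_def real_scaleR_def
      by (simp add: integral_eq_nn_integral)
  qed
  then show ?thesis
    unfolding eq[symmetric] by (simp add: C.emeasure_eq_measure)
qed

lemma trans_prob_nonneg: "0 \<le> trans_prob E \<psi> x y"
proof (cases "(x, y) \<in> E")
  case True
  have "0 \<le> jump_density E \<psi> x y t" if "0 \<le> t" for t
    unfolding jump_density_def using that waiting_density_nonneg[OF edge_density[OF True] that]
    by (intro mult_nonneg_nonneg prod_nonneg)
      (auto simp: measure_clock_law_atLeast[OF edge_density, symmetric])
  then show ?thesis
    unfolding trans_prob_def set_lebesgue_integral_def
    by (auto intro!: integral_nonneg_AE split: split_indicator)
qed (simp add: trans_prob_def)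

end

section \<open>The past of the process\<close>

locale waiting_jump_process = jump_process P E \<psi> m X W
  for P :: "'w measure" and E :: "('v::finite \<times> 'v) set" and \<psi> :: "'v \<Rightarrow> 'v \<Rightarrow> real \<Rightarrow> real"
    and m :: "'v pmf" and X :: "nat \<Rightarrow> 'w \<Rightarrow> 'v" and W :: "nat \<Rightarrow> 'v \<Rightarrow> 'w \<Rightarrow> real" +
  assumes graph: "waiting_graph E \<psi>"
begin

declare X_measurable [measurable] W_measurable [measurable]

definition sojourn :: "nat \<Rightarrow> 'w \<Rightarrow> real" where
  "sojourn i \<omega> = W i (X (Suc i) \<omega>) \<omega>"

lemma sojourn_measurable [measurable]: "sojourn i \<in> borel_measurable P"
  unfolding sojourn_def
  by (rule measurable_compose_countable'[where I=UNIV]) (auto intro: countable_finite)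

lemma jump_time_eq: "jump_time X W n \<omega> = (\<Sum>i<n. sojourn i \<omega>)"
  by (simp add: jump_time_def sojourn_def)

lemma jump_time_measurable [measurable]: "jump_time X W n \<in> borel_measurable P"
  unfolding jump_time_eq[abs_def] by measurable

definition past_cylinder :: "nat \<Rightarrow> (nat \<Rightarrow> 'v) \<Rightarrow> (nat \<Rightarrow> real set) \<Rightarrow> 'w set" where
  "past_cylinder i x D = {\<omega> \<in> space P. \<forall>j\<le>i. X j \<omega> = x j \<and> jump_time X W j \<omega> \<in> D j}"

definition past_cylinders :: "nat \<Rightarrow> 'w set set" where
  "past_cylinders i = {past_cylinder i x D | x D. \<forall>j. D j \<in> sets borel}"

text \<open>The history at the \<open>i\<close>-th arrival: it contains the nodes up to index
  \<open>i\<close> and the sojourn times of index below \<open>i\<close>, while the clocks started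
  at that arrival are left out.\<close>

definition past :: "nat \<Rightarrow> 'w measure" where
  "past i = sigma (space P) (past_cylinders i)"

lemma past_cylinders_events: "past_cylinders i \<subseteq> events"
  unfolding past_cylinders_def past_cylinder_def by (auto simp: Ball_def)

lemma past_cylinders_Pow: "past_cylinders i \<subseteq> Pow (space P)"
  unfolding past_cylinders_def past_cylinder_def by auto

lemma space_past [simp]: "space (past i) = space P"
  by (simp add: past_def space_measure_of[OF past_cylinders_Pow])

lemma sets_past: "sets (past i) = sigma_sets (space P) (past_cylinders i)"
  by (simp add: past_def sets_measure_of[OF past_cylinders_Pow])

lemma past_cylinder_in_past: "(\<And>j. D j \<in> sets borel) \<Longrightarrow> past_cylinder i x D \<in> sets (past i)"
  unfolding sets_past past_cylinders_def by (intro sigma_sets.Basic) auto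

lemma past_events: "F \<in> sets (past i) \<Longrightarrow> F \<in> events"
  unfolding sets_past using sets.sigma_sets_subset[OF past_cylinders_events] by auto

lemma subalgebra_past: "subalgebra P (past i)"
  by (auto simp: subalgebra_def past_events)

text \<open>A cylinder prescribes a whole path up to time \<open>i\<close>, so an event about single
  coordinates is the union over the finitely many paths compatible with it.\<close>

lemma past_split:
  assumes "j \<le> i" "k \<le> i"
  shows "{\<omega> \<in> space P. X j \<omega> = a \<and> jump_time X W k \<omega> \<in> D}
    = (\<Union>x\<in>{x \<in> PiE {..i} (\<lambda>_. UNIV). x j = a}. past_cylinder i x (\<lambda>l. if l = k then D else UNIV))"
proof (intro set_eqI iffI)
  fix \<omega> assume \<omega>: "\<omega> \<in> {\<omega> \<in> space P. X j \<omega> = a \<and> jump_time X W k \<omega> \<in> D}"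
  let ?x = "restrict (\<lambda>j. X j \<omega>) {..i}"
  have "\<omega> \<in> past_cylinder i ?x (\<lambda>l. if l = k then D else UNIV)"
    using \<omega> by (simp add: past_cylinder_def)
  moreover have "?x \<in> {x \<in> PiE {..i} (\<lambda>_. UNIV). x j = a}"
    using \<omega> assms by simp
  ultimately show "\<omega> \<in> (\<Union>x\<in>{x \<in> PiE {..i} (\<lambda>_. UNIV). x j = a}. past_cylinder i x (\<lambda>l. if l = k then D else UNIV))"
    by (rule UN_I[rotated])
next
  fix \<omega> assume "\<omega> \<in> (\<Union>x\<in>{x \<in> PiE {..i} (\<lambda>_. UNIV). x j = a}. past_cylinder i x (\<lambda>l. if l = k then D else UNIV))"
  then obtain x where "x j = a" "\<omega> \<in> past_cylinder i x (\<lambda>l. if l = k then D else UNIV)"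
    by blast
  then show "\<omega> \<in> {\<omega> \<in> space P. X j \<omega> = a \<and> jump_time X W k \<omega> \<in> D}"
    using assms by (auto simp: past_cylinder_def)
qed

lemma finite_paths: "finite {x \<in> PiE {..i::nat} (\<lambda>_. UNIV :: 'v set). x j = a}"
  by (rule finite_subset[of _ "PiE {..i} (\<lambda>_. UNIV)"]) (auto intro: finite_PiE)

lemma position_jump_time_in_past:
  assumes "j \<le> i" "k \<le> i" "D \<in> sets borel"
  shows "{\<omega> \<in> space P. X j \<omega> = a \<and> jump_time X W k \<omega> \<in> D} \<in> sets (past i)"
  unfolding past_split[OF assms(1,2)] using assms(3)
  by (intro sets.finite_UN finite_paths past_cylinder_in_past) auto

lemma X_past: "j \<le> i \<Longrightarrow> X j \<in> measurable (past i) (count_space UNIV)"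
proof -
  assume j: "j \<le> i"
  have "X j -` {a} \<inter> space (past i) \<in> sets (past i)" for a
  proof -
    have "X j -` {a} \<inter> space (past i) = {\<omega> \<in> space P. X j \<omega> = a \<and> jump_time X W 0 \<omega> \<in> UNIV}"
      by auto
    then show ?thesis
      using position_jump_time_in_past[OF j, of 0 UNIV a] by simp
  qed
  then show ?thesis
    by (simp add: measurable_count_space_eq2)
qed

lemma jump_time_past: "k \<le> i \<Longrightarrow> jump_time X W k \<in> borel_measurable (past i)"
proof (rule measurableI)
  fix D :: "real set" assume D: "D \<in> sets borel" and k: "k \<le> i"
  have "jump_time X W k -` D \<inter> space (past i)
      = (\<Union>a. {\<omega> \<in> space P. X 0 \<omega> = a \<and> jump_time X W k \<omega> \<in> D})"
    by auto
  also have "\<dots> \<in> sets (past i)"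
    using D k by (intro sets.finite_UN position_jump_time_in_past) auto
  finally show "jump_time X W k -` D \<inter> space (past i) \<in> sets (past i)" .
qed simp

lemma sojourn_past: "j < i \<Longrightarrow> sojourn j \<in> borel_measurable (past i)"
proof -
  assume "j < i"
  then have [measurable]: "jump_time X W (Suc j) \<in> borel_measurable (past i)"
      "jump_time X W j \<in> borel_measurable (past i)"
    by (auto intro: jump_time_past)
  have "sojourn j = (\<lambda>\<omega>. jump_time X W (Suc j) \<omega> - jump_time X W j \<omega>)"
    by (simp add: jump_time_eq fun_eq_iff)
  also have "\<dots> \<in> borel_measurable (past i)"
    by measurable
  finally show ?thesis .
qed

lemma reactive_past: "n \<le> i \<Longrightarrow> Measurable.pred (past i) (\<lambda>\<omega>. reactive A B (\<lambda>j. X j \<omega>) n)"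
proof (induction n)
  case 0
  note X_past[OF 0, measurable]
  show ?case
    by (simp only: reactive.simps) measurable
next
  case (Suc n)
  note X_past[OF Suc.prems, measurable]
  have [measurable]: "Measurable.pred (past i) (\<lambda>\<omega>. reactive A B (\<lambda>j. X j \<omega>) n)"
    using Suc by simp
  show ?case
    by (simp only: reactive.simps) measurable
qed

lemma Int_stable_past_cylinders: "Int_stable (past_cylinders i)"
proof (rule Int_stableI)
  fix F F' assume "F \<in> past_cylinders i" "F' \<in> past_cylinders i"
  then obtain x D x' D' where F: "F = past_cylinder i x D" "F' = past_cylinder i x' D'"
    and D: "\<And>j. D j \<in> sets borel" "\<And>j. D' j \<in> sets borel"
    unfolding past_cylinders_def by blast
  \<comment> \<open>Where the two prescribed paths disagree, the set of admissible times becomes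
    empty; this keeps an empty intersection in cylinder form.\<close>
  have "F \<inter> F' = past_cylinder i x (\<lambda>j. {t \<in> D j \<inter> D' j. x j = x' j})"
    unfolding F past_cylinder_def by auto
  moreover have "{t \<in> D j \<inter> D' j. x j = x' j} \<in> sets borel" for j
    using D by (cases "x j = x' j") auto
  ultimately show "F \<inter> F' \<in> past_cylinders i"
    unfolding past_cylinders_def by blast
qed

lemma clocks_past_cylinder:
  assumes D: "\<And>j. D j \<in> sets borel" and C: "\<And>y. C y \<in> sets borel"
  shows "prob (past_cylinder i z D \<inter> {\<omega> \<in> space P. X i \<omega> = x \<and> (\<forall>y\<in>E `` {x}. W i y \<omega> \<in> C y)})
    = prob (past_cylinder i z D \<inter> {\<omega> \<in> space P. X i \<omega> = x})
      * (\<Prod>y\<in>E `` {x}. measure (edge_clock E \<psi> x y) (C y))"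
proof (cases "z i = x")
  case True
  have edge: "measure (edge_clock E \<psi> x y) (C y) = (LINT u:C y \<inter> {0..}|lborel. \<psi> x y u)" if "y \<in> E `` {x}" for y
    using that C by (simp add: edge_clock_def measure_clock_law edge_density[OF graph])
  have "past_cylinder i z D \<inter> {\<omega> \<in> space P. X i \<omega> = x \<and> (\<forall>y\<in>E `` {x}. W i y \<omega> \<in> C y)}
    = {\<omega> \<in> space P. (\<forall>j\<le>i. X j \<omega> = z j \<and> jump_time X W j \<omega> \<in> D j) \<and> (\<forall>y\<in>E `` {z i}. W i y \<omega> \<in> C y)}"
    using True by (auto simp: past_cylinder_def)
  moreover have "past_cylinder i z D \<inter> {\<omega> \<in> space P. X i \<omega> = x}
    = {\<omega> \<in> space P. \<forall>j\<le>i. X j \<omega> = z j \<and> jump_time X W j \<omega> \<in> D j}"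
    using True by (auto simp: past_cylinder_def)
  ultimately show ?thesis
    using clocks[of D C i z] D C True by (simp add: edge)
next
  case False
  then have "past_cylinder i z D \<inter> {\<omega> \<in> space P. X i \<omega> = x} = {}"
    by (auto simp: past_cylinder_def)
  moreover from this have "past_cylinder i z D \<inter> {\<omega> \<in> space P. X i \<omega> = x \<and> (\<forall>y\<in>E `` {x}. W i y \<omega> \<in> C y)} = {}"
    by auto
  ultimately show ?thesis
    by (simp only: measure_empty mult_zero_left)
qed

text \<open>Pi-lambda argument: for fixed \<open>C\<close> the events \<open>F\<close> with this
  factorisation are closed under complements and disjoint countable unions, and cylinders form an
  intersection-stable generator.\<close>

lemma clocks_past:
  assumes F: "F \<in> sets (past i)" and C: "\<And>y. C y \<in> sets borel"
  shows "prob (F \<inter> {\<omega> \<in> space P. X i \<omega> = x \<and> (\<forall>y\<in>E `` {x}. W i y \<omega> \<in> C y)})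
    = prob (F \<inter> {\<omega> \<in> space P. X i \<omega> = x}) * (\<Prod>y\<in>E `` {x}. measure (edge_clock E \<psi> x y) (C y))"
proof -
  define Q where "Q = {\<omega> \<in> space P. X i \<omega> = x}"
  define R where "R = {\<omega> \<in> space P. X i \<omega> = x \<and> (\<forall>y\<in>E `` {x}. W i y \<omega> \<in> C y)}"
  define c where "c = (\<Prod>y\<in>E `` {x}. measure (edge_clock E \<psi> x y) (C y))"
  note C[measurable]
  have [measurable]: "Q \<in> events" "R \<in> events"
    unfolding Q_def R_def by measurable
  have cyl: "prob (past_cylinder i z D \<inter> R) = prob (past_cylinder i z D \<inter> Q) * c"
    if "\<And>j. D j \<in> sets borel" for z D
    unfolding Q_def R_def c_def by (rule clocks_past_cylinder[OF that C])
  \<comment> \<open>The complement step needs the identity on the whole space, which is not itself a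
    cylinder but a disjoint union of finitely many of them, one per path.\<close>
  have all: "prob R = prob Q * c"
  proof -
    let ?Z = "PiE {..i} (\<lambda>_. UNIV :: 'v set)"
    let ?K = "\<lambda>z. past_cylinder i z (\<lambda>_. UNIV)"
    have Z: "finite ?Z"
      by (intro finite_PiE) auto
    have K: "?K z \<in> events" for z
      by (intro past_events[of _ i] past_cylinder_in_past) simp
    have "space P = (\<Union>z\<in>?Z. ?K z)"
    proof (intro set_eqI iffI)
      fix \<omega> assume "\<omega> \<in> space P"
      then have "\<omega> \<in> ?K (restrict (\<lambda>j. X j \<omega>) {..i})"
        by (simp add: past_cylinder_def)
      then show "\<omega> \<in> (\<Union>z\<in>?Z. ?K z)"
        by (intro UN_I[of "restrict (\<lambda>j. X j \<omega>) {..i}"]) simp_all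
    qed (auto simp: past_cylinder_def)
    moreover have "disjoint_family_on ?K ?Z"
      unfolding disjoint_family_on_def
    proof (intro ballI impI)
      fix z z' assume z: "z \<in> ?Z" "z' \<in> ?Z" "z \<noteq> z'"
      then obtain j where "j \<le> i" "z j \<noteq> z' j"
        by (metis PiE_ext atMost_iff)
      then show "?K z \<inter> ?K z' = {}"
        by (auto simp: past_cylinder_def)
    qed
    ultimately have split: "prob S = (\<Sum>z\<in>?Z. prob (?K z \<inter> S))" if "S \<in> events" for S
    proof -
      have "S = (\<Union>z\<in>?Z. ?K z \<inter> S)"
        using sets.sets_into_space[OF that] \<open>space P = (\<Union>z\<in>?Z. ?K z)\<close> by auto
      then have "prob S = prob (\<Union>z\<in>?Z. ?K z \<inter> S)"
        by simp
      also have "\<dots> = (\<Sum>z\<in>?Z. prob (?K z \<inter> S))"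
        using \<open>disjoint_family_on ?K ?Z\<close> that K
        by (intro finite_measure_finite_Union Z) (auto simp: disjoint_family_on_def)
      finally show ?thesis .
    qed
    show ?thesis
      unfolding split[OF \<open>R \<in> events\<close>] split[OF \<open>Q \<in> events\<close>] by (simp add: cyl sum_distrib_right)
  qed
  have "prob (F \<inter> R) = prob (F \<inter> Q) * c"
    using Int_stable_past_cylinders past_cylinders_Pow F[unfolded sets_past]
  proof (induction rule: sigma_sets_induct_disjoint)
    case (basic F)
    then show ?case
      by (auto simp: past_cylinders_def cyl)
  next
    case (compl F)
    then have "F \<in> events"
      by (intro past_events[of _ i]) (simp add: sets_past)
    have "prob ((space P - F) \<inter> S) = prob S - prob (F \<inter> S)" if "S \<in> events" for S
    proof -
      have "(space P - F) \<inter> S = S - F"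
        using sets.sets_into_space[OF that] by auto
      then show ?thesis
        using finite_measure_Diff'[OF that \<open>F \<in> events\<close>] by (simp add: Int_commute)
    qed
    then show ?case
      using compl.IH all by (simp add: left_diff_distrib)
  next
    case (union A)
    then have A: "A n \<in> events" for n
      by (intro past_events[of _ i]) (auto simp: sets_past)
    have "(\<lambda>n. prob (A n \<inter> S)) sums prob ((\<Union>n. A n) \<inter> S)" if "S \<in> events" for S
    proof -
      have "(\<lambda>n. prob (A n \<inter> S)) sums prob (\<Union>n. A n \<inter> S)"
        using A that union.hyps(1)
        by (intro finite_measure_UNION) (auto simp: disjoint_family_on_def)
      moreover have "(\<Union>n. A n \<inter> S) = (\<Union>n. A n) \<inter> S"
        by auto
      ultimately show ?thesis
        by simp
    qed
    from sums_mult2[OF this[OF \<open>Q \<in> events\<close>], of c] this[OF \<open>R \<in> events\<close>] show ?case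
      by (simp add: union.IH sums_unique2)
  qed simp
  then show ?thesis
    by (simp add: Q_def R_def c_def)
qed

section \<open>Joint law of the clocks given the past\<close>

text \<open>The node \<open>x\<close> is a fixed parameter, so that the target product space is not
  random; the vector is used only on the event that \<open>X i\<close> equals
  \<open>x\<close>.\<close>

definition clock_vector :: "nat \<Rightarrow> 'v \<Rightarrow> 'w \<Rightarrow> 'v \<Rightarrow> real" where
  "clock_vector i x \<omega> = (\<lambda>y\<in>E `` {x}. W i y \<omega>)"

lemma clock_vector_measurable [measurable]: "clock_vector i x \<in> measurable P (clocks_law E \<psi> x)"
  unfolding measurable_cong_sets[OF refl sets_clocks_law] clock_vector_def by measurable

text \<open>On a past event with \<open>X i\<close> at \<open>x\<close>, the image measure of the
  clocks and the scaled product law agree on boxes by \<open>clocks_past\<close>, hence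
  everywhere.\<close>

lemma nn_integral_clock_vector:
  assumes F: "F \<in> sets (past i)" and g: "g \<in> borel_measurable (clocks_law E \<psi> x)"
  shows "(\<integral>\<^sup>+\<omega>. g (clock_vector i x \<omega>) * indicator (F \<inter> {\<omega> \<in> space P. X i \<omega> = x}) \<omega> \<partial>P)
    = prob (F \<inter> {\<omega> \<in> space P. X i \<omega> = x}) * (\<integral>\<^sup>+w. g w \<partial>clocks_law E \<psi> x)"
proof -
  define F' where "F' = F \<inter> {\<omega> \<in> space P. X i \<omega> = x}"
  have [measurable]: "F' \<in> events"
    unfolding F'_def using past_events[OF F] by measurable
  interpret C: prob_space "clocks_law E \<psi> x"
    by (rule prob_space_clocks_law[OF graph])
  have "distr (density P (indicator F')) (clocks_law E \<psi> x) (clock_vector i x)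
      = scale_measure (prob F') (clocks_law E \<psi> x)"
  proof (rule measure_eqI_PiM_finite[where I="E `` {x}" and M="\<lambda>_. borel" and A="\<lambda>_. space (clocks_law E \<psi> x)"])
    fix C :: "'v \<Rightarrow> real set" assume "\<And>y. y \<in> E `` {x} \<Longrightarrow> C y \<in> sets borel"
    \<comment> \<open>\<open>clocks_past\<close> asks for measurable sets at all nodes, while
      \<open>C\<close> is controlled on the edges from \<open>x\<close> only.\<close>
    define C' where "C' y = (if y \<in> E `` {x} then C y else {})" for y
    have C': "C' y \<in> sets borel" for y
      unfolding C'_def using \<open>\<And>y. y \<in> E `` {x} \<Longrightarrow> C y \<in> sets borel\<close> by auto
    have PiE: "PiE (E `` {x}) C = PiE (E `` {x}) C'"
      by (rule PiE_cong) (simp add: C'_def)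
    have box[measurable]: "PiE (E `` {x}) C' \<in> sets (clocks_law E \<psi> x)"
      unfolding sets_clocks_law by (intro sets_PiM_I_finite C') simp
    have "emeasure (distr (density P (indicator F')) (clocks_law E \<psi> x) (clock_vector i x)) (PiE (E `` {x}) C')
        = emeasure P (F' \<inter> (clock_vector i x -` PiE (E `` {x}) C' \<inter> space P))"
      by (subst emeasure_distr) (auto simp: emeasure_restricted)
    also have "F' \<inter> (clock_vector i x -` PiE (E `` {x}) C' \<inter> space P)
        = F \<inter> {\<omega> \<in> space P. X i \<omega> = x \<and> (\<forall>y\<in>E `` {x}. W i y \<omega> \<in> C' y)}"
      unfolding F'_def clock_vector_def by (auto simp: PiE_iff)
    also have "emeasure P \<dots> = ennreal (prob F' * (\<Prod>y\<in>E `` {x}. measure (edge_clock E \<psi> x y) (C' y)))"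
      unfolding emeasure_eq_measure F'_def clocks_past[OF F C'] ..
    also have "\<dots> = ennreal (prob F') * (\<Prod>y\<in>E `` {x}. emeasure (edge_clock E \<psi> x y) (C' y))"
      by (simp add: ennreal_mult' prod_ennreal[symmetric]
          finite_measure.emeasure_eq_measure[OF prob_space.finite_measure[OF prob_space_edge_clock[OF graph]]])
    also have "\<dots> = emeasure (scale_measure (prob F') (clocks_law E \<psi> x)) (PiE (E `` {x}) C')"
      by (simp add: emeasure_clocks_law_box[OF graph] C')
    finally show "emeasure (distr (density P (indicator F')) (clocks_law E \<psi> x) (clock_vector i x)) (PiE (E `` {x}) C)
        = emeasure (scale_measure (prob F') (clocks_law E \<psi> x)) (PiE (E `` {x}) C)"
      unfolding PiE .
  next
    show "range (\<lambda>_::nat. space (clocks_law E \<psi> x)) \<subseteq> prod_algebra (E `` {x}) (\<lambda>_. borel)"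
      by (auto simp: space_clocks_law intro!: prod_algebraI_finite)
    show "(\<Union>_::nat. space (clocks_law E \<psi> x)) = space (PiM (E `` {x}) (\<lambda>_. borel))"
      by (simp add: space_clocks_law space_PiM)
    show "emeasure (distr (density P (indicator F')) (clocks_law E \<psi> x) (clock_vector i x))
        (space (clocks_law E \<psi> x)) \<noteq> \<infinity>" for j :: nat
      by (subst emeasure_distr) (auto simp: emeasure_restricted emeasure_eq_measure)
  qed (simp_all add: sets_clocks_law)
  then have "(\<integral>\<^sup>+w. g w \<partial>distr (density P (indicator F')) (clocks_law E \<psi> x) (clock_vector i x))
      = (\<integral>\<^sup>+w. g w \<partial>scale_measure (prob F') (clocks_law E \<psi> x))"
    by simp
  then show ?thesis
    using g unfolding F'_def[symmetric]
    by (simp add: nn_integral_distr nn_integral_density nn_integral_scale_measure mult.commute)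
qed

text \<open>The clocks determine the least waiting time but, because of possible ties, not the node
  that attains it; so the next node is only said to be a minimiser.\<close>

lemma sojourn_eq_Min:
  "AE \<omega> in P. X (Suc i) \<omega> \<in> E `` {X i \<omega>} \<and> sojourn i \<omega> = Min (clock_vector i (X i \<omega>) \<omega> ` (E `` {X i \<omega>}))
     \<and> (\<forall>z\<in>E `` {X i \<omega>}. W i (X (Suc i) \<omega>) \<omega> \<le> W i z \<omega>)"
  using jump[of i]
proof eventually_elim
  case (elim \<omega>)
  then have in_E: "X (Suc i) \<omega> \<in> E `` {X i \<omega>}" and le: "\<And>z. z \<in> E `` {X i \<omega>} \<Longrightarrow> W i (X (Suc i) \<omega>) \<omega> \<le> W i z \<omega>"
    by (auto simp: is_arg_min_linorder)
  have "Min (clock_vector i (X i \<omega>) \<omega> ` (E `` {X i \<omega>})) = W i (X (Suc i) \<omega>) \<omega>"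
    using in_E le by (intro Min_eqI) (auto simp: clock_vector_def image_iff intro!: bexI[of _ "X (Suc i) \<omega>"])
  with in_E le show ?case
    by (simp add: sojourn_def)
qed

lemma nn_integral_sojourn:
  assumes F: "F \<in> sets (past i)" and [measurable]: "h \<in> borel_measurable borel"
  shows "(\<integral>\<^sup>+\<omega>. h (sojourn i \<omega>) * indicator (F \<inter> {\<omega> \<in> space P. X i \<omega> = x}) \<omega> \<partial>P)
    = prob (F \<inter> {\<omega> \<in> space P. X i \<omega> = x}) * (\<integral>\<^sup>+t. h t \<partial>sojourn_law E \<psi> x)"
proof -
  have Min[measurable]: "(\<lambda>w. Min (w ` (E `` {x}))) \<in> borel_measurable (clocks_law E \<psi> x)"
    unfolding measurable_cong_sets[OF sets_clocks_law refl] by (rule Min_measurable_clocks_law)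
  have "(\<integral>\<^sup>+\<omega>. h (sojourn i \<omega>) * indicator (F \<inter> {\<omega> \<in> space P. X i \<omega> = x}) \<omega> \<partial>P)
      = (\<integral>\<^sup>+\<omega>. h (Min (clock_vector i x \<omega> ` (E `` {x}))) * indicator (F \<inter> {\<omega> \<in> space P. X i \<omega> = x}) \<omega> \<partial>P)"
  proof (rule nn_integral_cong_AE)
    show "AE \<omega> in P. h (sojourn i \<omega>) * indicator (F \<inter> {\<omega> \<in> space P. X i \<omega> = x}) \<omega>
        = h (Min (clock_vector i x \<omega> ` (E `` {x}))) * indicator (F \<inter> {\<omega> \<in> space P. X i \<omega> = x}) \<omega>"
      using sojourn_eq_Min[of i] by eventually_elim (simp split: split_indicator)
  qed
  also have "\<dots> = prob (F \<inter> {\<omega> \<in> space P. X i \<omega> = x}) * (\<integral>\<^sup>+w. h (Min (w ` (E `` {x}))) \<partial>clocks_law E \<psi> x)"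
    by (rule nn_integral_clock_vector[OF F]) measurable
  also have "(\<integral>\<^sup>+w. h (Min (w ` (E `` {x}))) \<partial>clocks_law E \<psi> x) = (\<integral>\<^sup>+t. h t \<partial>sojourn_law E \<psi> x)"
    unfolding sojourn_law_def by (subst nn_integral_distr) auto
  finally show ?thesis .
qed

text \<open>A jump to \<open>y\<close> makes the clock of \<open>y\<close> minimal. The converse
  would need the absence of ties, so only one inequality is obtained here; \<open>transition\<close>
  upgrades it to an equality.\<close>

lemma transition_le:
  assumes F: "F \<in> sets (past i)"
  shows "prob (F \<inter> {\<omega> \<in> space P. X i \<omega> = x \<and> X (Suc i) \<omega> = y})
    \<le> prob (F \<inter> {\<omega> \<in> space P. X i \<omega> = x}) * trans_prob E \<psi> x y"
proof (cases "(x, y) \<in> E")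
  case True
  let ?S = "{w \<in> space (clocks_law E \<psi> x). \<forall>z\<in>E `` {x}. w y \<le> w z}"
  note past_events[OF F, measurable]
  have "(\<lambda>w. w z) \<in> borel_measurable (clocks_law E \<psi> x)" if "z \<in> E `` {x}" for z
    using that unfolding measurable_cong_sets[OF sets_clocks_law refl] by (rule measurable_component_singleton)
  then have S[measurable]: "?S \<in> sets (clocks_law E \<psi> x)"
    using True by (intro sets.sets_Collect_finite_All borel_measurable_le) auto
  have "ennreal (prob (F \<inter> {\<omega> \<in> space P. X i \<omega> = x \<and> X (Suc i) \<omega> = y}))
      = (\<integral>\<^sup>+\<omega>. indicator (F \<inter> {\<omega> \<in> space P. X i \<omega> = x \<and> X (Suc i) \<omega> = y}) \<omega> \<partial>P)"
    by (subst nn_integral_indicator) (auto simp: emeasure_eq_measure)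
  also have "\<dots> \<le> (\<integral>\<^sup>+\<omega>. indicator ?S (clock_vector i x \<omega>) * indicator (F \<inter> {\<omega> \<in> space P. X i \<omega> = x}) \<omega> \<partial>P)"
  proof (rule nn_integral_mono_AE)
    show "AE \<omega> in P. indicator (F \<inter> {\<omega> \<in> space P. X i \<omega> = x \<and> X (Suc i) \<omega> = y}) \<omega>
        \<le> indicator ?S (clock_vector i x \<omega>)
          * (indicator (F \<inter> {\<omega> \<in> space P. X i \<omega> = x}) \<omega> :: ennreal)"
      using sojourn_eq_Min[of i]
      by eventually_elim (use True in \<open>auto simp: clock_vector_def space_clocks_law split: split_indicator\<close>)
  qed
  also have "\<dots> = prob (F \<inter> {\<omega> \<in> space P. X i \<omega> = x}) * (\<integral>\<^sup>+w. indicator ?S w \<partial>clocks_law E \<psi> x)"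
    by (rule nn_integral_clock_vector[OF F]) measurable
  also have "(\<integral>\<^sup>+w. indicator ?S w \<partial>clocks_law E \<psi> x) = ennreal (trans_prob E \<psi> x y)"
    unfolding nn_integral_indicator[OF S] by (rule emeasure_clocks_law_arg_min[OF graph True])
  finally show ?thesis
    by (simp add: ennreal_mult'[symmetric] trans_prob_nonneg[OF graph])
next
  case False
  have "prob (F \<inter> {\<omega> \<in> space P. X i \<omega> = x \<and> X (Suc i) \<omega> = y}) \<le> prob {}"
  proof (rule finite_measure_mono_AE)
    show "AE \<omega> in P. \<omega> \<in> F \<inter> {\<omega> \<in> space P. X i \<omega> = x \<and> X (Suc i) \<omega> = y} \<longrightarrow> \<omega> \<in> {}"
      using sojourn_eq_Min[of i] by eventually_elim (use False in auto)
  qed simp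
  then show ?thesis
    using False by (simp add: trans_prob_def)
qed

end

section \<open>Laws of large numbers for the process\<close>

locale ergodic_jump_process = waiting_jump_process P E \<psi> m X W
  for P :: "'w measure" and E :: "('v::finite \<times> 'v) set" and \<psi> :: "'v \<Rightarrow> 'v \<Rightarrow> real \<Rightarrow> real"
    and m :: "'v pmf" and X :: "nat \<Rightarrow> 'w \<Rightarrow> 'v" and W :: "nat \<Rightarrow> 'v \<Rightarrow> 'w \<Rightarrow> real" +
  assumes irreducible: "irreducible_chain (trans_prob E \<psi>)"
    and invariant_iff: "invariant_dist (trans_prob E \<psi>) m' \<longleftrightarrow> m' = m"
begin

abbreviation p :: "'v \<Rightarrow> 'v \<Rightarrow> real" where
  "p \<equiv> trans_prob E \<psi>"

lemma p_nonneg: "0 \<le> p x y"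
  by (rule trans_prob_nonneg[OF graph])

lemma nstep_prob_nonneg: "0 \<le> nstep_prob p n x y"
  by (induction n arbitrary: x) (auto intro!: sum_nonneg mult_nonneg_nonneg p_nonneg)

lemma invariant: "(\<Sum>x\<in>UNIV. pmf m x * p x y) = pmf m y"
  using invariant_iff[of m] by (simp add: invariant_dist_def)

lemma invariant_nstep: "(\<Sum>x\<in>UNIV. pmf m x * nstep_prob p n x y) = pmf m y"
proof (induction n)
  case 0
  have "(\<Sum>x\<in>UNIV. pmf m x * (if x = y then 1 else 0)) = (\<Sum>x\<in>UNIV. if x = y then pmf m x else 0)"
    by (intro sum.cong) auto
  then show ?case
    by simp
next
  case (Suc n)
  have "(\<Sum>x\<in>UNIV. pmf m x * nstep_prob p (Suc n) x y)
      = (\<Sum>x\<in>UNIV. \<Sum>z\<in>UNIV. pmf m x * p x z * nstep_prob p n z y)"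
    by (simp add: sum_distrib_left mult.assoc)
  also have "\<dots> = (\<Sum>z\<in>UNIV. (\<Sum>x\<in>UNIV. pmf m x * p x z) * nstep_prob p n z y)"
    by (subst sum.swap) (simp add: sum_distrib_right)
  finally show ?case
    by (simp add: invariant Suc.IH)
qed

text \<open>By irreducibility some node in the support of \<open>m\<close> sends mass to
  \<open>x\<close> in \<open>n\<close> steps, and by invariance that mass is part of
  \<open>pmf m x\<close>.\<close>

lemma m_pos: "0 < pmf m x"
proof -
  obtain z where z: "z \<in> set_pmf m"
    using set_pmf_not_empty[of m] by blast
  obtain n where n: "nstep_prob p n z x > 0"
    using irreducible by (auto simp: irreducible_chain_def)
  have "0 < pmf m z * nstep_prob p n z x"
    using z n by (simp add: pmf_positive)
  also have "\<dots> \<le> (\<Sum>y\<in>UNIV. pmf m y * nstep_prob p n y x)"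
    by (rule member_le_sum) (auto intro!: mult_nonneg_nonneg nstep_prob_nonneg)
  finally show ?thesis
    by (simp add: invariant_nstep)
qed

lemma prob_start: "prob {\<omega> \<in> space P. X 0 \<omega> = x} = pmf m x"
proof -
  have "pmf m x = measure (distr P (count_space UNIV) (X 0)) {x}"
    by (simp add: start measure_pmf_single)
  also have "\<dots> = prob {\<omega> \<in> space P. X 0 \<omega> = x}"
    by (subst measure_distr) (auto intro!: arg_cong[where f=prob])
  finally show ?thesis ..
qed

lemma sum_prob_next:
  assumes F: "F \<in> sets (past i)"
  shows "(\<Sum>y\<in>UNIV. prob (F \<inter> {\<omega> \<in> space P. X i \<omega> = x \<and> X (Suc i) \<omega> = y}))
    = prob (F \<inter> {\<omega> \<in> space P. X i \<omega> = x})"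
proof -
  note past_events[OF F, measurable]
  let ?S = "\<lambda>y. F \<inter> {\<omega> \<in> space P. X i \<omega> = x \<and> X (Suc i) \<omega> = y}"
  have "prob (\<Union>y\<in>UNIV. ?S y) = (\<Sum>y\<in>UNIV. prob (?S y))"
    by (rule finite_measure_finite_Union) (auto simp: disjoint_family_on_def)
  moreover have "(\<Union>y\<in>UNIV. ?S y) = F \<inter> {\<omega> \<in> space P. X i \<omega> = x}"
    by auto
  ultimately show ?thesis
    by simp
qed

text \<open>At time \<open>0\<close> every node has positive mass, so \<open>transition_le\<close> bounds the row sums of \<open>p\<close> from
  below by \<open>1\<close>; invariance of \<open>m\<close> excludes a larger sum.  In this way ties between clocks need
  not be discussed.\<close>

lemma sum_p: "(\<Sum>y\<in>UNIV. p x y) = 1"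
proof -
  have ge: "1 \<le> (\<Sum>y\<in>UNIV. p x y)" for x
  proof -
    have S: "space P \<in> sets (past 0)"
      by (metis sets.top space_past)
    have "pmf m x = prob (space P \<inter> {\<omega> \<in> space P. X 0 \<omega> = x})"
      by (simp add: prob_start[symmetric] Int_def conj_ac)
    also have "\<dots> = (\<Sum>y\<in>UNIV. prob (space P \<inter> {\<omega> \<in> space P. X 0 \<omega> = x \<and> X (Suc 0) \<omega> = y}))"
      by (rule sum_prob_next[OF S, symmetric])
    also have "\<dots> \<le> (\<Sum>y\<in>UNIV. prob (space P \<inter> {\<omega> \<in> space P. X 0 \<omega> = x}) * p x y)"
      by (intro sum_mono transition_le S)
    also have "\<dots> = pmf m x * (\<Sum>y\<in>UNIV. p x y)"
      by (simp add: prob_start[symmetric] Int_def conj_ac sum_distrib_left)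
    finally show ?thesis
      using m_pos[of x] by simp
  qed
  have "(\<Sum>x\<in>UNIV. pmf m x * ((\<Sum>y\<in>UNIV. p x y) - 1))
      = (\<Sum>y\<in>UNIV. \<Sum>x\<in>UNIV. pmf m x * p x y) - (\<Sum>x\<in>UNIV. pmf m x)"
    by (subst sum.swap) (simp add: right_diff_distrib sum_subtractf sum_distrib_left)
  also have "\<dots> = 0"
    by (simp add: invariant)
  finally have "pmf m x * ((\<Sum>y\<in>UNIV. p x y) - 1) = 0"
    using ge by (subst (asm) sum_nonneg_eq_0_iff) auto
  then show ?thesis
    using m_pos[of x] by simp
qed

lemma edges_nonempty: "E `` {x} \<noteq> {}"
proof
  assume "E `` {x} = {}"
  then have "p x y = 0" for y
    by (auto simp: trans_prob_def)
  then show False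
    using sum_p[of x] by simp
qed

text \<open>Both sides have the same sum over \<open>y\<close> because the rows of \<open>p\<close>
  sum to 1, so the termwise inequality \<open>transition_le\<close> must be an equality.\<close>

lemma transition:
  assumes F: "F \<in> sets (past i)"
  shows "prob (F \<inter> {\<omega> \<in> space P. X i \<omega> = x \<and> X (Suc i) \<omega> = y})
    = prob (F \<inter> {\<omega> \<in> space P. X i \<omega> = x}) * p x y"
proof -
  have "(\<Sum>y\<in>UNIV. prob (F \<inter> {\<omega> \<in> space P. X i \<omega> = x \<and> X (Suc i) \<omega> = y}))
      = (\<Sum>y\<in>UNIV. prob (F \<inter> {\<omega> \<in> space P. X i \<omega> = x}) * p x y)"
    by (simp add: sum_prob_next[OF F] sum_p sum_distrib_left[symmetric])
  from sum_mono_inv[OF this transition_le[OF F]] show ?thesis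
    by simp
qed

lemma set_integral_position:
  fixes e :: "'v \<Rightarrow> real"
  assumes F: "F \<in> sets (past i)"
  shows "(LINT \<omega>:F|P. e (X i \<omega>)) = (\<Sum>x\<in>UNIV. prob (F \<inter> {\<omega> \<in> space P. X i \<omega> = x}) * e x)"
proof -
  note past_events[OF F, measurable]
  have "(LINT \<omega>:F|P. e (X i \<omega>))
      = (LINT \<omega>|P. (\<Sum>x\<in>UNIV. indicator (F \<inter> {\<omega> \<in> space P. X i \<omega> = x}) \<omega> * e x))"
    unfolding set_lebesgue_integral_def
  proof (intro Bochner_Integration.integral_cong refl)
    fix \<omega> assume "\<omega> \<in> space P"
    then have "(\<Sum>x\<in>UNIV. indicator (F \<inter> {\<omega> \<in> space P. X i \<omega> = x}) \<omega> * e x)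
        = (\<Sum>x\<in>UNIV. if x = X i \<omega> then indicator F \<omega> * e x else 0)"
      by (intro sum.cong) (auto split: split_indicator)
    then show "indicator F \<omega> *\<^sub>R e (X i \<omega>) = (\<Sum>x\<in>UNIV. indicator (F \<inter> {\<omega> \<in> space P. X i \<omega> = x}) \<omega> * e x)"
      by simp
  qed
  also have "\<dots> = (\<Sum>x\<in>UNIV. prob (F \<inter> {\<omega> \<in> space P. X i \<omega> = x}) * e x)"
    by (subst Bochner_Integration.integral_sum)
      (auto simp: emeasure_eq_measure intro!: integrable_mult_left integrable_real_indicator)
  finally show ?thesis .
qed

lemma set_integral_next_position:
  fixes f :: "'v \<Rightarrow> real"
  assumes F: "F \<in> sets (past i)"
  shows "(LINT \<omega>:F|P. f (X (Suc i) \<omega>))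
    = (\<Sum>x\<in>UNIV. prob (F \<inter> {\<omega> \<in> space P. X i \<omega> = x}) * (\<Sum>y\<in>UNIV. p x y * f y))"
proof -
  note past_events[OF F, measurable]
  let ?S = "\<lambda>x y. F \<inter> {\<omega> \<in> space P. X i \<omega> = x \<and> X (Suc i) \<omega> = y}"
  have "(LINT \<omega>:F|P. f (X (Suc i) \<omega>))
      = (LINT \<omega>|P. (\<Sum>x\<in>UNIV. \<Sum>y\<in>UNIV. indicator (?S x y) \<omega> * f y))"
    unfolding set_lebesgue_integral_def
  proof (intro Bochner_Integration.integral_cong refl)
    fix \<omega> assume "\<omega> \<in> space P"
    then have "(\<Sum>x\<in>UNIV. \<Sum>y\<in>UNIV. indicator (?S x y) \<omega> * f y)
        = (\<Sum>x\<in>UNIV. \<Sum>y\<in>UNIV. if y = X (Suc i) \<omega> then (if x = X i \<omega> then indicator F \<omega> * f y else 0) else 0)"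
      by (intro sum.cong) (auto split: split_indicator)
    then show "indicator F \<omega> *\<^sub>R f (X (Suc i) \<omega>) = (\<Sum>x\<in>UNIV. \<Sum>y\<in>UNIV. indicator (?S x y) \<omega> * f y)"
      by simp
  qed
  also have "\<dots> = (\<Sum>x\<in>UNIV. \<Sum>y\<in>UNIV. prob (?S x y) * f y)"
  proof -
    have int: "integrable P (\<lambda>\<omega>. indicator (?S x y) \<omega> * f y)" for x y
      by (intro integrable_mult_left integrable_real_indicator) (auto simp: emeasure_eq_measure)
    have "(LINT \<omega>|P. (\<Sum>x\<in>UNIV. \<Sum>y\<in>UNIV. indicator (?S x y) \<omega> * f y))
        = (\<Sum>x\<in>UNIV. LINT \<omega>|P. (\<Sum>y\<in>UNIV. indicator (?S x y) \<omega> * f y))"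
      by (intro Bochner_Integration.integral_sum Bochner_Integration.integrable_sum int)
    also have "\<dots> = (\<Sum>x\<in>UNIV. \<Sum>y\<in>UNIV. LINT \<omega>|P. indicator (?S x y) \<omega> * f y)"
      by (intro sum.cong refl Bochner_Integration.integral_sum int)
    finally show ?thesis
      by simp
  qed
  also have "\<dots> = (\<Sum>x\<in>UNIV. prob (F \<inter> {\<omega> \<in> space P. X i \<omega> = x}) * (\<Sum>y\<in>UNIV. p x y * f y))"
    by (simp add: transition[OF F] sum_distrib_left mult.assoc)
  finally show ?thesis .
qed

lemma set_integral_sojourn:
  fixes h :: "real \<Rightarrow> real"
  assumes F: "F \<in> sets (past i)" and h: "h \<in> borel_measurable borel" "\<And>t. 0 \<le> h t" "\<And>t. h t \<le> C"
  shows "(LINT \<omega>:F|P. h (sojourn i \<omega>))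
    = (\<Sum>x\<in>UNIV. prob (F \<inter> {\<omega> \<in> space P. X i \<omega> = x}) * (LINT t|sojourn_law E \<psi> x. h t))"
proof -
  note past_events[OF F, measurable] h(1)[measurable]
  let ?S = "\<lambda>x. F \<inter> {\<omega> \<in> space P. X i \<omega> = x}"
  have fin: "(\<integral>\<^sup>+t. ennreal (h t) \<partial>sojourn_law E \<psi> x) = ennreal (LINT t|sojourn_law E \<psi> x. h t)" for x
  proof (rule nn_integral_eq_integral)
    interpret S: prob_space "sojourn_law E \<psi> x"
      by (rule prob_space_sojourn_law[OF graph])
    show "integrable (sojourn_law E \<psi> x) h"
      by (rule S.integrable_const_bound[of _ C]) (auto simp: h)
  qed (simp add: h)
  have L0: "0 \<le> (LINT t|sojourn_law E \<psi> x. h t)" for x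
    by (rule integral_nonneg_AE) (simp add: h)
  have "(LINT \<omega>:F|P. h (sojourn i \<omega>)) = enn2real (\<integral>\<^sup>+\<omega>. ennreal (indicator F \<omega> * h (sojourn i \<omega>)) \<partial>P)"
    unfolding set_lebesgue_integral_def real_scaleR_def
    by (rule integral_eq_nn_integral) (auto simp: h)
  also have "(\<integral>\<^sup>+\<omega>. ennreal (indicator F \<omega> * h (sojourn i \<omega>)) \<partial>P)
      = (\<integral>\<^sup>+\<omega>. (\<Sum>x\<in>UNIV. ennreal (h (sojourn i \<omega>)) * indicator (?S x) \<omega>) \<partial>P)"
  proof (intro nn_integral_cong)
    fix \<omega> assume "\<omega> \<in> space P"
    then have "(\<Sum>x\<in>UNIV. ennreal (h (sojourn i \<omega>)) * indicator (?S x) \<omega>)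
        = (\<Sum>x\<in>UNIV. if x = X i \<omega> then ennreal (indicator F \<omega> * h (sojourn i \<omega>)) else 0)"
      by (intro sum.cong) (auto split: split_indicator)
    then show "ennreal (indicator F \<omega> * h (sojourn i \<omega>))
        = (\<Sum>x\<in>UNIV. ennreal (h (sojourn i \<omega>)) * indicator (?S x) \<omega>)"
      by simp
  qed
  also have "\<dots> = (\<Sum>x\<in>UNIV. \<integral>\<^sup>+\<omega>. ennreal (h (sojourn i \<omega>)) * indicator (?S x) \<omega> \<partial>P)"
    by (rule nn_integral_sum) measurable
  also have "\<dots> = (\<Sum>x\<in>UNIV. ennreal (prob (?S x)) * ennreal (LINT t|sojourn_law E \<psi> x. h t))"
    by (intro sum.cong refl, subst nn_integral_sojourn[OF F, of "\<lambda>t. ennreal (h t)"]) (auto simp: fin)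
  also have "\<dots> = ennreal (\<Sum>x\<in>UNIV. prob (?S x) * (LINT t|sojourn_law E \<psi> x. h t))"
    by (simp add: ennreal_mult'[symmetric] L0 sum_ennreal)
  finally show ?thesis
    by (simp add: L0 sum_nonneg)
qed

text \<open>The hypothesis \<open>zero\<close> says that the conditional expectation of
  \<open>Z\<close> given the past vanishes, and a bounded past factor can be taken out of
  it.\<close>

lemma expectation_past_times_centered:
  fixes Z G :: "'w \<Rightarrow> real"
  assumes Z: "Z \<in> borel_measurable P" "\<And>\<omega>. \<bar>Z \<omega>\<bar> \<le> C"
    and zero: "\<And>F. F \<in> sets (past i) \<Longrightarrow> (LINT \<omega>:F|P. Z \<omega>) = 0"
    and G: "G \<in> borel_measurable (past i)" "\<And>\<omega>. \<bar>G \<omega>\<bar> \<le> D"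
  shows "expectation (\<lambda>\<omega>. G \<omega> * Z \<omega>) = 0"
proof -
  interpret S: finite_measure_subalgebra P "past i"
    by standard (rule subalgebra_past)
  have G': "G \<in> borel_measurable P"
    by (rule measurable_from_subalg[OF subalgebra_past G(1)])
  have "0 \<le> D"
    by (rule order_trans[OF abs_ge_zero G(2)])
  then have int: "integrable P (\<lambda>\<omega>. G \<omega> * Z \<omega>)"
    using Z G G' by (intro integrable_const_bound[of _ "D * C"]) (auto simp: abs_mult intro!: mult_mono)
  have "AE \<omega> in P. real_cond_exp P (past i) Z \<omega> = 0"
    using Z zero by (intro S.real_cond_exp_charact)
      (auto intro!: integrable_const_bound[of _ C] simp: set_lebesgue_integral_def)
  then have "expectation (\<lambda>\<omega>. G \<omega> * real_cond_exp P (past i) Z \<omega>) = expectation (\<lambda>\<omega>. 0)"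
    using G' by (intro integral_cong_AE) (auto elim!: eventually_mono)
  then show ?thesis
    using S.real_cond_exp_intg(2)[OF int G(1) Z(1)] by simp
qed

lemma martingale_law_of_large_numbers:
  fixes Z :: "nat \<Rightarrow> 'w \<Rightarrow> real"
  assumes Z: "\<And>i j. i < j \<Longrightarrow> Z i \<in> borel_measurable (past j)" "\<And>i \<omega>. \<bar>Z i \<omega>\<bar> \<le> C"
    and zero: "\<And>i F. F \<in> sets (past i) \<Longrightarrow> (LINT \<omega>:F|P. Z i \<omega>) = 0"
  shows "AE \<omega> in P. (\<lambda>n. (\<Sum>i<n. Z i \<omega>) / real n) \<longlonglongrightarrow> 0"
proof (rule bounded_orthogonal_law_of_large_numbers)
  show meas: "Z i \<in> borel_measurable P" for i
    by (rule measurable_from_subalg[OF subalgebra_past Z(1)[OF lessI]])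
  show "expectation (\<lambda>\<omega>. Z i \<omega> * Z j \<omega>) = 0" if "i < j" for i j
    by (rule expectation_past_times_centered[OF meas Z(2) zero Z(1)[OF that] Z(2)])
qed (rule Z(2))

section \<open>Occupation frequencies and reactions per jump\<close>

definition occupation :: "'w \<Rightarrow> nat \<Rightarrow> 'v \<Rightarrow> real" where
  "occupation \<omega> n x = (\<Sum>i<n. of_bool (X i \<omega> = x)) / real n"

lemma sum_occupation: "(\<Sum>x\<in>UNIV. occupation \<omega> n x * e x) = (\<Sum>i<n. e (X i \<omega>)) / real n"
proof -
  have "(\<Sum>x\<in>UNIV. occupation \<omega> n x * e x) = (\<Sum>i<n. \<Sum>x\<in>UNIV. of_bool (X i \<omega> = x) * e x) / real n"
    by (subst sum.swap) (simp add: occupation_def sum_divide_distrib sum_distrib_right)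
  also have "\<dots> = (\<Sum>i<n. \<Sum>x\<in>UNIV. if x = X i \<omega> then e x else 0) / real n"
    by (intro arg_cong2[where f="(/)"] sum.cong refl) auto
  finally show ?thesis
    by simp
qed

text \<open>The indicator of the next node minus its transition probability is a martingale
  difference. Its average is the defect from invariance, up to the boundary terms of an index shift,
  which are at most 1 / n.\<close>

lemma occupation_tendsto: "AE \<omega> in P. \<forall>x. (\<lambda>n. occupation \<omega> n x) \<longlonglongrightarrow> pmf m x"
proof -
  have p_le: "p x y \<le> 1" for x y
    using member_le_sum[of y UNIV "p x"] by (simp add: p_nonneg sum_p)
  have "AE \<omega> in P. (\<lambda>n. (\<Sum>i<n. of_bool (X (Suc i) \<omega> = y) - p (X i \<omega>) y) / real n) \<longlonglongrightarrow> 0" for y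
  proof (rule martingale_law_of_large_numbers)
    fix i j :: nat assume "i < j"
    then have [measurable]: "X i \<in> measurable (past j) (count_space UNIV)"
        "X (Suc i) \<in> measurable (past j) (count_space UNIV)"
      by (auto intro: X_past)
    show "(\<lambda>\<omega>. of_bool (X (Suc i) \<omega> = y) - p (X i \<omega>) y) \<in> borel_measurable (past j)"
      by measurable
  next
    fix i \<omega> show "\<bar>of_bool (X (Suc i) \<omega> = y) - p (X i \<omega>) y\<bar> \<le> 1"
      using p_le[of "X i \<omega>" y] p_nonneg[of "X i \<omega>" y] by (auto simp: of_bool_def)
  next
    fix i F assume F: "F \<in> sets (past i)"
    have int: "set_integrable P F (\<lambda>\<omega>. of_bool (X (Suc i) \<omega> = y) :: real)"
      "set_integrable P F (\<lambda>\<omega>. p (X i \<omega>) y)"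
      unfolding set_integrable_def using past_events[OF F]
      by (auto intro!: integrable_const_bound[of _ 1] simp: p_nonneg p_le split: split_indicator)
    have "(\<Sum>z\<in>UNIV. p x z * of_bool (z = y)) = (\<Sum>z\<in>UNIV. if z = y then p x z else 0)" for x
      by (intro sum.cong) auto
    then show "(LINT \<omega>:F|P. of_bool (X (Suc i) \<omega> = y) - p (X i \<omega>) y) = 0"
      using set_integral_next_position[OF F, of "\<lambda>z. of_bool (z = y)"]
        set_integral_position[OF F, of "\<lambda>x. p x y"]
      by (simp add: set_integral_diff(2)[OF int])
  qed
  then have "AE \<omega> in P. \<forall>y\<in>UNIV. (\<lambda>n. (\<Sum>i<n. of_bool (X (Suc i) \<omega> = y) - p (X i \<omega>) y) / real n) \<longlonglongrightarrow> 0"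
    by (intro AE_finite_allI) auto
  then show ?thesis
  proof eventually_elim
    case (elim \<omega>)
    show ?case
    proof
      fix x show "(\<lambda>n. occupation \<omega> n x) \<longlonglongrightarrow> pmf m x"
      proof (rule empirical_measure_tendsto_invariant)
        show "m' = m" if "invariant_dist p m'" for m'
          using that invariant_iff by simp
        show "0 \<le> occupation \<omega> n x" for n x
          by (simp add: occupation_def sum_nonneg)
        show "(\<Sum>x\<in>UNIV. occupation \<omega> n x) = 1" if "n > 0" for n
          using sum_occupation[of \<omega> n "\<lambda>_. 1"] that by simp
        fix y
        have "occupation \<omega> n y - (\<Sum>x\<in>UNIV. occupation \<omega> n x * p x y)
            = (\<Sum>i<n. of_bool (X (Suc i) \<omega> = y) - p (X i \<omega>) y) / real n
              + (of_bool (X 0 \<omega> = y) - of_bool (X n \<omega> = y)) / real n" for n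
        proof -
          have "(\<Sum>i<n. of_bool (X i \<omega> = y) :: real) + of_bool (X n \<omega> = y)
              = of_bool (X 0 \<omega> = y) + (\<Sum>i<n. of_bool (X (Suc i) \<omega> = y))"
            by (induction n) auto
          then show ?thesis
            unfolding sum_occupation by (simp add: occupation_def sum_subtractf diff_divide_distrib[symmetric]
                add_divide_distrib[symmetric])
        qed
        moreover have "(\<lambda>n. (\<Sum>i<n. of_bool (X (Suc i) \<omega> = y) - p (X i \<omega>) y) / real n) \<longlonglongrightarrow> 0"
          using elim by blast
        moreover have "(\<lambda>n. (of_bool (X 0 \<omega> = y) - of_bool (X n \<omega> = y)) / real n) \<longlonglongrightarrow> 0"
          by (rule Lim_null_comparison[OF _ lim_inverse_n])
            (auto intro!: always_eventually simp: divide_inverse of_bool_def)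
        ultimately show "(\<lambda>n. occupation \<omega> n y - (\<Sum>x\<in>UNIV. occupation \<omega> n x * p x y)) \<longlonglongrightarrow> 0"
          by (simp only: tendsto_add_zero)
      qed
    qed
  qed
qed

text \<open>One null set serves all \<open>e\<close> at once, since a function on finitely many
  nodes is a combination of indicators.\<close>

lemma ergodic_averages:
  "AE \<omega> in P. \<forall>e. (\<lambda>n. (\<Sum>i<n. e (X i \<omega>)) / real n) \<longlonglongrightarrow> (\<Sum>x\<in>UNIV. pmf m x * e x)"
  using occupation_tendsto
proof eventually_elim
  case (elim \<omega>)
  then show ?case
    unfolding sum_occupation[symmetric] by (auto intro!: tendsto_intros)
qed

text \<open>While \<open>reactive\<close> holds, \<open>q (X n)\<close> is a martingale stopped and restarted at the visits of \<open>A\<close>: its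
  restarts at \<open>A\<close> and its final value \<open>1\<close> at \<open>B\<close> balance.\<close>

lemma reaction_count_average_tendsto:
  assumes AB: "A \<inter> B = {}"
  defines "q \<equiv> committor p A B"
  shows "AE \<omega> in P. (\<lambda>N. real (reaction_count A B (\<lambda>i. X i \<omega>) N) / real N)
    \<longlonglongrightarrow> (\<Sum>x\<in>A. \<Sum>y\<in>UNIV. pmf m x * p x y * q y)"
proof -
  note q_A = committor_in_A[where p=p, OF p_nonneg sum_p AB, folded q_def]
  note q_B = committor_in_B[where p=p, OF p_nonneg sum_p AB, folded q_def]
  note q_harmonic = committor_harmonic[where p=p, OF p_nonneg sum_p AB, folded q_def]
  have q_bounds: "0 \<le> q x" "q x \<le> 1" for x
    unfolding q_def by (rule committor_bounds[OF p_nonneg sum_p])+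
  define Pq where "Pq x = (\<Sum>y\<in>UNIV. p x y * q y)" for x
  have Pq_bounds: "0 \<le> Pq x" "Pq x \<le> 1" for x
  proof -
    show "0 \<le> Pq x"
      unfolding Pq_def by (intro sum_nonneg mult_nonneg_nonneg p_nonneg q_bounds)
    have "Pq x \<le> (\<Sum>y\<in>UNIV. p x y * 1)"
      unfolding Pq_def by (intro sum_mono mult_left_mono p_nonneg q_bounds)
    then show "Pq x \<le> 1"
      by (simp add: sum_p)
  qed
  define s where "s i \<omega> = (of_bool (reactive A B (\<lambda>j. X j \<omega>) i) :: real)" for i \<omega>
  have "AE \<omega> in P. (\<lambda>n. (\<Sum>i<n. s i \<omega> * (q (X (Suc i) \<omega>) - Pq (X i \<omega>))) / real n) \<longlonglongrightarrow> 0"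
  proof (rule martingale_law_of_large_numbers)
    fix i j :: nat assume ij: "i < j"
    then have [measurable]: "X i \<in> measurable (past j) (count_space UNIV)"
        "X (Suc i) \<in> measurable (past j) (count_space UNIV)"
      by (auto intro: X_past)
    have [measurable]: "Measurable.pred (past j) (\<lambda>\<omega>. reactive A B (\<lambda>l. X l \<omega>) i)"
      using ij by (intro reactive_past) simp
    have [measurable]: "s i \<in> borel_measurable (past j)"
      unfolding s_def by measurable
    show "(\<lambda>\<omega>. s i \<omega> * (q (X (Suc i) \<omega>) - Pq (X i \<omega>))) \<in> borel_measurable (past j)"
      by measurable
  next
    fix i \<omega>
    show "\<bar>s i \<omega> * (q (X (Suc i) \<omega>) - Pq (X i \<omega>))\<bar> \<le> 1"
      using q_bounds[of "X (Suc i) \<omega>"] Pq_bounds[of "X i \<omega>"] by (auto simp: s_def of_bool_def)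
  next
    fix i F assume F: "F \<in> sets (past i)"
    \<comment> \<open>The factor \<open>s i\<close> is the indicator of a past event and is absorbed
      into the domain of integration.\<close>
    let ?F = "F \<inter> {\<omega> \<in> space P. reactive A B (\<lambda>j. X j \<omega>) i}"
    have F': "?F \<in> sets (past i)"
      using sets.Int[OF F reactive_past[of i i A B, unfolded pred_def]] by simp
    have int: "set_integrable P ?F (\<lambda>\<omega>. q (X (Suc i) \<omega>))" "set_integrable P ?F (\<lambda>\<omega>. Pq (X i \<omega>))"
      unfolding set_integrable_def using past_events[OF F']
      by (auto intro!: integrable_const_bound[of _ 1] simp: q_bounds Pq_bounds split: split_indicator)
    have "(LINT \<omega>:F|P. s i \<omega> * (q (X (Suc i) \<omega>) - Pq (X i \<omega>)))
        = (LINT \<omega>:?F|P. q (X (Suc i) \<omega>) - Pq (X i \<omega>))"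
      unfolding set_lebesgue_integral_def s_def
      by (intro Bochner_Integration.integral_cong) (auto split: split_indicator)
    also have "\<dots> = 0"
      unfolding set_integral_diff(2)[OF int] set_integral_next_position[OF F', of q]
        set_integral_position[OF F', of Pq]
      by (simp add: Pq_def)
    finally show "(LINT \<omega>:F|P. s i \<omega> * (q (X (Suc i) \<omega>) - Pq (X i \<omega>))) = 0" .
  qed
  with ergodic_averages show ?thesis
  proof eventually_elim
    case (elim \<omega>)
    let ?M = "\<lambda>N. real (reaction_count A B (\<lambda>i. X i \<omega>) N)"
    let ?Z = "\<lambda>N. \<Sum>i<N. s i \<omega> * (q (X (Suc i) \<omega>) - Pq (X i \<omega>))"
    let ?e = "\<lambda>x. of_bool (x \<in> A) * Pq x"
    \<comment> \<open>While reactive, \<open>Pq\<close> differs from \<open>q\<close> only on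
      \<open>A\<close>, where \<open>q\<close> is 0; this gives the term \<open>?e\<close>. Arriving
      in \<open>B\<close> resets \<open>s\<close> to 0 and loses the value 1 of \<open>q\<close>,
      which the indicator restores. A start of a reactive phase costs nothing, as it happens in
      \<open>A\<close>.\<close>
    have step: "s i \<omega> * (q (X (Suc i) \<omega>) - Pq (X i \<omega>))
        = s (Suc i) \<omega> * q (X (Suc i) \<omega>) - s i \<omega> * q (X i \<omega>)
          + of_bool (reactive A B (\<lambda>j. X j \<omega>) i \<and> X (Suc i) \<omega> \<in> B) - ?e (X i \<omega>)" for i
    proof (cases "reactive A B (\<lambda>j. X j \<omega>) i")
      case True
      then have nB: "X i \<omega> \<notin> B"
        by (rule reactive_notin[OF AB])
      have "Pq (X i \<omega>) = q (X i \<omega>) + ?e (X i \<omega>)"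
        using nB q_A q_harmonic[of "X i \<omega>"] by (auto simp: Pq_def)
      then show ?thesis
        using True AB q_A q_B by (auto simp: s_def of_bool_def)
    next
      case False
      then have "X i \<omega> \<notin> A"
        using in_A_imp_reactive[of "\<lambda>j. X j \<omega>"] by blast
      then show ?thesis
        using False q_A by (auto simp: s_def of_bool_def)
    qed
    have telescope: "(\<Sum>i<N. s (Suc i) \<omega> * q (X (Suc i) \<omega>)) - (\<Sum>i<N. s i \<omega> * q (X i \<omega>))
        = s N \<omega> * q (X N \<omega>) - s 0 \<omega> * q (X 0 \<omega>)" for N
      by (induction N) auto
    have Z: "?Z N = s N \<omega> * q (X N \<omega>) - s 0 \<omega> * q (X 0 \<omega>) + ?M N - (\<Sum>i<N. ?e (X i \<omega>))" for N
      unfolding step reaction_count_eq[OF AB] of_nat_sum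
      by (simp add: sum.distrib sum_subtractf telescope)
    have "?M N / real N = ?Z N / real N + (\<Sum>i<N. ?e (X i \<omega>)) / real N
        + (s 0 \<omega> * q (X 0 \<omega>) - s N \<omega> * q (X N \<omega>)) / real N" for N
      unfolding Z by (simp add: add_divide_distrib[symmetric])
    moreover have "(\<lambda>N. (s 0 \<omega> * q (X 0 \<omega>) - s N \<omega> * q (X N \<omega>)) / real N) \<longlonglongrightarrow> 0"
    proof (rule Lim_null_comparison[OF _ lim_inverse_n])
      have "\<bar>s 0 \<omega> * q (X 0 \<omega>) - s N \<omega> * q (X N \<omega>)\<bar> \<le> 1" for N
        using q_bounds[of "X 0 \<omega>"] q_bounds[of "X N \<omega>"] by (auto simp: s_def of_bool_def)
      then show "\<forall>\<^sub>F N in sequentially. norm ((s 0 \<omega> * q (X 0 \<omega>) - s N \<omega> * q (X N \<omega>)) / real N) \<le> inverse (real N)"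
        by (auto intro!: always_eventually mult_left_le_one_le simp: divide_inverse abs_mult)
    qed
    moreover have "(\<lambda>N. (\<Sum>i<N. ?e (X i \<omega>)) / real N) \<longlonglongrightarrow> (\<Sum>x\<in>UNIV. pmf m x * ?e x)"
      using elim(1) by (rule allE[of _ ?e])
    ultimately have "(\<lambda>N. ?M N / real N) \<longlonglongrightarrow> 0 + (\<Sum>x\<in>UNIV. pmf m x * ?e x) + 0"
      using elim(2) by (simp only:) (intro tendsto_add)
    moreover have "(\<Sum>x\<in>UNIV. pmf m x * ?e x) = (\<Sum>x\<in>A. \<Sum>y\<in>UNIV. pmf m x * p x y * q y)"
    proof -
      have "(\<Sum>x\<in>UNIV. pmf m x * ?e x) = (\<Sum>x\<in>A. pmf m x * ?e x)"
        by (intro sum.mono_neutral_right) auto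
      then show ?thesis
        by (simp add: Pq_def sum_distrib_left mult.assoc)
    qed
    ultimately show ?case
      by simp
  qed
qed

end

section \<open>Dyadic truncation\<close>

lemma sum_dyadic_truncated_squares:
  fixes u :: real
  assumes "0 \<le> u"
  shows "(\<Sum>n<N. (min u (2 ^ n))\<^sup>2 / 2 ^ n) \<le> 4 * u"
proof -
  \<comment> \<open>Below \<open>u\<close> the terms are 2^n, a geometric sum. Above
    \<open>u\<close> they are u^2 / 2^n, and the subtracted quantity is exactly the tail of this
    series from \<open>N\<close> on, so the total stays within \<open>4 * u\<close>.\<close>
  have "(\<Sum>n<N. (min u (2 ^ n))\<^sup>2 / 2 ^ n) \<le> (if 2 ^ N \<le> u then 2 ^ N else 4 * u - 2 * u\<^sup>2 / 2 ^ N)"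
  proof (induction N)
    case 0
    have "2 * u\<^sup>2 \<le> 4 * u" if "u < 1"
      using mult_left_mono[of u 1 u] that assms by (simp add: power2_eq_square)
    then show ?case
      by auto
  next
    case (Suc N)
    define a :: real where "a = 2 ^ N"
    have a: "0 < a" "2 ^ Suc N = 2 * a"
      by (auto simp: a_def)
    let ?S = "\<Sum>n<N. (min u (2 ^ n))\<^sup>2 / 2 ^ n"
    have IH: "?S \<le> (if a \<le> u then a else 4 * u - 2 * u\<^sup>2 / a)"
      unfolding a_def by (rule Suc.IH)
    have sum: "(\<Sum>n<Suc N. (min u (2 ^ n))\<^sup>2 / 2 ^ n) = ?S + (min u a)\<^sup>2 / a"
      by (simp add: a_def)
    consider "2 * a \<le> u" | "a \<le> u" "u < 2 * a" | "u < a"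
      by linarith
    then show ?case
    proof cases
      case 1
      then have "min u a = a" "a \<le> u"
        using a by auto
      then show ?thesis
        using IH 1 a unfolding sum by (simp add: power2_eq_square)
    next
      case 2
      have "u\<^sup>2 / a \<le> 2 * u"
        using mult_left_mono[of u "2 * a" u] 2 a assms by (simp add: power2_eq_square field_simps)
      then have "2 * a \<le> 4 * u - 2 * u\<^sup>2 / (2 * a)"
        using 2 by simp
      moreover have "(min u a)\<^sup>2 / a = a"
        using 2 a by (simp add: power2_eq_square min_def)
      ultimately show ?thesis
        using IH 2 unfolding sum a(2) by simp
    next
      case 3
      then have "(min u a)\<^sup>2 / a = u\<^sup>2 / a"
        by simp
      then show ?thesis
        using IH 3 a(1) assms unfolding sum a(2) by simp
    qed
  qed
  also have "\<dots> \<le> 4 * u"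
    using assms by auto
  finally show ?thesis .
qed

lemma suminf_dyadic_truncated_squares:
  assumes "0 \<le> u"
  shows "(\<Sum>n. ennreal ((min u (2 ^ n))\<^sup>2 / 2 ^ n)) \<le> ennreal (4 * u)"
proof (rule suminf_le_const[OF summableI])
  show "(\<Sum>n<N. ennreal ((min u (2 ^ n))\<^sup>2 / 2 ^ n)) \<le> ennreal (4 * u)" for N
    using sum_dyadic_truncated_squares[OF assms, of N] by (simp add: sum_ennreal ennreal_leI)
qed

section \<open>Averages of bounded sojourn functions and of excesses\<close>

context ergodic_jump_process
begin

definition mean :: "(real \<Rightarrow> real) \<Rightarrow> 'v \<Rightarrow> real" where
  "mean h x = (LINT t|sojourn_law E \<psi> x. h t)"

lemma mean_nonneg: "(\<And>t. 0 \<le> h t) \<Longrightarrow> 0 \<le> mean h x"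
  unfolding mean_def by (rule integral_nonneg_AE) simp

context
  fixes h :: "real \<Rightarrow> real" and C :: real
  assumes h [measurable]: "h \<in> borel_measurable borel" and h_bounds: "\<And>t. 0 \<le> h t" "\<And>t. h t \<le> C"
begin

lemma integrable_bounded_sojourn_law: "integrable (sojourn_law E \<psi> x) h"
proof -
  interpret S: prob_space "sojourn_law E \<psi> x"
    by (rule prob_space_sojourn_law[OF graph])
  show ?thesis
    by (rule S.integrable_const_bound[of _ C]) (auto simp: h_bounds)
qed

lemma mean_bounds: "0 \<le> mean h x" "mean h x \<le> C"
proof -
  interpret S: prob_space "sojourn_law E \<psi> x"
    by (rule prob_space_sojourn_law[OF graph])
  show "0 \<le> mean h x"
    by (rule mean_nonneg) (rule h_bounds)
  have "mean h x \<le> (LINT t|sojourn_law E \<psi> x. C)"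
    unfolding mean_def by (intro integral_mono integrable_bounded_sojourn_law) (auto simp: h_bounds)
  then show "mean h x \<le> C"
    using S.prob_space by simp
qed

text \<open>The position probabilities are estimated by 1, which gives a bound uniform in
  \<open>i\<close>.\<close>

lemma expectation_sojourn_le: "expectation (\<lambda>\<omega>. h (sojourn i \<omega>)) \<le> (\<Sum>x\<in>UNIV. mean h x)"
proof -
  have S: "space P \<in> sets (past i)"
    by (metis sets.top space_past)
  have "integrable P (\<lambda>\<omega>. h (sojourn i \<omega>))"
    by (rule integrable_const_bound[of _ C]) (auto simp: h_bounds)
  then have "expectation (\<lambda>\<omega>. h (sojourn i \<omega>)) = (LINT \<omega>:space P|P. h (sojourn i \<omega>))"
    by (rule set_integral_space[symmetric])
  also have "\<dots> = (\<Sum>x\<in>UNIV. prob (space P \<inter> {\<omega> \<in> space P. X i \<omega> = x}) * mean h x)"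
    unfolding mean_def by (rule set_integral_sojourn[OF S h h_bounds])
  also have "\<dots> \<le> (\<Sum>x\<in>UNIV. mean h x)"
    by (intro sum_mono mult_left_le_one_le) (auto simp: mean_bounds)
  finally show ?thesis .
qed

lemma centered_sojourn_bound: "\<bar>h (sojourn i \<omega>) - mean h (X i \<omega>)\<bar> \<le> C"
  using h_bounds[of "sojourn i \<omega>"] mean_bounds[of "X i \<omega>"] by linarith

lemma centered_sojourn_past:
  assumes "i < j"
  shows "(\<lambda>\<omega>. h (sojourn i \<omega>) - mean h (X i \<omega>)) \<in> borel_measurable (past j)"
proof -
  have [measurable]: "X i \<in> measurable (past j) (count_space UNIV)" "sojourn i \<in> borel_measurable (past j)"
    using assms by (auto intro: X_past sojourn_past)
  show ?thesis
    by measurable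
qed

lemma set_integral_centered_sojourn:
  assumes F: "F \<in> sets (past i)"
  shows "(LINT \<omega>:F|P. h (sojourn i \<omega>) - mean h (X i \<omega>)) = 0"
proof -
  have int: "set_integrable P F (\<lambda>\<omega>. h (sojourn i \<omega>))" "set_integrable P F (\<lambda>\<omega>. mean h (X i \<omega>))"
    unfolding set_integrable_def using past_events[OF F] order_trans[OF mean_bounds]
    by (auto intro!: integrable_const_bound[of _ C] simp: h_bounds mean_bounds split: split_indicator)
  show ?thesis
    unfolding set_integral_diff(2)[OF int] set_integral_sojourn[OF F h h_bounds, folded mean_def]
      set_integral_position[OF F, of "mean h"] by simp
qed

text \<open>Pythagoras: \<open>mean h (X i \<omega>)\<close> is the conditional expectation given
  the past, hence orthogonal to the centred part.\<close>

lemma expectation_centered_sojourn_square: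
  "expectation (\<lambda>\<omega>. (h (sojourn i \<omega>) - mean h (X i \<omega>))\<^sup>2) \<le> expectation (\<lambda>\<omega>. (h (sojourn i \<omega>))\<^sup>2)"
proof -
  let ?Z = "\<lambda>\<omega>. h (sojourn i \<omega>) - mean h (X i \<omega>)" and ?e = "\<lambda>\<omega>. mean h (X i \<omega>)"
  have zero: "expectation (\<lambda>\<omega>. ?e \<omega> * ?Z \<omega>) = 0"
  proof (rule expectation_past_times_centered[where i=i])
    show "?e \<in> borel_measurable (past i)"
      by (rule measurable_compose[OF X_past[OF order_refl]]) simp
    show "\<bar>?e \<omega>\<bar> \<le> C" for \<omega>
      by (simp add: mean_bounds)
  qed (auto intro: centered_sojourn_bound set_integral_centered_sojourn)
  have "integrable P (\<lambda>\<omega>. f \<omega> * g \<omega>)"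
    if "f \<in> borel_measurable P" "g \<in> borel_measurable P" "\<And>\<omega>. \<bar>f \<omega>\<bar> \<le> C" "\<And>\<omega>. \<bar>g \<omega>\<bar> \<le> C"
    for f g :: "'w \<Rightarrow> real"
  proof (rule integrable_const_bound[of _ "C * C"])
    have "\<bar>f \<omega>\<bar> * \<bar>g \<omega>\<bar> \<le> C * C" for \<omega>
      by (intro mult_mono that order_trans[OF mean_bounds]) simp
    then show "AE \<omega> in P. norm (f \<omega> * g \<omega>) \<le> C * C"
      by (simp add: abs_mult)
  qed (use that in measurable)
  then have int: "integrable P (\<lambda>\<omega>. ?Z \<omega> * ?Z \<omega>)" "integrable P (\<lambda>\<omega>. ?e \<omega> * ?Z \<omega>)"
      "integrable P (\<lambda>\<omega>. ?e \<omega> * ?e \<omega>)"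
    using centered_sojourn_bound by (simp_all add: mean_bounds)
  have "(h (sojourn i \<omega>))\<^sup>2 = ?Z \<omega> * ?Z \<omega> + 2 * (?e \<omega> * ?Z \<omega>) + ?e \<omega> * ?e \<omega>" for \<omega>
    by (simp add: power2_eq_square algebra_simps)
  then have "expectation (\<lambda>\<omega>. (h (sojourn i \<omega>))\<^sup>2)
      = expectation (\<lambda>\<omega>. ?Z \<omega> * ?Z \<omega>) + 2 * expectation (\<lambda>\<omega>. ?e \<omega> * ?Z \<omega>) + expectation (\<lambda>\<omega>. ?e \<omega> * ?e \<omega>)"
    using int by simp
  moreover have "0 \<le> expectation (\<lambda>\<omega>. ?e \<omega> * ?e \<omega>)"
    by simp
  ultimately show ?thesis
    using zero by (simp add: power2_eq_square)
qed

lemma bounded_sojourn_averages: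
  "AE \<omega> in P. (\<lambda>n. (\<Sum>i<n. h (sojourn i \<omega>)) / real n) \<longlonglongrightarrow> (\<Sum>x\<in>UNIV. pmf m x * mean h x)"
proof -
  have "AE \<omega> in P. (\<lambda>n. (\<Sum>i<n. h (sojourn i \<omega>) - mean h (X i \<omega>)) / real n) \<longlonglongrightarrow> 0"
    by (rule martingale_law_of_large_numbers)
      (auto intro: centered_sojourn_past centered_sojourn_bound set_integral_centered_sojourn)
  with ergodic_averages show ?thesis
  proof eventually_elim
    case (elim \<omega>)
    have "(\<lambda>n. (\<Sum>i<n. h (sojourn i \<omega>) - mean h (X i \<omega>)) / real n + (\<Sum>i<n. mean h (X i \<omega>)) / real n)
        \<longlonglongrightarrow> 0 + (\<Sum>x\<in>UNIV. pmf m x * mean h x)"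
      by (intro tendsto_add elim(2)) (rule allE[OF elim(1), of "mean h"])
    then show ?case
      by (simp add: sum_subtractf add_divide_distrib[symmetric])
  qed
qed

end

text \<open>Tests the sojourn times with the indicator of \<open>{..0}\<close>, whose mean vanishes
  at every node because clocks with densities are almost surely positive.\<close>

lemma sojourn_pos: "AE \<omega> in P. \<forall>i. 0 < sojourn i \<omega>"
proof -
  have "AE \<omega> in P. 0 < sojourn i \<omega>" for i
  proof -
    let ?h = "indicator {..0} :: real \<Rightarrow> real"
    have "mean ?h x = 0" for x
    proof -
      have "mean ?h x = (LINT t|sojourn_law E \<psi> x. 0)"
        unfolding mean_def using AE_sojourn_law_pos[OF graph edges_nonempty]
        by (intro integral_cong_AE) (auto elim!: eventually_mono simp: not_le split: split_indicator)
      then show ?thesis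
        by simp
    qed
    then have "expectation (\<lambda>\<omega>. ?h (sojourn i \<omega>)) \<le> 0"
      using expectation_sojourn_le[of ?h 1 i] by simp
    then have "expectation (\<lambda>\<omega>. ?h (sojourn i \<omega>)) = 0"
      by (intro antisym integral_nonneg_AE) auto
    then have "AE \<omega> in P. ?h (sojourn i \<omega>) = 0"
      by (subst (asm) integral_nonneg_eq_0_iff_AE) (auto intro!: integrable_const_bound[of _ 1])
    then show ?thesis
      by eventually_elim (auto split: split_indicator_asm)
  qed
  then show ?thesis
    by (simp add: AE_all_countable)
qed

text \<open>The excess of the sojourn times over \<open>c\<close> has small averages.  Truncating the first \<open>2 ^ n\<close> of
  them at level \<open>2 ^ n\<close> makes second moments summable over \<open>n\<close>; since the excesses are nonnegative,
  passing from dyadic to arbitrary times costs at most a factor \<open>2\<close>.\<close>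

lemma sojourn_excess_averages:
  assumes fin: "\<And>x. mean_stay E \<psi> x < \<infinity>" and c: "0 \<le> c"
  defines "u \<equiv> \<lambda>t. max 0 (t - c)"
  shows "AE \<omega> in P. \<forall>\<delta>>0. \<forall>\<^sub>F N in sequentially.
    (\<Sum>i<N. u (sojourn i \<omega>)) \<le> 2 * ((\<Sum>x\<in>UNIV. mean u x) + \<delta>) * real N"
proof -
  have u[measurable]: "u \<in> borel_measurable borel" and u0: "0 \<le> u t" for t
    unfolding u_def by auto
  define v where "v n t = min (u t) (2 ^ n)" for n t
  have v[measurable]: "v n \<in> borel_measurable borel" for n
    unfolding v_def by measurable
  have v_bounds: "0 \<le> v n t" "v n t \<le> 2 ^ n" "v n t \<le> u t" for n t
    by (auto simp: v_def u0)
  have u_fin: "(\<integral>\<^sup>+t. ennreal (u t) \<partial>sojourn_law E \<psi> x) < \<infinity>" for x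
  proof -
    have "(\<integral>\<^sup>+t. ennreal (u t) \<partial>sojourn_law E \<psi> x) \<le> (\<integral>\<^sup>+t. ennreal t \<partial>sojourn_law E \<psi> x)"
    proof (rule nn_integral_mono)
      show "ennreal (u t) \<le> ennreal t" for t
        using c by (cases "0 \<le> t - c") (auto simp: u_def intro!: ennreal_leI)
    qed
    also have "\<dots> < \<infinity>"
      using fin[of x] by (simp add: nn_integral_sojourn_law[OF graph edges_nonempty])
    finally show ?thesis .
  qed
  have u_int: "integrable (sojourn_law E \<psi> x) u" for x
    using u_fin[of x] u0 by (intro integrableI_bounded) auto
  define g where "g n t = (v n t)\<^sup>2 / 2 ^ n" for n t
  have g[measurable]: "g n \<in> borel_measurable borel" and g0: "0 \<le> g n t" for n t
    unfolding g_def by auto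
  have g_bound: "g n t \<le> 2 ^ n" for n t
  proof -
    have "(v n t)\<^sup>2 \<le> (2 ^ n)\<^sup>2"
      by (intro power_mono v_bounds)
    then show ?thesis
      by (simp add: g_def power2_eq_square field_simps)
  qed
  \<comment> \<open>This one summable sequence dominates both the second moment of the dyadic
    average \<open>S n\<close> and the expected number \<open>R n\<close> of excesses above the
    truncation level.\<close>
  define \<gamma> where "\<gamma> n = (\<Sum>x\<in>UNIV. mean (g n) x)" for n
  have \<gamma>0: "0 \<le> \<gamma> n" for n
    unfolding \<gamma>_def by (intro sum_nonneg mean_nonneg g0)
  have \<gamma>_sum: "(\<Sum>n. ennreal (2 * \<gamma> n)) < \<infinity>"
  proof -
    have "ennreal (\<gamma> n) = (\<Sum>x\<in>UNIV. \<integral>\<^sup>+t. ennreal (g n t) \<partial>sojourn_law E \<psi> x)" for n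
      unfolding \<gamma>_def
      by (subst sum_ennreal[symmetric])
        (auto simp: mean_def nn_integral_eq_integral[OF integrable_bounded_sojourn_law[OF g g0 g_bound]] g0
          intro!: mean_nonneg[unfolded mean_def])
    then have "(\<Sum>n. ennreal (\<gamma> n)) = (\<Sum>x\<in>UNIV. \<Sum>n. \<integral>\<^sup>+t. ennreal (g n t) \<partial>sojourn_law E \<psi> x)"
      by (simp add: suminf_sum)
    also have "\<dots> = (\<Sum>x\<in>UNIV. \<integral>\<^sup>+t. (\<Sum>n. ennreal (g n t)) \<partial>sojourn_law E \<psi> x)"
      by (intro sum.cong refl nn_integral_suminf[symmetric]) measurable
    also have "\<dots> \<le> (\<Sum>x\<in>UNIV. \<integral>\<^sup>+t. ennreal 4 * ennreal (u t) \<partial>sojourn_law E \<psi> x)"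
    proof (intro sum_mono nn_integral_mono)
      show "(\<Sum>n. ennreal (g n t)) \<le> ennreal 4 * ennreal (u t)" for t
        using suminf_dyadic_truncated_squares[OF u0, of t]
        by (simp add: g_def v_def ennreal_mult[symmetric] u0 del: ennreal_numeral)
    qed
    also have "\<dots> = (\<Sum>x\<in>UNIV. ennreal 4 * (\<integral>\<^sup>+t. ennreal (u t) \<partial>sojourn_law E \<psi> x))"
      by (intro sum.cong refl nn_integral_cmult) measurable
    also have "\<dots> < \<infinity>"
      using u_fin by (auto simp: ennreal_mult_less_top)
    finally have "ennreal 2 * (\<Sum>n. ennreal (\<gamma> n)) < \<infinity>"
      by (simp add: ennreal_mult_less_top)
    moreover have "(\<Sum>n. ennreal (2 * \<gamma> n)) = ennreal 2 * (\<Sum>n. ennreal (\<gamma> n))"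
      by (simp add: ennreal_mult \<gamma>0)
    ultimately show ?thesis
      by simp
  qed
  define Z where "Z n i \<omega> = v n (sojourn i \<omega>) - mean (v n) (X i \<omega>)" for n i \<omega>
  have Z[measurable]: "Z n i \<in> borel_measurable P" for n i
    unfolding Z_def by measurable
  define S where "S n \<omega> = (\<Sum>i<2 ^ n. Z n i \<omega>) / 2 ^ n" for n :: nat and \<omega>
  define R where "R n \<omega> = (\<Sum>i<2 ^ n. of_bool (2 ^ n < u (sojourn i \<omega>)) :: real)" for n :: nat and \<omega>
  have [measurable]: "S n \<in> borel_measurable P" "R n \<in> borel_measurable P" for n
    unfolding S_def R_def by measurable
  have Z_bound: "\<bar>Z n i \<omega>\<bar> \<le> 2 ^ n" for n i \<omega>
    unfolding Z_def by (rule centered_sojourn_bound[OF v v_bounds(1,2)])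
  have v2: "expectation (\<lambda>\<omega>. (v n (sojourn i \<omega>))\<^sup>2) \<le> 2 ^ n * \<gamma> n" for n i
  proof -
    have "expectation (\<lambda>\<omega>. (v n (sojourn i \<omega>))\<^sup>2) = 2 ^ n * expectation (\<lambda>\<omega>. g n (sojourn i \<omega>))"
      by (simp add: g_def)
    also have "\<dots> \<le> 2 ^ n * \<gamma> n"
      unfolding \<gamma>_def by (intro mult_left_mono expectation_sojourn_le[OF g g0 g_bound]) simp
    finally show ?thesis .
  qed
  have S2: "expectation (\<lambda>\<omega>. (S n \<omega>)\<^sup>2) \<le> \<gamma> n" for n
  proof -
    have orth: "expectation (\<lambda>\<omega>. Z n i \<omega> * Z n j \<omega>) = 0" if "i < j" for i j
      unfolding Z_def using that
      by (intro expectation_past_times_centered[where i=j])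
        (auto intro!: centered_sojourn_bound centered_sojourn_past set_integral_centered_sojourn v_bounds)
    have "expectation (\<lambda>\<omega>. (\<Sum>i<2 ^ n. Z n i \<omega>)\<^sup>2) = (\<Sum>i<2 ^ n. expectation (\<lambda>\<omega>. (Z n i \<omega>)\<^sup>2))"
      by (rule expectation_sum_square_orthogonal[OF Z Z_bound orth])
    also have "\<dots> \<le> (\<Sum>i<(2::nat) ^ n. 2 ^ n * \<gamma> n)"
      unfolding Z_def
      by (intro sum_mono order_trans[OF expectation_centered_sojourn_square[OF v v_bounds(1,2)] v2])
    finally have "expectation (\<lambda>\<omega>. (\<Sum>i<2 ^ n. Z n i \<omega>)\<^sup>2) \<le> (2 ^ n)\<^sup>2 * \<gamma> n"
      by (simp add: power2_eq_square)
    then show ?thesis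
      by (simp add: S_def power_divide divide_le_eq mult.commute)
  qed
  have R1: "expectation (\<lambda>\<omega>. R n \<omega>) \<le> \<gamma> n" for n
  proof -
    \<comment> \<open>Above the level the truncated value is 2^n, so the right side is exactly
      1.\<close>
    have le: "of_bool (2 ^ n < u t) \<le> g n t / 2 ^ n" for t
      by (auto simp: g_def v_def power2_eq_square)
    have gi: "integrable P (\<lambda>\<omega>. g n (sojourn i \<omega>))" for i
      by (rule integrable_const_bound[of _ "2 ^ n"]) (auto simp: g0 g_bound)
    have bi: "integrable P (\<lambda>\<omega>. of_bool (2 ^ n < u (sojourn i \<omega>)) :: real)" for i
      by (rule integrable_const_bound[of _ 1]) auto
    have "expectation (\<lambda>\<omega>. R n \<omega>) = (\<Sum>i<2 ^ n. expectation (\<lambda>\<omega>. of_bool (2 ^ n < u (sojourn i \<omega>))))"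
      unfolding R_def by (rule Bochner_Integration.integral_sum) (rule bi)
    also have "\<dots> \<le> (\<Sum>i<(2::nat) ^ n. expectation (\<lambda>\<omega>. g n (sojourn i \<omega>) / 2 ^ n))"
      by (intro sum_mono integral_mono bi le integrable_divide gi)
    also have "\<dots> \<le> (\<Sum>i<(2::nat) ^ n. \<gamma> n / 2 ^ n)"
      unfolding \<gamma>_def using expectation_sojourn_le[OF g g0 g_bound]
      by (intro sum_mono) (simp add: divide_right_mono)
    finally show ?thesis
      by simp
  qed
  have "(\<integral>\<^sup>+\<omega>. ennreal ((S n \<omega>)\<^sup>2 + R n \<omega>) \<partial>P) \<le> ennreal (2 * \<gamma> n)" for n
  proof -
    have R_bound: "0 \<le> R n \<omega>" "R n \<omega> \<le> 2 ^ n" for \<omega>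
      using sum_mono[of "{..<2 ^ n}" "\<lambda>i. of_bool (2 ^ n < u (sojourn i \<omega>)) :: real" "\<lambda>_. 1"]
      by (auto simp: R_def sum_nonneg)
    have "\<bar>\<Sum>i<2 ^ n. Z n i \<omega>\<bar> \<le> (\<Sum>i<(2::nat) ^ n. 2 ^ n)" for \<omega>
      by (rule order_trans[OF sum_abs sum_mono]) (rule Z_bound)
    then have "\<bar>S n \<omega>\<bar> \<le> 2 ^ n" for \<omega>
      by (simp add: S_def abs_divide divide_le_eq)
    then have "(S n \<omega>)\<^sup>2 \<le> (2 ^ n)\<^sup>2" for \<omega>
      using abs_le_square_iff[of "S n \<omega>" "2 ^ n"] by simp
    then have int: "integrable P (\<lambda>\<omega>. (S n \<omega>)\<^sup>2)"
      by (intro integrable_const_bound[of _ "(2 ^ n)\<^sup>2"]) auto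
    have int': "integrable P (R n)"
      using R_bound by (intro integrable_const_bound[of _ "2 ^ n"]) auto
    have "(\<integral>\<^sup>+\<omega>. ennreal ((S n \<omega>)\<^sup>2 + R n \<omega>) \<partial>P) = ennreal (expectation (\<lambda>\<omega>. (S n \<omega>)\<^sup>2 + R n \<omega>))"
      using R_bound int int' by (intro nn_integral_eq_integral) auto
    also have "\<dots> \<le> ennreal (2 * \<gamma> n)"
      using S2[of n] R1[of n] int int' by (intro ennreal_leI) simp
    finally show ?thesis .
  qed
  then have "(\<Sum>n. \<integral>\<^sup>+\<omega>. ennreal ((S n \<omega>)\<^sup>2 + R n \<omega>) \<partial>P) < \<infinity>"
    by (rule le_less_trans[OF suminf_le[OF _ summableI summableI] \<gamma>_sum])
  then have "AE \<omega> in P. (\<lambda>n. (S n \<omega>)\<^sup>2 + R n \<omega>) \<longlonglongrightarrow> 0"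
    by (intro AE_tendsto_zero_if_suminf_expectation_finite) (auto simp: R_def sum_nonneg)
  then show ?thesis
  proof eventually_elim
    case (elim \<omega>)
    show ?case
    proof (intro allI impI)
      fix \<delta> :: real assume "\<delta> > 0"
      define \<epsilon> where "\<epsilon> = (\<Sum>x\<in>UNIV. mean u x)"
      \<comment> \<open>Below 1 the count \<open>R n\<close> must be 0, so no excess among the first
        2^n is truncated; below the square of \<delta> the average \<open>S n\<close> is at most
        \<delta>.\<close>
      have "0 < min 1 (\<delta>\<^sup>2)"
        using \<open>\<delta> > 0\<close> by simp
      then have "\<forall>\<^sub>F n in sequentially. (S n \<omega>)\<^sup>2 + R n \<omega> < min 1 (\<delta>\<^sup>2)"
        using elim by (rule order_tendstoD(2)[rotated])
      then have "\<forall>\<^sub>F n in sequentially. (\<Sum>i<2 ^ n. u (sojourn i \<omega>)) \<le> (\<epsilon> + \<delta>) * 2 ^ n"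
      proof eventually_elim
        case (elim n)
        have R0: "0 \<le> R n \<omega>"
          by (simp add: R_def sum_nonneg)
        have "R n \<omega> < 1"
          using elim zero_le_power2[of "S n \<omega>"] by linarith
        have trunc: "u (sojourn i \<omega>) = v n (sojourn i \<omega>)" if "i < 2 ^ n" for i
        proof (rule ccontr)
          assume "u (sojourn i \<omega>) \<noteq> v n (sojourn i \<omega>)"
          then have "2 ^ n < u (sojourn i \<omega>)"
            by (auto simp: v_def min_def split: if_splits)
          moreover have "of_bool (2 ^ n < u (sojourn i \<omega>)) \<le> R n \<omega>"
            unfolding R_def
            using member_le_sum[of i "{..<2 ^ n}" "\<lambda>i. of_bool (2 ^ n < u (sojourn i \<omega>)) :: real"] that
            by simp
          ultimately have "1 \<le> R n \<omega>"
            by simp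
          then show False
            using \<open>R n \<omega> < 1\<close> by simp
        qed
        have "(S n \<omega>)\<^sup>2 \<le> \<delta>\<^sup>2"
          using elim R0 by linarith
        then have "S n \<omega> \<le> \<delta>"
          by (rule power2_le_imp_le) (use \<open>\<delta> > 0\<close> in simp)
        have mean_le: "mean (v n) x \<le> \<epsilon>" for x
        proof -
          have "mean (v n) x \<le> mean u x"
            unfolding mean_def by (intro integral_mono u_int integrable_bounded_sojourn_law[OF v v_bounds(1,2)] v_bounds)
          also have "\<dots> \<le> \<epsilon>"
            unfolding \<epsilon>_def by (rule member_le_sum) (auto simp: u0 intro!: mean_nonneg)
          finally show ?thesis .
        qed
        have "(\<Sum>i<2 ^ n. u (sojourn i \<omega>)) = (\<Sum>i<2 ^ n. Z n i \<omega> + mean (v n) (X i \<omega>))"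
          by (intro sum.cong) (auto simp: trunc Z_def)
        also have "\<dots> = S n \<omega> * 2 ^ n + (\<Sum>i<2 ^ n. mean (v n) (X i \<omega>))"
          by (simp add: sum.distrib S_def)
        also have "\<dots> \<le> \<delta> * 2 ^ n + (\<Sum>i<(2::nat) ^ n. \<epsilon>)"
          using \<open>S n \<omega> \<le> \<delta>\<close> by (intro add_mono sum_mono mean_le mult_right_mono) auto
        finally show ?case
          by (simp add: algebra_simps)
      qed
      then obtain k where k: "\<And>n. k \<le> n \<Longrightarrow> (\<Sum>i<2 ^ n. u (sojourn i \<omega>)) \<le> (\<epsilon> + \<delta>) * 2 ^ n"
        unfolding eventually_sequentially by blast
      have "0 \<le> \<epsilon>"
        unfolding \<epsilon>_def by (intro sum_nonneg mean_nonneg) (simp add: u0)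
      have "(\<Sum>i<N. u (sojourn i \<omega>)) \<le> 2 * (\<epsilon> + \<delta>) * real N" if N: "2 ^ k \<le> N" for N
      proof -
        have "0 < N"
          using N by (metis gr0I not_less power_eq_0_iff zero_less_numeral zero_neq_numeral le_zero_eq)
        then obtain n where n: "2 ^ n \<le> N" "N < 2 ^ Suc n"
          using ex_power_ivl1[of 2 N] by auto
        have "k \<le> n"
        proof (rule ccontr)
          assume "\<not> k \<le> n"
          then have "(2::nat) ^ Suc n \<le> 2 ^ k"
            by (intro power_increasing) auto
          then show False
            using N n by simp
        qed
        have "(\<Sum>i<N. u (sojourn i \<omega>)) \<le> (\<Sum>i<2 ^ Suc n. u (sojourn i \<omega>))"
          using n by (intro sum_mono2) (auto simp: u0)
        also have "\<dots> \<le> (\<epsilon> + \<delta>) * 2 ^ Suc n"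
          using \<open>k \<le> n\<close> by (intro k) simp
        also have "\<dots> = 2 * (\<epsilon> + \<delta>) * real (2 ^ n)"
          by simp
        also have "\<dots> \<le> 2 * (\<epsilon> + \<delta>) * real N"
          using n(1) \<open>0 \<le> \<epsilon>\<close> \<open>\<delta> > 0\<close> by (intro mult_left_mono) (auto simp del: of_nat_power)
        finally show ?thesis .
      qed
      then show "\<forall>\<^sub>F N in sequentially. (\<Sum>i<N. u (sojourn i \<omega>)) \<le> 2 * ((\<Sum>x\<in>UNIV. mean u x) + \<delta>) * real N"
        unfolding \<epsilon>_def eventually_sequentially by blast
    qed
  qed
qed

end

section \<open>Mean time per jump and the reaction rate\<close>

context ergodic_jump_process
begin

lemma jump_time_average_tendsto:
  "AE \<omega> in P. (\<lambda>N. ennreal (jump_time X W N \<omega> / real N))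
    \<longlonglongrightarrow> (\<Sum>x\<in>UNIV. ennreal (pmf m x) * mean_stay E \<psi> x)"
proof -
  define K where "K = (\<Sum>x\<in>UNIV. ennreal (pmf m x) * mean_stay E \<psi> x)"
  \<comment> \<open>Every node has positive weight in \<open>m\<close>, so a finite weighted sum
    leaves no infinite term.\<close>
  have fin: "mean_stay E \<psi> x < \<infinity>" if "K < \<infinity>" for x
  proof -
    have "ennreal (pmf m x) * mean_stay E \<psi> x \<le> K"
      unfolding K_def by (rule member_le_sum) auto
    then have "ennreal (pmf m x) * mean_stay E \<psi> x < \<infinity>"
      using that by (rule order_le_less_trans)
    then show ?thesis
      using m_pos[of x] by (auto simp: ennreal_mult_less_top)
  qed
  define h where "h k t = max 0 (min t (real k))" for k t
  define u where "u k t = max 0 (t - real k)" for k t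
  have h[measurable]: "h k \<in> borel_measurable borel" and h_bounds: "0 \<le> h k t" "h k t \<le> real k" for k t
    unfolding h_def by auto
  have u[measurable]: "u k \<in> borel_measurable borel" and u0: "0 \<le> u k t" for k t
    unfolding u_def by auto
  define K' where "K' k = (\<Sum>x\<in>UNIV. pmf m x * mean (h k) x)" for k
  have h_mean: "ennreal (mean (h k) x) = (\<integral>\<^sup>+t. ennreal (h k t) \<partial>sojourn_law E \<psi> x)" for k x
    unfolding mean_def
    by (intro nn_integral_eq_integral[symmetric] integrable_bounded_sojourn_law[OF h h_bounds]) (simp add: h_bounds)
  have h_mean_le: "ennreal (mean (h k) x) \<le> mean_stay E \<psi> x" for k x
    unfolding h_mean nn_integral_sojourn_law[OF graph edges_nonempty, symmetric]
  proof (rule nn_integral_mono)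
    show "ennreal (h k t) \<le> ennreal t" for t
      by (cases "0 \<le> t") (auto simp: h_def ennreal_neg intro!: ennreal_leI)
  qed
  have K'_eq: "ennreal (K' k) = (\<Sum>x\<in>UNIV. ennreal (pmf m x) * ennreal (mean (h k) x))" for k
    unfolding K'_def by (subst sum_ennreal[symmetric]) (auto simp: ennreal_mult' mean_nonneg h_bounds)
  have K'_le: "ennreal (K' k) \<le> K" for k
    unfolding K'_eq K_def by (intro sum_mono mult_left_mono h_mean_le) simp
  have K'_lim: "(\<lambda>k. ennreal (K' k)) \<longlonglongrightarrow> K"
  proof -
    have "(\<lambda>k. ennreal (mean (h k) x)) \<longlonglongrightarrow> mean_stay E \<psi> x" for x
      unfolding h_mean nn_integral_sojourn_law[OF graph edges_nonempty, symmetric]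
    proof (rule nn_integral_LIMSEQ)
      show "incseq (\<lambda>k t. ennreal (h k t))"
        by (auto simp: incseq_def le_fun_def h_def intro!: ennreal_leI)
      fix t :: real
      obtain l :: nat where "t \<le> real l"
        using real_arch_simple by blast
      then have "ennreal (h k t) = ennreal t" if "k \<ge> l" for k
        using that by (cases "0 \<le> t") (auto simp: h_def ennreal_neg min_def)
      then show "(\<lambda>k. ennreal (h k t)) \<longlonglongrightarrow> ennreal t"
        by (intro tendsto_eventually eventually_sequentiallyI[of l]) auto
    qed simp
    then show ?thesis
      unfolding K'_eq K_def by (intro tendsto_sum ennreal_tendsto_cmult) auto
  qed
  have "AE \<omega> in P. \<forall>k. (\<lambda>n. (\<Sum>i<n. h k (sojourn i \<omega>)) / real n) \<longlonglongrightarrow> K' k"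
    unfolding AE_all_countable K'_def by (intro allI bounded_sojourn_averages[OF h h_bounds])
  \<comment> \<open>The excess estimate is wanted only for upper bounds \<open>a\<close> above
    \<open>K\<close>; such an \<open>a\<close> exists only if \<open>K\<close> is finite.\<close>
  moreover have "AE \<omega> in P. K < \<infinity> \<longrightarrow> (\<forall>k. \<forall>\<delta>>0. \<forall>\<^sub>F N in sequentially.
      (\<Sum>i<N. u k (sojourn i \<omega>)) \<le> 2 * ((\<Sum>x\<in>UNIV. mean (u k) x) + \<delta>) * real N)"
  proof (cases "K < \<infinity>")
    case True
    then show ?thesis
      unfolding u_def using sojourn_excess_averages[OF fin] by (simp add: AE_all_countable)
  qed simp
  ultimately show ?thesis
    using sojourn_pos
  proof eventually_elim
    case (elim \<omega>)
    let ?t = "\<lambda>N. jump_time X W N \<omega>"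
    have split: "?t N = (\<Sum>i<N. h k (sojourn i \<omega>)) + (\<Sum>i<N. u k (sojourn i \<omega>))" for k N
      unfolding jump_time_eq sum.distrib[symmetric] using elim(3)
      by (intro sum.cong refl) (auto simp: h_def u_def max_def min_def less_le)
    show ?case
      unfolding K_def[symmetric]
    proof (rule order_tendstoI)
      fix a assume "a < K"
      then obtain k where "a < ennreal (K' k)"
        using order_tendstoD(1)[OF K'_lim] by (metis eventually_sequentially order_refl)
      moreover have "(\<lambda>N. ennreal ((\<Sum>i<N. h k (sojourn i \<omega>)) / real N)) \<longlonglongrightarrow> ennreal (K' k)"
        using elim(1) by (intro tendsto_ennrealI) blast
      ultimately have "\<forall>\<^sub>F N in sequentially. a < ennreal ((\<Sum>i<N. h k (sojourn i \<omega>)) / real N)"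
        by (rule order_tendstoD(1)[rotated])
      then show "\<forall>\<^sub>F N in sequentially. a < ennreal (?t N / real N)"
      proof eventually_elim
        case (elim N)
        also have "ennreal ((\<Sum>i<N. h k (sojourn i \<omega>)) / real N) \<le> ennreal (?t N / real N)"
          unfolding split[of _ k] by (intro ennreal_leI divide_right_mono) (auto simp: sum_nonneg u0)
        finally show ?case .
      qed
    next
      fix a assume "K < a"
      then obtain b where b: "K < b" "b < a"
        using dense by blast
      define K\<^sub>r where "K\<^sub>r = enn2real K"
      have K: "K = ennreal K\<^sub>r" "K < \<infinity>" "0 \<le> K\<^sub>r"
        using order_less_le_trans[OF b(1) top_greatest] by (auto simp: K\<^sub>r_def)
      obtain b' where b': "b = ennreal b'" "0 \<le> b'"
        using b by (cases b) auto
      \<comment> \<open>Error budget: the truncated part exceeds \<open>K\<^sub>r\<close> by less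
        than \<eta>, and the doubled excess is below 2 \<eta>, so a quarter of the gap is
        ample.\<close>
      define \<eta> where "\<eta> = (b' - K\<^sub>r) / 4"
      have \<eta>: "\<eta> > 0"
        using b(1) K unfolding b'(1) \<eta>_def by (simp add: ennreal_less_iff)
      have "b' = K\<^sub>r + 4 * \<eta>"
        by (simp add: \<eta>_def field_simps)
      then have combine: "y + z \<le> b'"
        if "y < K\<^sub>r + \<eta>" "z \<le> 2 * (e + \<eta> / 2)" "e < \<eta> / 2" for y z e :: real
        using that \<eta> by (simp add: field_simps)
      \<comment> \<open>Dominated convergence makes the mean excess over \<open>k\<close> as small
        as desired, which absorbs the factor 2 of \<open>sojourn_excess_averages\<close>.\<close>
      have "(\<lambda>k. \<Sum>x\<in>UNIV. mean (u k) x) \<longlonglongrightarrow> (\<Sum>(x::'v)\<in>UNIV. 0)"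
      proof (rule tendsto_sum)
        fix x :: 'v
        have "(\<lambda>k. LINT t|sojourn_law E \<psi> x. u k t) \<longlonglongrightarrow> (LINT t|sojourn_law E \<psi> x. 0)"
        proof (rule integral_dominated_convergence[where w="\<lambda>t. max 0 t"])
          have "(\<integral>\<^sup>+t. ennreal (max 0 t) \<partial>sojourn_law E \<psi> x) = mean_stay E \<psi> x"
            unfolding nn_integral_sojourn_law[OF graph edges_nonempty, symmetric]
            by (intro nn_integral_cong) (simp add: max_def ennreal_neg)
          then show "integrable (sojourn_law E \<psi> x) (\<lambda>t. max 0 t)"
            using fin[OF K(2), of x] by (intro integrableI_bounded) auto
          show "AE t in sojourn_law E \<psi> x. (\<lambda>k. u k t) \<longlonglongrightarrow> 0"
          proof (rule AE_I2)
            fix t :: real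
            obtain l :: nat where "t \<le> real l"
              using real_arch_simple by blast
            then have "u k t = 0" if "k \<ge> l" for k
              using that by (auto simp: u_def)
            then show "(\<lambda>k. u k t) \<longlonglongrightarrow> 0"
              by (intro tendsto_eventually eventually_sequentiallyI[of l]) auto
          qed
          show "AE t in sojourn_law E \<psi> x. norm (u k t) \<le> max 0 t" for k
            by (auto simp: u_def)
        qed auto
        then show "(\<lambda>k. mean (u k) x) \<longlonglongrightarrow> 0"
          by (simp add: mean_def)
      qed
      then have "\<forall>\<^sub>F k in sequentially. (\<Sum>x\<in>UNIV. mean (u k) x) < \<eta> / 2"
        using \<eta> by (intro order_tendstoD(2)) auto
      then obtain k where k: "(\<Sum>x\<in>UNIV. mean (u k) x) < \<eta> / 2"
        using eventually_happens'[OF sequentially_bot] by blast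
      have "K' k \<le> K\<^sub>r"
        using K'_le[of k] K by simp
      then have "\<forall>\<^sub>F N in sequentially. (\<Sum>i<N. h k (sojourn i \<omega>)) / real N < K\<^sub>r + \<eta>"
        using elim(1) \<eta> by (intro order_tendstoD(2)[of _ "K' k"]) auto
      moreover have "\<forall>\<^sub>F N in sequentially.
          (\<Sum>i<N. u k (sojourn i \<omega>)) \<le> 2 * ((\<Sum>x\<in>UNIV. mean (u k) x) + \<eta> / 2) * real N"
        using \<eta> by (intro elim(2)[rule_format, OF K(2)]) simp
      ultimately show "\<forall>\<^sub>F N in sequentially. ennreal (?t N / real N) < a"
        using eventually_gt_at_top[of 0]
      proof eventually_elim
        case (elim N)
        have "(\<Sum>i<N. u k (sojourn i \<omega>)) / real N \<le> 2 * ((\<Sum>x\<in>UNIV. mean (u k) x) + \<eta> / 2)"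
          using elim by (simp add: divide_le_eq)
        then have "?t N / real N \<le> b'"
          unfolding split[of N k] add_divide_distrib by (rule combine[OF elim(1) _ k])
        then have "ennreal (?t N / real N) \<le> b"
          unfolding b' by (rule ennreal_leI)
        then show ?case
          using b(2) by (rule order_le_less_trans)
      qed
    qed
  qed
qed

lemma mean_stay_pos: "0 < mean_stay E \<psi> x"
proof (rule ccontr)
  interpret S: prob_space "sojourn_law E \<psi> x"
    by (rule prob_space_sojourn_law[OF graph])
  assume "\<not> 0 < mean_stay E \<psi> x"
  then have "(\<integral>\<^sup>+t. ennreal t \<partial>sojourn_law E \<psi> x) = 0"
    by (simp add: nn_integral_sojourn_law[OF graph edges_nonempty])
  then have "AE t in sojourn_law E \<psi> x. ennreal t = 0"
    by (subst (asm) nn_integral_0_iff_AE) auto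
  with AE_sojourn_law_pos[OF graph edges_nonempty] have "AE t in sojourn_law E \<psi> x. False"
    by eventually_elim simp
  then show False
    by simp
qed

text \<open>Quotient of the two averages per jump. Inversion is continuous on
  \<open>ennreal\<close>, so an infinite mean sojourn time gives the limit 0 without a separate
  case.\<close>

theorem reaction_rate:
  assumes AB: "A \<inter> B = {}"
  shows "AE \<omega> in P.
    (\<lambda>N. ennreal (real (reaction_count A B (\<lambda>i. X i \<omega>) N) / jump_time X W N \<omega>))
      \<longlonglongrightarrow> ennreal (\<Sum>x\<in>A. \<Sum>y\<in>UNIV. pmf m x * p x y * committor p A B y)
          / (\<Sum>x\<in>UNIV. ennreal (pmf m x) * mean_stay E \<psi> x)"
  using reaction_count_average_tendsto[OF AB] jump_time_average_tendsto sojourn_pos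
proof eventually_elim
  case (elim \<omega>)
  let ?M = "\<lambda>N. real (reaction_count A B (\<lambda>i. X i \<omega>) N)" and ?t = "\<lambda>N. jump_time X W N \<omega>"
  let ?r = "\<Sum>x\<in>A. \<Sum>y\<in>UNIV. pmf m x * p x y * committor p A B y"
  let ?K = "\<Sum>x\<in>UNIV. ennreal (pmf m x) * mean_stay E \<psi> x"
  \<comment> \<open>Keeps \<open>inverse ?K\<close> finite, so that the product of the limits is not
    of the form 0 times infinity.\<close>
  have "?K \<noteq> 0"
    using m_pos[of undefined] mean_stay_pos[of undefined]
    by (auto simp: ennreal_eq_0_iff not_le intro!: exI[of _ undefined])
  have "(\<lambda>N. inverse (ennreal (?t N / real N))) \<longlonglongrightarrow> inverse ?K"
  proof (rule continuous_on_tendsto_compose[OF _ elim(2)])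
    show "continuous_on UNIV (inverse :: ennreal \<Rightarrow> ennreal)"
      by (intro continuous_on_inverse_ennreal continuous_on_id)
  qed simp_all
  moreover have "(\<lambda>N. ennreal (?M N / real N)) \<longlonglongrightarrow> ennreal ?r"
    using elim(1) by (rule tendsto_ennrealI)
  ultimately have "(\<lambda>N. ennreal (?M N / real N) * inverse (ennreal (?t N / real N))) \<longlonglongrightarrow> ennreal ?r * inverse ?K"
    using \<open>?K \<noteq> 0\<close> by (intro tendsto_mult_ennreal) auto
  moreover have "\<forall>\<^sub>F N in sequentially.
      ennreal (?M N / real N) * inverse (ennreal (?t N / real N)) = ennreal (?M N / ?t N)"
    using eventually_gt_at_top[of 0]
  proof eventually_elim
    case (elim N)
    have "0 < ?t N"
      unfolding jump_time_eq using \<open>\<forall>i. 0 < sojourn i \<omega>\<close> elim by (intro sum_pos) auto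
    then show ?case
      using elim by (simp add: divide_ennreal_def[symmetric] divide_ennreal)
  qed
  ultimately show ?case
    unfolding divide_ennreal_def by (rule Lim_transform_eventually)
qed

end

theorem proposition10:
  fixes E :: "('v::finite \<times> 'v) set"
    and \<psi> :: "'v \<Rightarrow> 'v \<Rightarrow> real \<Rightarrow> real"
    and A B :: "'v set"
    and m :: "'v pmf"
    and P :: "'w measure"
    and X :: "nat \<Rightarrow> 'w \<Rightarrow> 'v"
    and W :: "nat \<Rightarrow> 'v \<Rightarrow> 'w \<Rightarrow> real"
  defines "p \<equiv> trans_prob E \<psi>"
    and "q \<equiv> committor (trans_prob E \<psi>) A B"
    and "\<kappa> \<equiv> mean_stay E \<psi>"
  assumes "CARD('v) > 1"
    and "waiting_graph E \<psi>"
    and "A \<inter> B = {}" and "A \<noteq> {}" and "B \<noteq> {}" and "- (A \<union> B) \<noteq> {}"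
    and "ergodic_chain p"
    and "\<And>\<mu>. invariant_dist p \<mu> \<longleftrightarrow> \<mu> = m"
    and "jump_process P E \<psi> m X W"
  shows "AE \<omega> in P.
    (\<lambda>N. ennreal (real (reaction_count A B (\<lambda>i. X i \<omega>) N) / jump_time X W N \<omega>))
      \<longlonglongrightarrow> ennreal (\<Sum>x\<in>A. \<Sum>y\<in>UNIV. pmf m x * p x y * q y)
          / (\<Sum>x\<in>UNIV. ennreal (pmf m x) * \<kappa> x)"
proof -
  interpret jump_process P E \<psi> m X W
    by fact
  interpret ergodic_jump_process P E \<psi> m X W
    using assms(5,10,11) by unfold_locales (auto simp: p_def ergodic_chain_def)
  show ?thesis
    unfolding p_def q_def \<kappa>_def by (rule reaction_rate) fact
qed

end
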